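(* Let $Q=D[H_1,\dots, H_t]$ be a composition of digraphs with $t\geq 2$, where $D$ has $t$ vertices, let $n_i=|V(H_i)|$ for $1\le i\le t$ and let $n_0=\min\{n_i\mid 1\le i\le t\}$. Then for any $S\subseteq V(Q)$ with $2\leq |S|\leq |V(Q)|$, $Q$ has at least $n_0$ pairwise arc-disjoint $S$-strong subgraphs if one of the following conditions holds: (i) $D$ is a strong symmetric digraph; (ii) $D$ is a strong semicomplete digraph and $Q\not\in \mathcal{Q}_0$. Moreover, these strong subgraphs can be found in time $O(n^4)$, where $n$ is the order of $Q$.
   Context: Digraphs are finite, without loops or parallel arcs (pairs of opposite arcs are allowed). A digraph is strong if for every pair of vertices $x,y$ there is a directed path from $x$ to $y$ and a directed path from $y$ to $x$. A digraph is symmetric if for every arc $xy$ the opposite arc $yx$ is also present; it is semicomplete if for every two distinct vertices $x,y$ at least one of the arcs $xy,yx$ is present. Composition: let $D$ be a digraph with $V(D)=\{u_i\mid 1\le i\le t\}$ and let $H_1,\dots,H_t$ be digraphs with $V(H_i)=\{u_{i,j_i}\mid 1\le j_i\le n_i\}$. The composition $Q=D[H_1,\dots,H_t]$ is the digraph with vertex set $\bigcup_{i=1}^t V(H_i)$ and arc set $\left(\bigcup_{i=1}^t A(H_i)\right)\cup\left(\bigcup_{u_iu_p\in A(D)}\{u_{i,j_i}u_{p,q_p}\mid 1\le j_i\le n_i,\ 1\le q_p\le n_p\}\right)$. For $S\subseteq V(Q)$, an $S$-strong subgraph of $Q$ is a strong subgraph $H$ of $Q$ with $S\subseteq V(H)$;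 $S$-strong subgraphs are arc-disjoint if no two of them share an arc. $\overrightarrow{C}_3$ is the directed cycle on 3 vertices, $\overrightarrow{P_2}$ is the directed path on 2 vertices, $\overline{K_r}$ is the digraph on $r$ vertices with no arcs, and $\mathcal{Q}_0=\{\overrightarrow{C}_3[\overline{K_2},\overline{K_2},\overline{K_2}],\ \overrightarrow{C}_3[\overrightarrow{P_2},\overline{K_2},\overline{K_2}],\ \overrightarrow{C}_3[\overline{K_2},\overline{K_2},\overline{K_3}]\}$ (membership is up to isomorphism). *)

theory Defs
  imports "Graph_Theory.Graph_Theory"
begin

section \<open>Digraphs and compositions\<close>

text \<open>Digraphs are the digraphs \<^locale>\<open>pair_digraph\<close> of the Graph Theory entry: finite, loop-free,
  arcs are pairs of vertices. Strong means \<^const>\<open>strongly_connected\<close>.\<close>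

definition semicomplete :: "'a pair_pre_digraph \<Rightarrow> bool" where
  "semicomplete D \<longleftrightarrow>
     (\<forall>x\<in>pverts D. \<forall>y\<in>pverts D. x \<noteq> y \<longrightarrow> (x, y) \<in> parcs D \<or> (y, x) \<in> parcs D)"

text \<open>The digraphs \<open>H\<^sub>i\<close> are indexed by the vertices of \<open>D\<close>. Pairing each vertex of \<open>H u\<close> with \<open>u\<close>
  makes the vertex sets of the parts disjoint.\<close>

definition composition ::
    "'a pair_pre_digraph \<Rightarrow> ('a \<Rightarrow> 'b pair_pre_digraph) \<Rightarrow> ('a \<times> 'b) pair_pre_digraph" where
  "composition D H =
     \<lparr> pverts = (SIGMA u:pverts D. pverts (H u)),
       parcs = {((u, x), (u, y)) | u x y. u \<in> pverts D \<and> (x, y) \<in> parcs (H u)} \<union>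
               {((u, x), (v, y)) | u v x y.
                  (u, v) \<in> parcs D \<and> x \<in> pverts (H u) \<and> y \<in> pverts (H v)} \<rparr>"

definition min_part :: "'a pair_pre_digraph \<Rightarrow> ('a \<Rightarrow> 'b pair_pre_digraph) \<Rightarrow> nat" where
  "min_part D H = Min ((\<lambda>u. card (pverts (H u))) ` pverts D)"

definition strong_subgraph_containing ::
    "'v pair_pre_digraph \<Rightarrow> 'v set \<Rightarrow> 'v pair_pre_digraph \<Rightarrow> bool" where
  "strong_subgraph_containing Q S F \<longleftrightarrow>
     subgraph (with_proj F) (with_proj Q) \<and> strongly_connected (with_proj F) \<and> S \<subseteq> pverts F"

definition arc_disjoint_strong_subgraphs ::
    "'v pair_pre_digraph \<Rightarrow> 'v set \<Rightarrow> 'v pair_pre_digraph set \<Rightarrow> bool" where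
  "arc_disjoint_strong_subgraphs Q S \<F> \<longleftrightarrow>
     finite \<F> \<and> (\<forall>F\<in>\<F>. strong_subgraph_containing Q S F) \<and>
     pairwise (\<lambda>F F'. disjnt (parcs F) (parcs F')) \<F>"

definition dicycle3 :: "nat pair_pre_digraph" where
  "dicycle3 = \<lparr> pverts = {0, 1, 2}, parcs = {(0, 1), (1, 2), (2, 0)} \<rparr>"

definition dipath2 :: "nat pair_pre_digraph" where
  "dipath2 = \<lparr> pverts = {0, 1}, parcs = {(0, 1)} \<rparr>"

definition arcless :: "nat \<Rightarrow> nat pair_pre_digraph" where
  "arcless r = \<lparr> pverts = {..<r}, parcs = {} \<rparr>"

definition Q0 :: "(nat \<times> nat) pair_pre_digraph set" where
  "Q0 = {composition dicycle3 (\<lambda>i. [arcless 2, arcless 2, arcless 2] ! i),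
         composition dicycle3 (\<lambda>i. [dipath2, arcless 2, arcless 2] ! i),
         composition dicycle3 (\<lambda>i. [arcless 2, arcless 2, arcless 3] ! i)}"

definition in_Q0 :: "'v pair_pre_digraph \<Rightarrow> bool" where
  "in_Q0 Q \<longleftrightarrow> (\<exists>R\<in>Q0. digraph_iso (with_proj Q) (with_proj R))"

definition packing_hypotheses ::
    "'a pair_pre_digraph \<Rightarrow> ('a \<Rightarrow> 'b pair_pre_digraph) \<Rightarrow> ('a \<times> 'b) set \<Rightarrow> bool" where
  "packing_hypotheses D H S \<longleftrightarrow>
     pair_digraph D \<and> (\<forall>u\<in>pverts D. pair_digraph (H u)) \<and> 2 \<le> card (pverts D) \<and>
     S \<subseteq> pverts (composition D H) \<and> 2 \<le> card S \<and> card S \<le> card (pverts (composition D H)) \<and>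
     (strongly_connected (with_proj D) \<and> symmetric (with_proj D) \<or>
      strongly_connected (with_proj D) \<and> semicomplete D \<and> \<not> in_Q0 (composition D H))"


section \<open>Machine model for running times\<close>

text \<open>A word RAM, presented as a while language. The memory consists of finitely many named
  multi-dimensional arrays of words; a scalar is an array with the empty index list. The memory is
  total, but a program only mentions finitely many array names and index lengths, so this is a RAM
  with row-major addressing. Elementary operations have unit cost. The word bound \<open>w\<close> prevents
  computations with large numbers in unit time: execution is stuck (there is no run) as soon as
  some value, including a constant, an array index or an intermediate result, exceeds \<open>w\<close>.
  Truth values are \<open>0\<close> and \<open>1\<close>, and any nonzero condition counts as true.\<close>

datatype binop = Add | Sub | Mul | Div | Mod | Less | Eq

fun apply_binop :: "binop \<Rightarrow> nat \<Rightarrow> nat \<Rightarrow> nat" where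
  "apply_binop Add m n = m + n"
| "apply_binop Sub m n = m - n"
| "apply_binop Mul m n = m * n"
| "apply_binop Div m n = m div n"
| "apply_binop Mod m n = m mod n"
| "apply_binop Less m n = of_bool (m < n)"
| "apply_binop Eq m n = of_bool (m = n)"

datatype exp = Num nat | Get string "exp list" | Bin binop exp exp

type_synonym state = "string \<Rightarrow> nat list \<Rightarrow> nat"

fun eval :: "state \<Rightarrow> exp \<Rightarrow> nat" where
  "eval s (Num k) = k"
| "eval s (Get a es) = s a (map (eval s) es)"
| "eval s (Bin f e1 e2) = apply_binop f (eval s e1) (eval s e2)"

fun cost :: "exp \<Rightarrow> nat" where
  "cost (Num k) = 1"
| "cost (Get a es) = 1 + sum_list (map cost es)"
| "cost (Bin f e1 e2) = 1 + cost e1 + cost e2"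

fun fits :: "nat \<Rightarrow> state \<Rightarrow> exp \<Rightarrow> bool" where
  "fits w s (Num k) \<longleftrightarrow> k \<le> w"
| "fits w s (Get a es) \<longleftrightarrow> (\<forall>e\<in>set es. fits w s e) \<and> eval s (Get a es) \<le> w"
| "fits w s (Bin f e1 e2) \<longleftrightarrow> fits w s e1 \<and> fits w s e2 \<and> eval s (Bin f e1 e2) \<le> w"

datatype com =
    Skip
  | Put string "exp list" exp
  | Seq com com
  | Cond exp com com
  | While exp com

text \<open>\<open>runs w c s T s'\<close>: with word bound \<open>w\<close>, program \<open>c\<close> started in \<open>s\<close> halts in \<open>s'\<close> after \<open>T\<close> steps.\<close>

inductive runs :: "nat \<Rightarrow> com \<Rightarrow> state \<Rightarrow> nat \<Rightarrow> state \<Rightarrow> bool" for w :: nat where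
  Skip: "runs w Skip s 1 s"
| Put: "\<forall>e'\<in>set (e # es). fits w s e' \<Longrightarrow>
    runs w (Put a es e) s (1 + sum_list (map cost (e # es)))
      (s(a := (s a)(map (eval s) es := eval s e)))"
| Seq: "runs w c1 s T1 s1 \<Longrightarrow> runs w c2 s1 T2 s2 \<Longrightarrow> runs w (Seq c1 c2) s (1 + T1 + T2) s2"
| CondTrue: "fits w s e \<Longrightarrow> eval s e \<noteq> 0 \<Longrightarrow> runs w c1 s T s1 \<Longrightarrow>
    runs w (Cond e c1 c2) s (1 + cost e + T) s1"
| CondFalse: "fits w s e \<Longrightarrow> eval s e = 0 \<Longrightarrow> runs w c2 s T s1 \<Longrightarrow>
    runs w (Cond e c1 c2) s (1 + cost e + T) s1"
| WhileFalse: "fits w s e \<Longrightarrow> eval s e = 0 \<Longrightarrow> runs w (While e c) s (1 + cost e) s"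
| WhileTrue: "fits w s e \<Longrightarrow> eval s e \<noteq> 0 \<Longrightarrow> runs w c s T1 s1 \<Longrightarrow>
    runs w (While e c) s1 T2 s2 \<Longrightarrow> runs w (While e c) s (1 + cost e + T1 + T2) s2"

inductive_cases runs_SkipE: "runs w Skip s T s'"
inductive_cases runs_PutE: "runs w (Put a es e) s T s'"
inductive_cases runs_SeqE: "runs w (Seq c1 c2) s T s'"
inductive_cases runs_CondE: "runs w (Cond e c1 c2) s T s'"
inductive_cases runs_WhileE: "runs w (While e c) s T s'"

lemma runs_deterministic:
  "runs w c s T s' \<Longrightarrow> runs w c s T' s'' \<Longrightarrow> T' = T \<and> s'' = s'"
proof (induction arbitrary: T' s'' rule: runs.induct)
  case (Skip s)
  then show ?case by (rule runs_SkipE) simp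
next
  case (Put e es s a)
  from Put.prems show ?case by (rule runs_PutE) simp
next
  case (Seq c1 s T1 s1 c2 T2 s2)
  from Seq.prems obtain U1 U2 r where r: "runs w c1 s U1 r" "runs w c2 r U2 s''" "T' = 1 + U1 + U2"
    by (rule runs_SeqE) (erule (1) that, simp)
  from Seq.IH(1)[OF r(1)] Seq.IH(2)[of U2 s''] r show ?case by simp
next
  case (CondTrue s e c1 T s1 c2)
  from CondTrue.prems obtain U where r: "runs w c1 s U s''" "T' = 1 + cost e + U"
    by (rule runs_CondE) (erule that, simp, simp add: CondTrue.hyps(2))
  from CondTrue.IH[OF r(1)] r(2) show ?case by simp
next
  case (CondFalse s e c2 T s1 c1)
  from CondFalse.prems obtain U where r: "runs w c2 s U s''" "T' = 1 + cost e + U"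
    by (rule runs_CondE) (simp add: CondFalse.hyps(2), erule that, simp)
  from CondFalse.IH[OF r(1)] r(2) show ?case by simp
next
  case (WhileFalse s e c)
  from WhileFalse.prems show ?case
    by (rule runs_WhileE) (simp_all add: WhileFalse.hyps)
next
  case (WhileTrue s e c T1 s1 T2 s2)
  from WhileTrue.prems obtain U1 U2 r
    where r: "runs w c s U1 r" "runs w (While e c) r U2 s''" "T' = 1 + cost e + U1 + U2"
    by (rule runs_WhileE) (simp add: WhileTrue.hyps(2), erule (1) that, simp)
  from WhileTrue.IH(1)[OF r(1)] WhileTrue.IH(2)[of U2 s''] r show ?case by simp
qed


section \<open>Input and output of the algorithm\<close>

definition standard_labels :: "nat pair_pre_digraph \<Rightarrow> (nat \<Rightarrow> nat pair_pre_digraph) \<Rightarrow> bool" where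
  "standard_labels D H \<longleftrightarrow>
     (\<exists>t. pverts D = {..<t}) \<and> (\<forall>i\<in>pverts D. \<exists>m. pverts (H i) = {..<m})"

text \<open>The input consists of \<open>t\<close>, the orders of the \<open>H\<^sub>i\<close>, the adjacency matrices of \<open>D\<close> and
  of the \<open>H\<^sub>i\<close>, and the characteristic function of \<open>S\<close>. All other memory cells are \<open>0\<close>.\<close>

definition input_state ::
    "nat pair_pre_digraph \<Rightarrow> (nat \<Rightarrow> nat pair_pre_digraph) \<Rightarrow> (nat \<times> nat) set \<Rightarrow> state" where
  "input_state D H S = (\<lambda>a is.
     if a = ''t'' \<and> is = [] then card (pverts D)
     else if a = ''order'' then
       (case is of [i] \<Rightarrow> if i \<in> pverts D then card (pverts (H i)) else 0 | _ \<Rightarrow> 0)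
     else if a = ''D'' then
       (case is of [i, j] \<Rightarrow> of_bool ((i, j) \<in> parcs D) | _ \<Rightarrow> 0)
     else if a = ''H'' then
       (case is of [i, p, q] \<Rightarrow> of_bool (i \<in> pverts D \<and> (p, q) \<in> parcs (H i)) | _ \<Rightarrow> 0)
     else if a = ''S'' then
       (case is of [i, p] \<Rightarrow> of_bool ((i, p) \<in> S) | _ \<Rightarrow> 0)
     else 0)"

text \<open>The output is a list of subgraphs: the length is stored in \<open>count\<close>, and the \<open>l\<close>-th
  subgraph is given by the characteristic functions of its vertex set and of its arc set.\<close>

definition output_subgraph :: "state \<Rightarrow> nat \<Rightarrow> (nat \<times> nat) pair_pre_digraph" where
  "output_subgraph s l =
     \<lparr> pverts = {(i, p). s ''V'' [l, i, p] \<noteq> 0},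
       parcs = {((i, p), (j, q)). s ''A'' [l, i, p, j, q] \<noteq> 0} \<rparr>"

definition output_subgraphs :: "state \<Rightarrow> (nat \<times> nat) pair_pre_digraph set" where
  "output_subgraphs s = output_subgraph s ` {..<s ''count'' []}"

text \<open>\<open>O(n\<^sup>4)\<close> steps on a machine with words of \<open>O(log n)\<close> bits, \<open>n\<close> being the order of the
  composition. If all \<open>H\<^sub>i\<close> are nonempty then \<open>t \<le> n\<close>; the summand \<open>t\<close> in the word bound
  only matters if some \<open>H\<^sub>i\<close> is empty, as the machine must be able to read \<open>t\<close>.\<close>

definition packing_algorithm :: "com \<Rightarrow> bool" where
  "packing_algorithm P \<longleftrightarrow>
     (\<exists>C b e. \<forall>D H S. packing_hypotheses D H S \<and> standard_labels D H \<longrightarrow>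
        (let Q = composition D H; n = card (pverts Q); t = card (pverts D) in
         \<exists>T s. runs (b * (n + t) ^ e) P (input_state D H S) T s \<and> T \<le> C * n ^ 4 \<and>
           arc_disjoint_strong_subgraphs Q S (output_subgraphs s) \<and>
           min_part D H \<le> card (output_subgraphs s)))"

end

theory Submission
  imports Defs "HOL-Combinatorics.Transposition"
begin

text \<open>
  The subgraphs built here are spanning, so they contain every \<open>S\<close>. Write \<open>n\<close> for the least order of
  a part and number the vertices of each part. The \<^emph>\<open>core\<close> consists of the first \<open>n\<close> vertices of
  every part (of a few more in one special case). The arcs inside the core are coloured with \<open>n\<close>
  colours such that every colour class is strong on the core. Any other vertex \<open>x\<close> of a part \<open>u\<close>
  is then attached to colour \<open>i\<close> by its arcs to and from the \<open>i\<close>-th vertices of the neighbouring parts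
  (\<open>core_packing_extends\<close>); different colours use different arcs.

  The core is \<open>V(D) \<times> \<int>\<^sub>n\<close>. Over an arc \<open>uv\<close> of \<open>D\<close> colour \<open>i\<close> gets the arcs from \<open>(u, p)\<close> to
  \<open>(v, p + f i)\<close>, where the shifts \<open>f i\<close> of different colours differ modulo \<open>n\<close>. As \<open>D\<close> is strong and
  each shift is a bijection, a walk of \<open>D\<close> lifts from every start and to every end, so a colour class
  is strong as soon as it connects the copies of a single vertex of \<open>D\<close> (\<open>layered_core_packing\<close>). For
  that it suffices that the shifts along one closed walk of \<open>D\<close> add up to a generator of \<open>\<int>\<^sub>n\<close>.

  If \<open>D\<close> has two opposite arcs, the shifts \<open>i\<close> and \<open>1 - i\<close> on them have the sum \<open>1\<close> for every
  colour; on a closed walk of four arcs the shifts \<open>i, -i, i, 1 - i\<close> do the same. Both cases are treated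
  as one, as an arc traversed forth and back twice is a closed walk of length four
  (\<open>walk_core_packing\<close>). Every strong symmetric digraph has such a walk, and a strong semicomplete
  digraph without one is the directed triangle (\<open>semicomplete_no_closed_4_walk\<close>).

  On the triangle the shifts must be balanced over three arcs. Three explicit families of shifts do this if \<open>n\<close> is odd or divisible by \<open>4\<close>. If \<open>n = 2 m\<close> with
  \<open>m\<close> odd, pure shifts cannot work: generators of \<open>\<int>\<^sub>n\<close> are odd, so \<open>n\<close> of them have an even sum,
  but the three families have the total \<open>3 n (n - 1) / 2\<close>, which is odd. For \<open>n \<ge> 6\<close> a permutation of
  at most three elements before the shifts of one arc repairs the parity (\<open>triangle_core_packing\<close>). For
  \<open>n = 2\<close> the parity can only be repaired by further vertices or arcs, and these are missing in the
  three exceptional digraphs: every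
  composition of the triangle with \<open>n = 2\<close> either contains one of seven small patterns up to rotation, for which
  two arc-disjoint closed spanning walks are listed, or is exceptional (\<open>fitting_pattern_exists\<close>).

  All of this is explicit, and the most expensive search is that for a closed walk of length four,
  which four nested loops do in \<open>O(n\<^sup>4)\<close> steps. The program writes out the coloured arcs by further nested loops.
  It is verified in a program logic for total correctness whose judgements carry a time bound;
  a loop over at most \<open>M\<close> values turns a bound \<open>k M\<^sup>d\<close> for its body into \<open>(k + 20) M\<^sup>d\<^sup>+\<^sup>1\<close>
  (\<open>halts_For\<close>).
\<close>

section \<open>Strong digraphs\<close>

lemma strongly_connected_iff_rtrancl:
  assumes "pair_wf_digraph G"
  shows "strongly_connected (with_proj G) \<longleftrightarrow>
    pverts G \<noteq> {} \<and> (\<forall>u\<in>pverts G. \<forall>v\<in>pverts G. (u, v) \<in> (parcs G)\<^sup>*)"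
proof -
  interpret pair_wf_digraph G by fact
  have "reachable (with_proj G) u v \<longleftrightarrow> (u, v) \<in> (parcs G)\<^sup>*" if "u \<in> pverts G" for u v
  proof
    assume "(u, v) \<in> (parcs G)\<^sup>*"
    then show "reachable (with_proj G) u v"
    proof induction
      case base
      show ?case using that by simp
    next
      case (step y z)
      then show ?case unfolding reachable_def
        by (auto intro: rtrancl_on_into_rtrancl_on dest: in_arcsD2)
    qed
  next
    assume "reachable (with_proj G) u v"
    then show "(u, v) \<in> (parcs G)\<^sup>*"
      unfolding reachable_def by (auto dest: rtrancl_on_rtranclI)
  qed
  then show ?thesis unfolding strongly_connected_def by auto
qed

locale strong_digraph = pair_digraph D for D :: "'a pair_pre_digraph" +
  assumes strong: "strongly_connected (with_proj D)"
    and two_vertices: "2 \<le> card (pverts D)"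
begin

lemma vertices_reachable: "u \<in> pverts D \<Longrightarrow> v \<in> pverts D \<Longrightarrow> (u, v) \<in> (parcs D)\<^sup>*"
  using strong strongly_connected_iff_rtrancl[OF pair_wf_digraph] by blast

lemma irreflexive [simp]: "(u, u) \<notin> parcs D"
  using pair_no_loops[of "(u, u)"] by auto

lemma leaving_arc:
  assumes "x \<in> X" "x \<in> pverts D" "y \<notin> X" "y \<in> pverts D"
  obtains a b where "(a, b) \<in> parcs D" "a \<in> X" "b \<notin> X"
proof -
  have "(x, y) \<in> (parcs D)\<^sup>*" using assms vertices_reachable by blast
  then have "y \<notin> X \<longrightarrow> (\<exists>a b. (a, b) \<in> parcs D \<and> a \<in> X \<and> b \<notin> X)"
    using \<open>x \<in> X\<close> by (induction) auto
  then show thesis using that \<open>y \<notin> X\<close> by blast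
qed

lemma other_vertex: obtains v where "v \<in> pverts D" "v \<noteq> u"
proof -
  have "\<not> pverts D \<subseteq> {u}" using two_vertices card_mono[of "{u}" "pverts D"] by auto
  then show thesis using that by blast
qed

lemma out_arc: assumes "u \<in> pverts D" obtains v where "(u, v) \<in> parcs D"
proof -
  obtain v where "v \<in> pverts D" "v \<noteq> u" by (rule other_vertex)
  then show thesis using leaving_arc[of u "{u}" v] assms that by auto
qed

lemma in_arc: assumes "u \<in> pverts D" obtains v where "(v, u) \<in> parcs D"
proof -
  obtain v where "v \<in> pverts D" "v \<noteq> u" by (rule other_vertex)
  then show thesis using leaving_arc[of v "- {u}" u] assms that by auto
qed

end


section \<open>Extending a packing of the core to the whole composition\<close>

locale numbered_composition = strong_digraph D for D :: "'a pair_pre_digraph" +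
  fixes H :: "'a \<Rightarrow> 'b pair_pre_digraph" and E :: "'a \<Rightarrow> nat \<Rightarrow> 'b" and n :: nat
  assumes parts: "u \<in> pverts D \<Longrightarrow> pair_digraph (H u)"
    and numbering: "u \<in> pverts D \<Longrightarrow> bij_betw (E u) {..<card (pverts (H u))} (pverts (H u))"
    and n_pos: "1 \<le> n"
    and n_le: "u \<in> pverts D \<Longrightarrow> n \<le> card (pverts (H u))"
begin

abbreviation V where "V \<equiv> pverts D"
abbreviation A where "A \<equiv> parcs D"
abbreviation N where "N u \<equiv> card (pverts (H u))"

definition core :: "('a \<Rightarrow> nat) \<Rightarrow> ('a \<times> nat) set" where
  "core k = (SIGMA u:V. {..<k u})"

text \<open>
  The condition on a colouring of core arcs, written on pairs of a part and a number, under which it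
  extends to the whole composition. The size \<open>k u\<close> of the core in part \<open>u\<close> may exceed \<open>n\<close>; this is used
  for the patterns on the directed triangle.
\<close>

definition core_packing :: "('a \<Rightarrow> nat) \<Rightarrow> (nat \<Rightarrow> ('a \<times> nat) rel) \<Rightarrow> bool" where
  "core_packing k R \<longleftrightarrow>
     (\<forall>u\<in>V. n \<le> k u \<and> k u \<le> N u) \<and>
     (\<forall>i<n. \<forall>((u, p), (v, q)) \<in> R i. u \<in> V \<and> v \<in> V \<and> p < k u \<and> q < k v \<and>
        ((u, v) \<in> A \<or> u = v \<and> (E u p, E u q) \<in> parcs (H u))) \<and>
     (\<forall>i<n. \<forall>j<n. i \<noteq> j \<longrightarrow> R i \<inter> R j = {}) \<and>
     (\<forall>i<n. \<forall>x\<in>core k. \<forall>y\<in>core k. (x, y) \<in> (R i)\<^sup>*)"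

text \<open>
  The arcs that attach the vertices outside the core to colour \<open>i\<close>. Their other ends are the vertices
  numbered \<open>i\<close>, so the colour can be read off from such an arc.
\<close>

definition spread :: "('a \<Rightarrow> nat) \<Rightarrow> nat \<Rightarrow> ('a \<times> nat) rel" where
  "spread k i =
     {((u, p), (v, i)) | u p v. (u, v) \<in> A \<and> k u \<le> p \<and> p < N u} \<union>
     {((u, i), (v, q)) | u v q. (u, v) \<in> A \<and> k v \<le> q \<and> q < N v}"

definition vertex :: "'a \<times> nat \<Rightarrow> 'a \<times> 'b" where
  "vertex = (\<lambda>(u, p). (u, E u p))"

definition packed :: "('a \<Rightarrow> nat) \<Rightarrow> (nat \<Rightarrow> ('a \<times> nat) rel) \<Rightarrow> nat \<Rightarrow> ('a \<times> 'b) pair_pre_digraph" where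
  "packed k R i = \<lparr> pverts = pverts (composition D H),
     parcs = map_prod vertex vertex ` (R i \<union> spread k i) \<rparr>"

lemma vertex_bij: "bij_betw vertex (core N) (pverts (composition D H))"
proof -
  have "inj_on vertex (core N)"
    using numbering by (auto simp: inj_on_def vertex_def core_def bij_betw_def)
  moreover have "vertex ` core N = pverts (composition D H)"
    using numbering unfolding bij_betw_def
    by (force simp: vertex_def core_def composition_def image_iff)
  ultimately show ?thesis by (simp add: bij_betw_def)
qed

lemma pair_digraph_composition: "pair_digraph (composition D H)"
proof -
  let ?Q = "composition D H"
  have fin: "finite (pverts ?Q)"
    using parts pair_finite_verts
    by (auto simp: composition_def pair_digraph_def pair_fin_digraph_def pair_fin_digraph_axioms_def)
  have wf: "e \<in> parcs ?Q \<Longrightarrow> fst e \<in> pverts ?Q \<and> snd e \<in> pverts ?Q \<and> fst e \<noteq> snd e" for e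
    using parts pair_no_loops in_arcsD1 in_arcsD2
    by (fastforce simp: composition_def pair_digraph_def pair_fin_digraph_def
        pair_loopfree_digraph_def pair_loopfree_digraph_axioms_def pair_wf_digraph_def)
  have "parcs ?Q \<subseteq> pverts ?Q \<times> pverts ?Q" using wf by auto
  then have "finite (parcs ?Q)" using fin finite_subset by blast
  then show ?thesis using wf fin by unfold_locales auto
qed

lemma core_packing_bounds:
  assumes "core_packing k R"
  shows "u \<in> V \<Longrightarrow> n \<le> k u" "u \<in> V \<Longrightarrow> k u \<le> N u"
  using assms by (auto simp: core_packing_def)

lemma core_packing_cong:
  assumes "core_packing k R" "\<And>u. u \<in> V \<Longrightarrow> k' u = k u"
  shows "core_packing k' R"
proof -
  have core: "core k' = core k" using assms(2) by (auto simp: core_def)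
  have arc: "u \<in> V \<and> v \<in> V \<and> p < k u \<and> q < k v \<and>
        ((u, v) \<in> A \<or> u = v \<and> (E u p, E u q) \<in> parcs (H u))"
    if "i < n" "((u, p), (v, q)) \<in> R i" for i u p v q
    using assms(1) that unfolding core_packing_def by fast
  show ?thesis
    unfolding core_packing_def
  proof (intro conjI)
    show "\<forall>u\<in>V. n \<le> k' u \<and> k' u \<le> N u" using assms by (simp add: core_packing_def)
    show "\<forall>i<n. \<forall>((u, p), (v, q))\<in>R i. u \<in> V \<and> v \<in> V \<and> p < k' u \<and> q < k' v \<and>
        ((u, v) \<in> A \<or> u = v \<and> (E u p, E u q) \<in> parcs (H u))"
    proof (intro allI impI ballI)
      fix i e assume i: "i < n" and "e \<in> R i"
      moreover obtain u p v q where e: "e = ((u, p), (v, q))" by (metis surj_pair)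
      ultimately have "((u, p), (v, q)) \<in> R i" by simp
      from arc[OF i this] show "case e of (x, y) \<Rightarrow> (case x of (u, p) \<Rightarrow> \<lambda>(v, q).
          u \<in> V \<and> v \<in> V \<and> p < k' u \<and> q < k' v \<and>
          ((u, v) \<in> A \<or> u = v \<and> (E u p, E u q) \<in> parcs (H u))) y"
        using assms(2)[of u] assms(2)[of v] by (simp add: e)
    qed
    show "\<forall>i<n. \<forall>j<n. i \<noteq> j \<longrightarrow> R i \<inter> R j = {}"
      "\<forall>i<n. \<forall>x\<in>core k'. \<forall>y\<in>core k'. (x, y) \<in> (R i)\<^sup>*"
      using assms(1) unfolding core by (simp_all add: core_packing_def)
  qed
qed

lemma packed_arcs:
  assumes R: "core_packing k R" and i: "i < n" and e: "(x, y) \<in> R i \<union> spread k i"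
  shows "x \<in> core N" "y \<in> core N" "(vertex x, vertex y) \<in> parcs (composition D H)"
proof -
  obtain u p v q where xy: "x = (u, p)" "y = (v, q)" by (cases x, cases y)
  have *: "u \<in> V \<and> v \<in> V \<and> p < N u \<and> q < N v \<and>
     ((u, v) \<in> A \<or> u = v \<and> (E u p, E u q) \<in> parcs (H u))"
  proof (cases "(x, y) \<in> R i")
    case True
    then have "u \<in> V \<and> v \<in> V \<and> p < k u \<and> q < k v \<and>
     ((u, v) \<in> A \<or> u = v \<and> (E u p, E u q) \<in> parcs (H u))"
      using R i unfolding core_packing_def xy by fast
    then show ?thesis using core_packing_bounds[OF R] by (auto intro: less_le_trans)
  next
    case False
    then show ?thesis using e i n_le
      by (auto simp: spread_def xy in_arcsD1 in_arcsD2 intro: less_le_trans)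
  qed
  then have "E u p \<in> pverts (H u)" "E v q \<in> pverts (H v)"
    using numbering[of u] numbering[of v] by (auto simp: bij_betw_def)
  with * show "x \<in> core N" "y \<in> core N" "(vertex x, vertex y) \<in> parcs (composition D H)"
    by (auto simp: xy core_def vertex_def composition_def)
qed

text \<open>
  Every vertex of \<open>D\<close> has an out-neighbour and an in-neighbour, so a vertex outside the core has an
  arc of \<open>spread k i\<close> into the core and one coming from the core.
\<close>

lemma extended_core_connected:
  assumes R: "core_packing k R" and i: "i < n" and x: "x \<in> core N" and y: "y \<in> core N"
  shows "(x, y) \<in> (R i \<union> spread k i)\<^sup>*"
proof -
  have core: "(x, y) \<in> (R i \<union> spread k i)\<^sup>*" if "x \<in> core k" "y \<in> core k" for x y
    using that R i rtrancl_mono[of "R i" "R i \<union> spread k i"] by (auto simp: core_packing_def)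
  have i_core: "(u, i) \<in> core k" if "u \<in> V" for u
    using that i core_packing_bounds[OF R] by (auto simp: core_def intro: less_le_trans)
  obtain x' where x': "(x, x') \<in> (R i \<union> spread k i)\<^sup>*" "x' \<in> core k"
  proof (cases "x \<in> core k")
    case False
    obtain u p where up: "x = (u, p)" "u \<in> V" "p < N u" "k u \<le> p"
      using x False by (cases x) (auto simp: core_def not_less)
    obtain v where "(u, v) \<in> A" using out_arc up(2) by blast
    then have "(x, (v, i)) \<in> spread k i" "(v, i) \<in> core k"
      using up i_core in_arcsD2 by (auto simp: spread_def)
    then show thesis using that by blast
  qed (use that in blast)
  moreover obtain y' where "(y', y) \<in> (R i \<union> spread k i)\<^sup>*" "y' \<in> core k"
  proof (cases "y \<in> core k")
    case False
    obtain u p where up: "y = (u, p)" "u \<in> V" "p < N u" "k u \<le> p"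
      using y False by (cases y) (auto simp: core_def not_less)
    obtain v where "(v, u) \<in> A" using in_arc up(2) by blast
    then have "((v, i), y) \<in> spread k i" "(v, i) \<in> core k"
      using up i_core in_arcsD1 by (auto simp: spread_def)
    then show thesis using that by blast
  qed (use that in blast)
  ultimately show ?thesis using core rtrancl_trans by meson
qed

lemma rtrancl_map_prod:
  "(x, y) \<in> r\<^sup>* \<Longrightarrow> (f x, f y) \<in> (map_prod f f ` r)\<^sup>*"
  by (induction rule: rtrancl_induct) (auto intro: rtrancl_into_rtrancl)

lemma packed_strong_subgraph:
  assumes R: "core_packing k R" and i: "i < n" and S: "S \<subseteq> pverts (composition D H)"
  shows "strong_subgraph_containing (composition D H) S (packed k R i)"
proof -
  let ?Q = "composition D H"
  interpret Q: pair_digraph ?Q by (rule pair_digraph_composition)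
  have sub: "parcs (packed k R i) \<subseteq> parcs ?Q"
    using packed_arcs(3)[OF R i] by (auto simp: packed_def)
  have wf: "pair_wf_digraph (packed k R i)"
    using sub by unfold_locales (auto simp: packed_def Q.wellformed')
  have "strongly_connected (with_proj (packed k R i))"
    unfolding strongly_connected_iff_rtrancl[OF wf]
  proof (intro conjI ballI)
    obtain u where "u \<in> V" by (rule other_vertex)
    moreover have "0 < N u" using n_pos n_le[OF calculation] by simp
    ultimately have "(u, 0) \<in> core N" by (auto simp: core_def)
    then show "pverts (packed k R i) \<noteq> {}"
      using vertex_bij by (auto simp: packed_def bij_betw_def)
    fix x y assume "x \<in> pverts (packed k R i)" "y \<in> pverts (packed k R i)"
    then have "x \<in> vertex ` core N" "y \<in> vertex ` core N"
      using vertex_bij by (auto simp: packed_def bij_betw_def)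
    then obtain x' y' where "x = vertex x'" "y = vertex y'" "x' \<in> core N" "y' \<in> core N"
      by blast
    then show "(x, y) \<in> (parcs (packed k R i))\<^sup>*"
      using rtrancl_map_prod[OF extended_core_connected[OF R i]] by (simp add: packed_def)
  qed
  moreover have "subgraph (with_proj (packed k R i)) (with_proj ?Q)"
    using sub Q.wellformed' wf[THEN pair_wf_digraph.in_arcsD1] wf[THEN pair_wf_digraph.in_arcsD2]
    by (auto simp: subgraph_def compatible_def wf_digraph_def) (simp add: packed_def)
  ultimately show ?thesis using S by (simp add: strong_subgraph_containing_def packed_def)
qed

lemma packed_arc_disjoint:
  assumes R: "core_packing k R" and "i < n" "j < n" "i \<noteq> j"
  shows "parcs (packed k R i) \<inter> parcs (packed k R j) = {}"
proof -
  have bound: "p < k u \<and> q < k v" if "((u, p), (v, q)) \<in> R i" "i < n" for i u p v q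
    using R that unfolding core_packing_def by fast
  have in_core: "p < k u" if "p < n" "(u, v) \<in> A \<or> (v, u) \<in> A" for p u v
    using core_packing_bounds(1)[OF R, of u] that in_arcsD1 in_arcsD2 by (auto intro: less_le_trans)
  have RR: "R i \<inter> R j = {}" using R assms by (auto simp: core_packing_def)
  have RS: "R i \<inter> spread k j = {}" if "i < n" "j < n" for i j
    using bound[OF _ that(1)] by (fastforce simp: spread_def)
  have SS: "spread k i \<inter> spread k j = {}"
    using in_core[OF \<open>i < n\<close>] in_core[OF \<open>j < n\<close>] \<open>i \<noteq> j\<close> unfolding spread_def
    by (auto simp: not_less[symmetric])
  have disj: "(R i \<union> spread k i) \<inter> (R j \<union> spread k j) = {}"
    using RR SS RS[of i j] RS[of j i] assms by blast
  have inj: "inj_on (map_prod vertex vertex) (core N \<times> core N)"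
    using vertex_bij by (auto simp: bij_betw_def inj_on_def)
  have sub: "R j \<union> spread k j \<subseteq> core N \<times> core N" if "j < n" for j
    using packed_arcs(1,2)[OF R that] by (intro subrelI) blast
  from inj_on_image_Int[OF inj sub[OF \<open>i < n\<close>] sub[OF \<open>j < n\<close>]] show ?thesis using disj by (simp add: packed_def)
qed

text \<open>
  Strong subgraphs on at least two vertices have arcs, so arc-disjoint ones are distinct and their
  number is \<open>n\<close>.
\<close>

theorem core_packing_extends:
  assumes R: "core_packing k R" and S: "S \<subseteq> pverts (composition D H)"
  shows "arc_disjoint_strong_subgraphs (composition D H) S (packed k R ` {..<n})"
    and "card (packed k R ` {..<n}) = n"
proof -
  show "arc_disjoint_strong_subgraphs (composition D H) S (packed k R ` {..<n})"
    unfolding arc_disjoint_strong_subgraphs_def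
    using packed_strong_subgraph[OF R _ S] packed_arc_disjoint[OF R]
    by (auto simp: pairwise_def disjnt_def)
  have nonempty: "parcs (packed k R i) \<noteq> {}" if "i < n" for i
  proof -
    obtain u where u: "u \<in> V" by (rule other_vertex)
    obtain v where v: "v \<in> V" "v \<noteq> u" by (rule other_vertex)
    have "((u, 0), (v, 0)) \<in> (R i \<union> spread k i)\<^sup>*"
      using extended_core_connected[OF R that] u v n_le[OF u] n_le[OF v(1)] n_pos
      by (auto simp: core_def)
    then have "R i \<union> spread k i \<noteq> {}" using v(2) by (auto elim: rtranclE)
    then show ?thesis by (simp add: packed_def)
  qed
  have "inj_on (packed k R) {..<n}"
    using packed_arc_disjoint[OF R] nonempty by (fastforce simp: inj_on_def)
  then show "card (packed k R ` {..<n}) = n" by (simp add: card_image)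
qed

end

section \<open>Layered colourings\<close>

text \<open>
  Over the arc \<open>uv\<close>, colour \<open>i\<close> leads from copy \<open>p\<close> of \<open>u\<close> to copy \<open>\<sigma> i u v p\<close> of \<open>v\<close>.
\<close>

definition layered :: "nat \<Rightarrow> 'a rel \<Rightarrow> (nat \<Rightarrow> 'a \<Rightarrow> 'a \<Rightarrow> nat \<Rightarrow> nat) \<Rightarrow> nat \<Rightarrow> ('a \<times> nat) rel" where
  "layered n A \<sigma> i = {((u, p), (v, \<sigma> i u v p)) | u v p. (u, v) \<in> A \<and> p < n}"

lemma layered_arc: "(u, v) \<in> A \<Longrightarrow> p < n \<Longrightarrow> q = \<sigma> i u v p \<Longrightarrow> ((u, p), (v, q)) \<in> layered n A \<sigma> i"
  by (auto simp: layered_def)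

lemma nat_eq_of_add_mod_eq:
  fixes n :: nat
  assumes "(a + f) mod n = (b + f) mod n" "a < n" "b < n"
  shows "a = b"
  using assms
proof (induction a b rule: linorder_wlog)
  case (le a b)
  then have "n dvd b - a" using mod_eq_dvd_iff_nat[of "a + f" "b + f" n] by simp
  then show ?case using le by (auto dest: dvd_imp_le)
next
  case (sym b a)
  from sym(1)[OF sym(2)[symmetric] sym(4) sym(3)] show ?case ..
qed

lemma add_mod_bij: "0 < n \<Longrightarrow> bij_betw (\<lambda>p. (p + f) mod n) {..<n} {..<n::nat}"
proof -
  assume "0 < n"
  then have "(\<lambda>p. (p + f) mod n) ` {..<n} \<subseteq> {..<n}" by auto
  moreover have "inj_on (\<lambda>p. (p + f) mod n) {..<n}"
    by (auto simp: inj_on_def dest: nat_eq_of_add_mod_eq)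
  ultimately show ?thesis using endo_inj_surj[of "{..<n}"] by (auto simp: bij_betw_def)
qed

lemma shift_back:
  fixes n :: nat
  assumes "i < n"
  shows "((p + i) mod n + (n + 1 - i)) mod n = (p + 1) mod n"
    and "((p + i) mod n + (n - i)) mod n = p mod n"
proof -
  have "((p + i) mod n + (n + 1 - i)) mod n = (p + i + (n + 1 - i)) mod n" by (rule mod_add_left_eq)
  also have "p + i + (n + 1 - i) = (p + 1) + n" using assms by arith
  finally show "((p + i) mod n + (n + 1 - i)) mod n = (p + 1) mod n" by (simp only: mod_add_self2)
  have "((p + i) mod n + (n - i)) mod n = (p + i + (n - i)) mod n" by (rule mod_add_left_eq)
  also have "p + i + (n - i) = p + n" using assms by arith
  finally show "((p + i) mod n + (n - i)) mod n = p mod n" by simp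
qed

lemma cyclic_steps_connect:
  fixes n :: nat
  assumes step: "\<And>p. p < n \<Longrightarrow> (x p, x ((p + 1) mod n)) \<in> R" and pq: "p < n" "q < n"
  shows "(x p, x q) \<in> R\<^sup>*"
proof -
  have up: "(x p, x (p + d)) \<in> R\<^sup>*" if "p + d < n" for p d
    using that
  proof (induction d)
    case (Suc d)
    then show ?case using step[of "p + d"] by (auto intro: rtrancl_into_rtrancl)
  qed simp
  have "(x p, x (n - 1)) \<in> R\<^sup>*" using up[of p "n - 1 - p"] pq by simp
  moreover have "(x (n - 1), x 0) \<in> R" using step[of "n - 1"] pq by simp
  moreover have "(x 0, x q) \<in> R\<^sup>*" using up[of 0 q] pq by simp
  ultimately show ?thesis by (meson rtrancl_into_rtrancl rtrancl_trans)
qed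

context numbered_composition
begin

text \<open>
  Walks of \<open>D\<close> lift to colour \<open>i\<close> from any copy of their first vertex, and, since the steps are
  bijective, to any copy of their last vertex. So everything reaches the connected fibre over \<open>u\<close> and
  is reached from it. Injectivity in the colour makes the classes disjoint.
\<close>

lemma layered_core_packing:
  assumes bij: "\<And>i u v. i < n \<Longrightarrow> (u, v) \<in> A \<Longrightarrow> bij_betw (\<sigma> i u v) {..<n} {..<n}"
    and inj: "\<And>u v p. (u, v) \<in> A \<Longrightarrow> p < n \<Longrightarrow> inj_on (\<lambda>i. \<sigma> i u v p) {..<n}"
    and fibre: "\<And>i. i < n \<Longrightarrow> \<exists>u\<in>V. \<forall>p<n. \<forall>q<n. ((u, p), (u, q)) \<in> (layered n A \<sigma> i)\<^sup>*"
  shows "core_packing (\<lambda>_. n) (layered n A \<sigma>)"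
proof -
  have range: "\<sigma> i u v p < n" if "i < n" "(u, v) \<in> A" "p < n" for i u v p
    using bij_betwE[OF bij[OF that(1,2)]] that(3) by auto
  have down: "\<exists>q<n. ((u, p), (v, q)) \<in> (layered n A \<sigma> i)\<^sup>*"
    if uv: "(u, v) \<in> A\<^sup>*" and that: "i < n" "p < n" for i u v p
    using uv
  proof induction
    case (step v w)
    then obtain q where q: "q < n" "((u, p), (v, q)) \<in> (layered n A \<sigma> i)\<^sup>*" by blast
    then have "((v, q), (w, \<sigma> i v w q)) \<in> layered n A \<sigma> i" using step by (simp add: layered_arc)
    then show ?case using q range[OF that(1) step(2) q(1)] by (meson rtrancl_into_rtrancl)
  qed (use that in blast)
  have up: "\<exists>p<n. ((u, p), (v, q)) \<in> (layered n A \<sigma> i)\<^sup>*"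
    if uv: "(u, v) \<in> A\<^sup>*" and that: "i < n" "q < n" for i u v q
    using uv
  proof (induction rule: converse_rtrancl_induct)
    case (step u w)
    then obtain p where p: "p < n" "((w, p), (v, q)) \<in> (layered n A \<sigma> i)\<^sup>*" by blast
    have "p \<in> \<sigma> i u w ` {..<n}"
      using bij_betw_imp_surj_on[OF bij[OF \<open>i < n\<close> step(1)]] p(1) by simp
    then obtain p' where "p' < n" "p = \<sigma> i u w p'" by auto
    then have "((u, p'), (w, p)) \<in> layered n A \<sigma> i" using step by (simp add: layered_arc)
    then show ?case using p \<open>p' < n\<close> by (meson converse_rtrancl_into_rtrancl)
  qed (use that in blast)
  have "(x, y) \<in> (layered n A \<sigma> i)\<^sup>*"
    if i: "i < n" and x: "x \<in> core (\<lambda>_. n)" and y: "y \<in> core (\<lambda>_. n)" for i x y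
  proof -
    obtain w where w: "w \<in> V" "\<forall>p<n. \<forall>q<n. ((w, p), (w, q)) \<in> (layered n A \<sigma> i)\<^sup>*"
      using fibre[OF i] by blast
    obtain u p v q where xy: "x = (u, p)" "y = (v, q)" "u \<in> V" "v \<in> V" "p < n" "q < n"
      using x y by (auto simp: core_def)
    obtain p' where "p' < n" "(x, (w, p')) \<in> (layered n A \<sigma> i)\<^sup>*"
      using down[OF vertices_reachable[OF xy(3) w(1)] i xy(5)] xy by auto
    moreover obtain q' where "q' < n" "((w, q'), y) \<in> (layered n A \<sigma> i)\<^sup>*"
      using up[OF vertices_reachable[OF w(1) xy(4)] i xy(6)] xy by auto
    ultimately show ?thesis using w(2) by (meson rtrancl_trans)
  qed
  moreover have "layered n A \<sigma> i \<inter> layered n A \<sigma> j = {}" if "i < n" "j < n" "i \<noteq> j" for i j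
    using inj that by (fastforce simp: layered_def inj_on_def)
  ultimately show ?thesis
    using range n_le by (auto simp: core_packing_def in_arcsD1 in_arcsD2)
      (auto simp: layered_def range in_arcsD1 in_arcsD2)
qed

end


section \<open>Closed walks of length four\<close>

text \<open>
  Vertices may repeat, so opposite arcs \<open>ab\<close> and \<open>ba\<close> give a closed walk as well.
\<close>

definition closed_4_walk :: "'a rel \<Rightarrow> 'a \<Rightarrow> 'a \<Rightarrow> 'a \<Rightarrow> 'a \<Rightarrow> bool" where
  "closed_4_walk A a b c d \<longleftrightarrow> (a, b) \<in> A \<and> (b, c) \<in> A \<and> (c, d) \<in> A \<and> (d, a) \<in> A"

text \<open>
  The shifts \<open>i\<close>, \<open>-i\<close>, \<open>i\<close>, \<open>1 - i\<close> along the closed walk \<open>a b c d\<close>, and \<open>i\<close> on all other arcs. If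
  \<open>da\<close> and \<open>bc\<close> are the same arc then \<open>1 - i\<close> takes precedence.
\<close>

definition walk_shift :: "nat \<Rightarrow> 'a \<Rightarrow> 'a \<Rightarrow> 'a \<Rightarrow> 'a \<Rightarrow> nat \<Rightarrow> 'a \<Rightarrow> 'a \<Rightarrow> nat" where
  "walk_shift n a b c d i u v =
     (if u = d \<and> v = a then n + 1 - i else if u = b \<and> v = c then n - i else i)"

definition walk_step :: "nat \<Rightarrow> 'a \<Rightarrow> 'a \<Rightarrow> 'a \<Rightarrow> 'a \<Rightarrow> nat \<Rightarrow> 'a \<Rightarrow> 'a \<Rightarrow> nat \<Rightarrow> nat" where
  "walk_step n a b c d i u v p = (p + walk_shift n a b c d i u v) mod n"

context numbered_composition
begin

text \<open>
  The copies of \<open>a\<close> are connected because going around adds \<open>1\<close>. If \<open>da\<close> and \<open>bc\<close> are different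
  arcs, this holds for the walk of length four. Otherwise \<open>b = d\<close> and \<open>a = c\<close>, and the
  walk \<open>a b a\<close> has the sum \<open>i + (1 - i) = 1\<close>. In no case can \<open>ab\<close> or \<open>cd\<close> coincide with \<open>bc\<close> or \<open>da\<close>, as
  there are no loops.
\<close>

lemma walk_core_packing:
  assumes walk: "closed_4_walk A a b c d"
  shows "core_packing (\<lambda>_. n) (layered n A (walk_step n a b c d))"
proof (rule layered_core_packing)
  show "bij_betw (walk_step n a b c d i u v) {..<n} {..<n}" for i u v
    using add_mod_bij[of n "walk_shift n a b c d i u v"] n_pos by (simp add: walk_step_def[abs_def])
next
  fix u v p
  have "i = j" if "i < n" "j < n" "walk_step n a b c d i u v p = walk_step n a b c d j u v p" for i j
  proof -
    consider "u = d \<and> v = a" | "\<not> (u = d \<and> v = a)" "u = b \<and> v = c"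
      | "\<not> (u = d \<and> v = a)" "\<not> (u = b \<and> v = c)" by blast
    then show ?thesis
    proof cases
      case 1
      moreover have "p + (n + 1 - k) = (n - 1 - k) + (p + 2)" if "k < n" for k using that by arith
      ultimately have "((n - 1 - i) + (p + 2)) mod n = ((n - 1 - j) + (p + 2)) mod n"
        using that by (simp add: walk_step_def walk_shift_def)
      from nat_eq_of_add_mod_eq[OF this] show ?thesis using that by simp
    next
      case 2
      moreover have "p + (n - k) = (n - 1 - k) + (p + 1)" if "k < n" for k using that by arith
      ultimately have "((n - 1 - i) + (p + 1)) mod n = ((n - 1 - j) + (p + 1)) mod n"
        using that by (auto simp: walk_step_def walk_shift_def)
      from nat_eq_of_add_mod_eq[OF this] show ?thesis using that by simp
    next
      case 3
      then have "(i + p) mod n = (j + p) mod n"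
        using that by (auto simp: walk_step_def walk_shift_def algebra_simps)
      from nat_eq_of_add_mod_eq[OF this] show ?thesis using that by simp
    qed
  qed
  then show "inj_on (\<lambda>i. walk_step n a b c d i u v p) {..<n}" by (auto simp: inj_on_def)
next
  fix i assume i: "i < n"
  let ?R = "layered n A (walk_step n a b c d) i"
  have arcs: "(a, b) \<in> A" "(b, c) \<in> A" "(c, d) \<in> A" "(d, a) \<in> A"
    using walk by (auto simp: closed_4_walk_def)
  then have neq: "a \<noteq> b" "b \<noteq> c" "c \<noteq> d" "d \<noteq> a" by auto
  have "((a, p), (a, (p + 1) mod n)) \<in> ?R\<^sup>*" if "p < n" for p
  proof (cases "b = d \<and> c = a")
    case True
    have "((a, p), (b, (p + i) mod n)) \<in> ?R"
      using arcs that True neq by (intro layered_arc) (auto simp: walk_step_def walk_shift_def)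
    moreover have "((b, (p + i) mod n), (a, (p + 1) mod n)) \<in> ?R"
      using arcs True shift_back(1)[OF i, of p] n_pos
      by (intro layered_arc) (auto simp: walk_step_def walk_shift_def)
    ultimately show ?thesis by (meson r_into_rtrancl rtrancl_into_rtrancl)
  next
    case False
    have "((a, p), (b, (p + i) mod n)) \<in> ?R"
      using arcs that neq by (intro layered_arc) (auto simp: walk_step_def walk_shift_def)
    moreover have "((b, (p + i) mod n), (c, p)) \<in> ?R"
      using arcs False that shift_back(2)[OF i, of p] n_pos
      by (intro layered_arc) (auto simp: walk_step_def walk_shift_def)
    moreover have "((c, p), (d, (p + i) mod n)) \<in> ?R"
      using arcs that neq by (intro layered_arc) (auto simp: walk_step_def walk_shift_def)
    moreover have "((d, (p + i) mod n), (a, (p + 1) mod n)) \<in> ?R"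
      using arcs shift_back(1)[OF i, of p] n_pos
      by (intro layered_arc) (auto simp: walk_step_def walk_shift_def)
    ultimately show ?thesis by (meson r_into_rtrancl rtrancl_into_rtrancl)
  qed
  from cyclic_steps_connect[of n "Pair a", OF this] have
    "\<forall>p<n. \<forall>q<n. ((a, p), (a, q)) \<in> ?R\<^sup>*" by simp
  then show "\<exists>u\<in>V. \<forall>p<n. \<forall>q<n. ((u, p), (u, q)) \<in> ?R\<^sup>*" using arcs in_arcsD1 by blast
qed

end

lemma (in strong_digraph) symmetric_closed_4_walk:
  assumes "symmetric (with_proj D)"
  shows "\<exists>a b c d. closed_4_walk (parcs D) a b c d"
proof -
  obtain u where "u \<in> pverts D" by (rule other_vertex)
  then obtain v where "(u, v) \<in> parcs D" by (rule out_arc)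
  moreover from this have "(v, u) \<in> parcs D" using assms by (simp add: symmetric_def symD)
  ultimately have "closed_4_walk (parcs D) u v u v" by (simp add: closed_4_walk_def)
  then show ?thesis by blast
qed

definition directed_triangle :: "'a pair_pre_digraph \<Rightarrow> 'a \<Rightarrow> 'a \<Rightarrow> 'a \<Rightarrow> bool" where
  "directed_triangle D a b c \<longleftrightarrow> a \<noteq> b \<and> b \<noteq> c \<and> c \<noteq> a \<and>
     pverts D = {a, b, c} \<and> parcs D = {(a, b), (b, c), (c, a)}"

lemma directed_triangle_rotate: "directed_triangle D a b c \<Longrightarrow> directed_triangle D b c a"
  by (simp add: directed_triangle_def insert_commute)

text \<open>
  Without closed walks of length four there are no opposite arcs. The arc leaving the out-neighbourhood
  of a vertex closes a triangle \<open>C\<close>. A vertex \<open>w\<close> outside \<open>C\<close> with arcs from and to \<open>C\<close> could be inserted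
  between two consecutive vertices of \<open>C\<close>, so \<open>w\<close> is dominated by all of \<open>C\<close> or dominates all of \<open>C\<close>. By
  strong connectivity, if there are vertices outside \<open>C\<close>, there is an arc \<open>xy\<close> from a dominated to
  a dominating vertex, and \<open>b x y a\<close> is a closed walk.
\<close>

lemma (in strong_digraph) semicomplete_no_closed_4_walk:
  assumes semi: "semicomplete D" and no: "\<nexists>a b c d. closed_4_walk (parcs D) a b c d"
  shows "\<exists>a b c. directed_triangle D a b c"
proof -
  have no4: False if "(a, b) \<in> parcs D" "(b, c) \<in> parcs D" "(c, d) \<in> parcs D" "(d, a) \<in> parcs D"
    for a b c d
  proof -
    have "closed_4_walk (parcs D) a b c d" using that by (simp add: closed_4_walk_def)
    then show False using no by blast
  qed
  have asym: "(v, u) \<notin> parcs D" if "(u, v) \<in> parcs D" for u v using no4[OF that _ that] by blast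
  have semi: "(u, v) \<in> parcs D \<or> (v, u) \<in> parcs D" if "u \<in> pverts D" "v \<in> pverts D" "u \<noteq> v" for u v
    using semi that unfolding semicomplete_def by blast
  obtain a where a: "a \<in> pverts D" by (rule other_vertex)
  obtain b' where b': "(a, b') \<in> parcs D" using a by (rule out_arc)
  let ?O = "{x. (a, x) \<in> parcs D}"
  have "a \<notin> ?O" by simp
  then obtain b c where bc: "(b, c) \<in> parcs D" "b \<in> ?O" "c \<notin> ?O"
    using leaving_arc[of b' ?O a] a b' in_arcsD2 by blast
  then have ab: "(a, b) \<in> parcs D" by simp
  then have "c \<noteq> a" using asym bc(1) by auto
  then have ca: "(c, a) \<in> parcs D" using semi[of a c] a bc in_arcsD2 by blast
  let ?C = "{a, b, c}"
  have C: "?C \<subseteq> pverts D" using ab bc(1) in_arcsD1 in_arcsD2 by auto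
  have neq: "a \<noteq> b" "b \<noteq> c" using ab bc(1) no_loops by auto
  have alternatives: "(\<forall>x\<in>?C. (x, w) \<in> parcs D) \<or> (\<forall>x\<in>?C. (w, x) \<in> parcs D)"
    if "w \<in> pverts D" "w \<notin> ?C" for w
  proof -
    have "(a, w) \<in> parcs D \<or> (w, a) \<in> parcs D" "(b, w) \<in> parcs D \<or> (w, b) \<in> parcs D"
      "(c, w) \<in> parcs D \<or> (w, c) \<in> parcs D"
      using semi[of a w] semi[of b w] semi[of c w] that C by blast+
    moreover have "\<not> ((a, w) \<in> parcs D \<and> (w, b) \<in> parcs D)" using no4[of a w b c] bc(1) ca by blast
    moreover have "\<not> ((b, w) \<in> parcs D \<and> (w, c) \<in> parcs D)" using no4[of b w c a] ca ab by blast
    moreover have "\<not> ((c, w) \<in> parcs D \<and> (w, a) \<in> parcs D)" using no4[of c w a b] ab bc(1) by blast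
    ultimately show ?thesis by auto
  qed
  have "pverts D \<subseteq> ?C"
  proof (rule ccontr)
    assume "\<not> pverts D \<subseteq> ?C"
    then obtain w where w: "w \<in> pverts D" "w \<notin> ?C" by auto
    let ?P = "{w\<in>pverts D. w \<notin> ?C \<and> (\<forall>x\<in>?C. (x, w) \<in> parcs D)}"
    obtain x y where xy: "(x, y) \<in> parcs D" "x \<in> ?C" "y \<notin> ?C"
      using leaving_arc[of a ?C w] a w by auto
    have yV: "y \<in> pverts D" using xy(1) by (rule in_arcsD2)
    have "\<not> (\<forall>z\<in>?C. (y, z) \<in> parcs D)" using xy(1,2) asym by blast
    then have "\<forall>z\<in>?C. (z, y) \<in> parcs D" using alternatives[OF yV xy(3)] by blast
    then have p: "y \<in> ?P" using yV xy(3) by blast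
    have "a \<notin> ?P" by simp
    then obtain x y where xy: "(x, y) \<in> parcs D" "x \<in> ?P" "y \<notin> ?P"
      by (rule leaving_arc[OF p yV _ a])
    have y: "y \<notin> ?C" using xy(1,2) asym by blast
    have yV: "y \<in> pverts D" using xy(1) by (rule in_arcsD2)
    have "(y, a) \<in> parcs D" using alternatives[OF yV y] xy(3) y yV by blast
    moreover have "(b, x) \<in> parcs D" using xy(2) by blast
    ultimately show False using no4 xy(1) ab by blast
  qed
  then have V: "pverts D = ?C" using C by blast
  have "(x, y) \<in> {(a, b), (b, c), (c, a)}" if "(x, y) \<in> parcs D" for x y
  proof -
    have "x \<in> ?C" "y \<in> ?C" using that V in_arcsD1 in_arcsD2 by auto
    then show ?thesis using that asym[OF ab] asym[OF bc(1)] asym[OF ca] by auto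
  qed
  then have "parcs D = {(a, b), (b, c), (c, a)}" using ab bc(1) ca by auto
  then have "directed_triangle D a b c" using V neq \<open>c \<noteq> a\<close> by (simp add: directed_triangle_def)
  then show ?thesis by blast
qed

section \<open>The directed triangle with at least three layers\<close>

text \<open>
  The arcs of the triangle \<open>a b c\<close> carry the shifts \<open>i\<close> on \<open>ab\<close>, \<open>middle_shift\<close> on \<open>bc\<close> and \<open>last_shift\<close> on
  \<open>ca\<close>. If \<open>n\<close> is \<open>2\<close> modulo \<open>4\<close>, the shift on \<open>bc\<close> is preceded by a permutation: the cycle
  \<open>0 \<rightarrow> 1 \<rightarrow> 2 \<rightarrow> 0\<close> for even colours and the transposition of \<open>0\<close> and \<open>1\<close> for odd colours. Modulo \<open>2\<close> the
  two permutations agree, which keeps different colours apart although \<open>i\<close> is used as shift after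
  both.
\<close>

definition twist :: "nat \<Rightarrow> nat \<Rightarrow> nat \<Rightarrow> nat" where
  "twist n i y =
     (if n mod 4 \<noteq> 2 then y
      else if y = 0 then 1
      else if y = 1 then (if even i then 2 else 0)
      else if y = 2 then (if even i then 0 else 2)
      else y)"

text \<open>
  If \<open>4\<close> divides \<open>n\<close>, the colours in the upper half are swapped in pairs \<open>2 k\<close>, \<open>2 k + 1\<close>. Then the
  three parities of \<open>i\<close>, \<open>middle_shift\<close> and \<open>last_shift\<close> have an odd sum for every colour while each of
  the three families contains every residue once.
\<close>

definition middle_shift :: "nat \<Rightarrow> nat \<Rightarrow> nat" where
  "middle_shift n i =
     (if n mod 4 = 0 \<and> n \<le> 2 * i then (if even i then i + 1 else i - 1) else i)"

text \<open>
  Chosen such that the three shifts sum to \<open>1\<close> modulo \<open>n\<close>, with two exceptions. If \<open>n\<close> is \<open>2\<close> modulo \<open>4\<close>,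
  the sum is \<open>2\<close> for odd \<open>i\<close>, where the transposition joins the two cycles of the shift by \<open>2\<close>. If \<open>4\<close> divides
  \<open>n\<close>, the sum is \<open>-1\<close> for the even colours in the upper half, because \<open>1\<close> would
  give values that \<open>last_shift\<close> already takes. Multiples of \<open>n\<close> are added to stay in the natural numbers.
\<close>

definition last_shift :: "nat \<Rightarrow> nat \<Rightarrow> nat" where
  "last_shift n i =
     (if odd i \<and> (n mod 4 = 2 \<or> n mod 4 = 0 \<and> n \<le> 2 * i) then 2 * n + 2 - 2 * i
      else if even i \<and> n mod 4 = 0 \<and> n \<le> 2 * i then 2 * n - 2 - 2 * i
      else 2 * n + 1 - 2 * i)"

definition triangle_step :: "nat \<Rightarrow> 'a \<Rightarrow> 'a \<Rightarrow> nat \<Rightarrow> 'a \<Rightarrow> 'a \<Rightarrow> nat \<Rightarrow> nat" where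
  "triangle_step n a b i u v p =
     (if u = a then p + i
      else if u = b then twist n i p + middle_shift n i
      else p + last_shift n i) mod n"

lemma twist_bij: "n \<noteq> 2 \<Longrightarrow> bij_betw (twist n i) {..<n} {..<n}"
proof -
  assume n: "n \<noteq> 2"
  have "inj_on (twist n i) {..<n}" by (auto simp: inj_on_def twist_def split: if_splits)
  moreover have "twist n i p < n" if "p < n" for p
  proof (cases "n mod 4 = 2")
    case True
    then have "n \<ge> 6" using n by presburger
    then show ?thesis using that by (auto simp: twist_def)
  qed (use that in \<open>simp add: twist_def\<close>)
  then have "twist n i ` {..<n} \<subseteq> {..<n}" by auto
  ultimately show ?thesis using endo_inj_surj[of "{..<n}"] by (auto simp: bij_betw_def)
qed

lemma add_mod_cancel:
  fixes n :: nat
  assumes "0 < n" "(p + x) mod n = (p + y) mod n"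
  shows "x mod n = y mod n"
  using nat_eq_of_add_mod_eq[of "x mod n" p n "y mod n"] assms
  by (simp add: mod_add_left_eq add.commute mod_simps)

lemma middle_shift_inj: "inj_on (middle_shift n) {..<n}"
proof (rule inj_onI)
  fix i j assume eq: "middle_shift n i = middle_shift n j" and ij: "i \<in> {..<n}" "j \<in> {..<n}"
  show "i = j"
  proof (cases "n mod 4 = 0")
    case True
    then obtain h where "n = 4 * h" by auto
    with eq ij show ?thesis
      unfolding middle_shift_def by - (cases "even i"; cases "even j"; auto elim!: evenE oddE split: if_splits; presburger)
  qed (use eq in \<open>simp add: middle_shift_def\<close>)
qed

lemma middle_shift_less: "i < n \<Longrightarrow> middle_shift n i < n"
  unfolding middle_shift_def by (auto elim!: evenE; presburger)


lemma last_shift_int: 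
  assumes "i < n"
  shows "int (last_shift n i) = 2 * int n - 2 * int i +
     (if odd i \<and> (n mod 4 = 2 \<or> n mod 4 = 0 \<and> n \<le> 2 * i) then 2
      else if even i \<and> n mod 4 = 0 \<and> n \<le> 2 * i then - 2 else 1)"
proof -
  have "even i \<Longrightarrow> n mod 4 = 0 \<Longrightarrow> i + 1 < n"
    using assms by presburger
  then show ?thesis using assms unfolding last_shift_def by auto
qed

lemma int_eq_of_dvd_diff: "(n::int) dvd i - j \<Longrightarrow> \<bar>i - j\<bar> < n \<Longrightarrow> i = j"
  using dvd_imp_le_int[of "i - j" n] by auto

text \<open>
  Up to a correction \<open>e i\<close> the shift is \<open>-2 i\<close>, so two equal values make \<open>2 (j - i)\<close> plus a difference of
  corrections a multiple of \<open>n\<close>. For odd \<open>n\<close> the factor \<open>2\<close> cancels. For even \<open>n\<close> the parities of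
  the corrections agree. If \<open>n = 4 h + 2\<close>, this makes \<open>j - i\<close> an even multiple of \<open>n / 2\<close>. If \<open>n = 4 h\<close>,
  both colours lie in the same half, where a multiple of \<open>n / 2\<close> as difference means equality.
\<close>

lemma last_shift_inj:
  assumes eq: "last_shift n i mod n = last_shift n j mod n" and ij: "i < n" "j < n"
  shows "i = j"
proof -
  have "int n dvd int (last_shift n i) - int (last_shift n j)"
    using eq by (metis mod_eq_dvd_iff zmod_int)
  then obtain k where k: "int (last_shift n i) - int (last_shift n j) = int n * k" by (rule dvdE)
  have dvd_n: "i = j" if "int i - int j = int n * k'" for k'
    using int_eq_of_dvd_diff[of "int n" "int i" "int j"] that ij by auto
  have "odd n \<or> n mod 4 = 2 \<or> n mod 4 = 0" by presburger
  then show ?thesis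
  proof (elim disjE)
    assume n: "odd n"
    then have "n mod 4 \<noteq> 2" "n mod 4 \<noteq> 0" by presburger+
    then have "2 * (int j - int i) = int n * k" using k ij by (simp add: last_shift_int)
    moreover then have "even k" using n by (metis dvd_triv_left even_mult_iff even_of_nat_iff)
    then obtain k' where "k = 2 * k'" by (rule evenE)
    ultimately have "int i - int j = int n * (- k')" by simp
    then show ?thesis by (rule dvd_n)
  next
    assume n: "n mod 4 = 2"
    then have "n = 4 * (n div 4) + 2" by presburger
    then obtain h where h: "n = 4 * h + 2" by blast
    define e where "e x = (if odd x then 2 else 1 :: int)" for x :: nat
    have k2: "2 * (int j - int i) + e i - e j = (4 * int h + 2) * k"
    proof -
      have "int (last_shift n x) = 2 * int n - 2 * int x + e x" if "x < n" for x
        using last_shift_int[OF that] n by (simp add: e_def)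
      then have "2 * (int j - int i) + e i - e j = int (last_shift n i) - int (last_shift n j)"
        using ij by simp
      then have "2 * (int j - int i) + e i - e j = int n * k" using k by simp
      moreover have "int n = 4 * int h + 2" using h by simp
      ultimately show ?thesis by simp
    qed
    then have "even i = even j"
    proof -
      have "e i - e j = 2 * ((2 * int h + 1) * k - (int j - int i))"
        using k2 by (simp add: algebra_simps)
      then have "even (e i - e j)" by simp
      then show ?thesis by (auto simp: e_def split: if_splits)
    qed
    then have "e i = e j" "even (int j - int i)" by (auto simp: e_def)
    then have "int j - int i = (2 * int h + 1) * k" using k2 by (simp add: algebra_simps)
    with \<open>even (int j - int i)\<close> have "even ((2 * int h + 1) * k)" by simp
    then have "even k" by simp
    then obtain k' where "k = 2 * k'" by (rule evenE)
    with \<open>int j - int i = (2 * int h + 1) * k\<close> have "int i - int j = int n * (- k')"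
      using h by (simp add: algebra_simps)
    then show ?thesis by (rule dvd_n)
  next
    assume n: "n mod 4 = 0"
    then obtain h where h: "n = 4 * h" by auto
    define e where "e x = (if n \<le> 2 * x then if odd x then 2 else - 2 else 1 :: int)" for x :: nat
    have k2: "2 * (int j - int i) + e i - e j = 4 * int h * k"
    proof -
      have "int (last_shift n x) = 2 * int n - 2 * int x + e x" if "x < n" for x
        using last_shift_int[OF that] n by (simp add: e_def)
      then have "2 * (int j - int i) + e i - e j = int (last_shift n i) - int (last_shift n j)"
        using ij by simp
      then have "2 * (int j - int i) + e i - e j = int n * k" using k by simp
      moreover have "int n = 4 * int h" using h by simp
      ultimately show ?thesis by simp
    qed
    then have "e i - e j = 2 * (2 * int h * k - (int j - int i))" by (simp add: algebra_simps)
    then have "even (e i - e j)" by simp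
    then have le: "n \<le> 2 * i \<longleftrightarrow> n \<le> 2 * j" by (auto simp: e_def split: if_splits)
    have "e i = e j"
    proof (rule ccontr)
      assume "e i \<noteq> e j"
      then have "odd (int j - int i)" "e i - e j = 4 \<or> e i - e j = -4" using le by (auto simp: e_def split: if_splits)
      moreover have "int j - int i = 2 * (int h * k) - (e i - e j) div 2"
        using k2 calculation(2) by auto
      ultimately show False by auto
    qed
    then have "int i - int j = int (n div 2) * (- k)" using k2 h by simp
    moreover have "\<bar>int i - int j\<bar> < int (n div 2)" using le ij h by auto
    ultimately show ?thesis
      using int_eq_of_dvd_diff[of "int (n div 2)" "int i" "int j"] by simp
  qed
qed

lemma triangle_step_bij:
  assumes "0 < n" "n \<noteq> 2"
  shows "bij_betw (triangle_step n a b i u v) {..<n} {..<n}"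
proof -
  consider "u = a" | "u \<noteq> a" "u = b" | "u \<noteq> a" "u \<noteq> b" by blast
  then show ?thesis
  proof cases
    case 2
    have "triangle_step n a b i u v = (\<lambda>p. (p + middle_shift n i) mod n) \<circ> twist n i"
      using 2 by (auto simp: triangle_step_def)
    then show ?thesis using bij_betw_trans[OF twist_bij add_mod_bij] assms by metis
  qed (use add_mod_bij[OF assms(1)] in \<open>simp_all add: triangle_step_def[abs_def]\<close>)
qed

lemma triangle_step_inj:
  assumes "p < n"
  shows "inj_on (\<lambda>i. triangle_step n a b i u v p) {..<n}"
proof (rule inj_onI)
  fix i j assume ij: "i \<in> {..<n}" "j \<in> {..<n}"
    and eq: "triangle_step n a b i u v p = triangle_step n a b j u v p"
  have n: "0 < n" using assms by simp
  consider "u = a" | "u \<noteq> a" "u = b" | "u \<noteq> a" "u \<noteq> b" by blast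
  then show "i = j"
  proof cases
    case 1
    then show ?thesis using add_mod_cancel[OF n, of p i j] eq ij by (simp add: triangle_step_def)
  next
    case 2
    then have eq: "(twist n i p + middle_shift n i) mod n = (twist n j p + middle_shift n j) mod n"
      using eq by (simp add: triangle_step_def)
    have "twist n i p = twist n j p"
    proof (cases "n mod 4 = 2")
      case True
      then have "even n" by presburger
      have "(x mod n) mod 2 = x mod 2" for x using \<open>even n\<close> by (simp add: mod_mod_cancel)
      then have "(twist n i p + i) mod 2 = (twist n j p + j) mod 2"
        using eq True by (metis middle_shift_def zero_neq_numeral)
      moreover have "twist n i p mod 2 = twist n j p mod 2" by (auto simp: twist_def)
      ultimately have "i mod 2 = j mod 2" using add_mod_cancel[of 2] by (metis mod_add_cong pos2 mod_add_left_eq)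
      then have "even i = even j" by (simp add: even_iff_mod_2_eq_zero)
      then show ?thesis by (simp add: twist_def)
    qed (simp add: twist_def)
    then have "middle_shift n i = middle_shift n j"
      using add_mod_cancel[OF n] eq ij middle_shift_less by (metis lessThan_iff mod_less)
    then show ?thesis using middle_shift_inj ij by (auto dest: inj_onD)
  next
    case 3
    then have "last_shift n i mod n = last_shift n j mod n"
      using add_mod_cancel[OF n, of p "last_shift n i" "last_shift n j"] eq
      by (simp add: triangle_step_def)
    then show ?thesis using last_shift_inj ij by blast
  qed
qed

lemma cyclic_enumeration_connects:
  fixes n :: nat
  assumes "\<And>p. p < n \<Longrightarrow> (x p, x ((p + 1) mod n)) \<in> R\<^sup>*"
    and "y \<in> x ` {..<n}" "z \<in> x ` {..<n}"
  shows "(y, z) \<in> R\<^sup>*"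
  using cyclic_steps_connect[of n x "R\<^sup>*"] assms by auto

text \<open>
  The permutation \<open>y \<mapsto> twist n i y + s\<close> is a single cycle: for even \<open>i\<close> it is
  \<open>0, 2, 1, 3, 4, \<dots>, n - 1\<close>, and for odd \<open>i\<close> it is \<open>0, 3, 5, \<dots>, n - 1, 1, 2, 4, \<dots>, n - 2\<close>. The functions \<open>x\<close>
  in the proof enumerate these cycles.
\<close>

lemma twisted_fibre_connected:
  assumes n: "n mod 4 = 2" "n \<noteq> 2" and s: "s = (if even i then 1 else 2)"
    and step: "\<And>y. y < n \<Longrightarrow> (f y, f ((twist n i y + s) mod n)) \<in> R\<^sup>*"
    and pq: "p < n" "q < n"
  shows "(f p, f q) \<in> R\<^sup>*"
proof -
  have n6: "n \<ge> 6" using n by presburger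
  show ?thesis
  proof (cases "even i")
    case True
    define x where "x p = (if p = 1 then 2 else if p = 2 then 1 else p)" for p :: nat
    have x_less: "x p < n" if "p < n" for p using that n6 by (simp add: x_def)
    have "(twist n i (x p) + s) mod n = x ((p + 1) mod n)" if "p < n" for p
      using that True n n6 s by (cases "p + 1 = n") (auto simp: twist_def x_def)
    then have steps: "(f (x p), f (x ((p + 1) mod n))) \<in> R\<^sup>*" if "p < n" for p
      using step[OF x_less[OF that]] that by simp
    have onto: "f y \<in> (\<lambda>p. f (x p)) ` {..<n}" if "y < n" for y
      using that x_less[OF that] by (intro image_eqI[of _ _ "x y"]) (auto simp: x_def)
    show ?thesis
      by (rule cyclic_enumeration_connects[of n "\<lambda>p. f (x p)", OF steps onto[OF pq(1)] onto[OF pq(2)]])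
  next
    case False
    have "n = 2 * (n div 2)" using n(1) by presburger
    then obtain m where m: "n = 2 * m" by blast
    define x where "x p = (if p = 0 then 0 else if p < m then 2 * p + 1
      else if p = m then 1 else 2 * (p - m))" for p
    have x_less: "x p < n" if "p < n" for p using that m n6 by (auto simp: x_def)
    have "(twist n i (x p) + s) mod n = x ((p + 1) mod n)" if "p < n" for p
    proof -
      have "p = 0 \<or> (0 < p \<and> p + 1 < m) \<or> p + 1 = m \<or> p = m \<or> (m < p \<and> p + 1 < n) \<or> p + 1 = n"
        using that m by linarith
      then show ?thesis
        using False n n6 s m that by (elim disjE) (auto simp: twist_def x_def le_mod_geq)
    qed
    then have steps: "(f (x p), f (x ((p + 1) mod n))) \<in> R\<^sup>*" if "p < n" for p
      using step[OF x_less[OF that]] that by simp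
    have onto: "f y \<in> (\<lambda>p. f (x p)) ` {..<n}" if "y < n" for y
    proof (cases "even y")
      case True
      then show ?thesis using that m
        by (intro image_eqI[of _ _ "if y = 0 then 0 else m + y div 2"]) (auto simp: x_def)
    next
      case False
      then obtain r where "y = 2 * r + 1" by (rule oddE)
      then show ?thesis using that m n6
        by (intro image_eqI[of _ _ "if r = 0 then m else r"]) (auto simp: x_def)
    qed
    show ?thesis
      by (rule cyclic_enumeration_connects[of n "\<lambda>p. f (x p)", OF steps onto[OF pq(1)] onto[OF pq(2)]])
  qed
qed

lemma shift_total:
  assumes "i < n"
  shows "middle_shift n i + last_shift n i + i =
    (if n mod 4 = 2 \<and> odd i then 2 * n + 2
     else if n mod 4 = 0 \<and> n \<le> 2 * i \<and> even i then 2 * n - 1 else 2 * n + 1)"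
  using assms unfolding middle_shift_def last_shift_def by (auto elim!: oddE evenE; presburger)

text \<open>
  The fibre over \<open>b\<close> is considered, so that one turn around the triangle starts with the
  permutation and ends with the sum of the three shifts.
\<close>

lemma (in numbered_composition) triangle_core_packing:
  assumes T: "directed_triangle D a b c" and n2: "n \<noteq> 2"
  shows "core_packing (\<lambda>_. n) (layered n A (triangle_step n a b))"
proof (rule layered_core_packing)
  show "bij_betw (triangle_step n a b i u v) {..<n} {..<n}" for i u v
    using n_pos n2 by (intro triangle_step_bij) auto
  show "inj_on (\<lambda>i. triangle_step n a b i u v p) {..<n}" if "p < n" for u v p
    using that by (rule triangle_step_inj)
  fix i assume i: "i < n"
  let ?R = "layered n A (triangle_step n a b) i"
  have neq: "a \<noteq> b" "b \<noteq> c" "c \<noteq> a" and arcs: "(a, b) \<in> A" "(b, c) \<in> A" "(c, a) \<in> A"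
    and bV: "b \<in> V" using T by (auto simp: directed_triangle_def)
  have step: "((b, y), (b, (twist n i y + (middle_shift n i + last_shift n i + i)) mod n)) \<in> ?R\<^sup>*"
    if "y < n" for y
  proof -
    have "((b, y), (c, (twist n i y + middle_shift n i) mod n)) \<in> ?R"
      using arcs that neq by (intro layered_arc) (auto simp: triangle_step_def)
    moreover have "((c, (twist n i y + middle_shift n i) mod n),
        (a, (twist n i y + middle_shift n i + last_shift n i) mod n)) \<in> ?R"
      using arcs neq n_pos by (intro layered_arc) (auto simp: triangle_step_def mod_add_left_eq)
    moreover have "((a, (twist n i y + middle_shift n i + last_shift n i) mod n),
        (b, (twist n i y + middle_shift n i + last_shift n i + i) mod n)) \<in> ?R"
      using arcs neq n_pos by (intro layered_arc) (auto simp: triangle_step_def mod_add_left_eq)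
    ultimately show ?thesis by (simp add: add.assoc)
  qed
  have "((b, p), (b, q)) \<in> ?R\<^sup>*" if pq: "p < n" "q < n" for p q
  proof -
    consider "n mod 4 = 2" | "n mod 4 \<noteq> 2" "middle_shift n i + last_shift n i + i = 2 * n + 1"
      | "n mod 4 \<noteq> 2" "middle_shift n i + last_shift n i + i = 2 * n - 1"
      using shift_total[OF i] by (cases "n mod 4 = 2") (auto split: if_splits)
    then show ?thesis
    proof cases
      case 1
      let ?s = "if even i then 1 else 2 :: nat"
      have "middle_shift n i + last_shift n i + i = ?s + 2 * n" using 1 shift_total[OF i] by auto
      then have "(twist n i y + (middle_shift n i + last_shift n i + i)) mod n
          = (twist n i y + ?s) mod n" for y
        by (simp add: add.assoc[symmetric])
      then show ?thesis
        using twisted_fibre_connected[where f = "Pair b" and R = ?R and i = i, OF 1 n2 refl _ pq]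
          step by simp
    next
      case 2
      have "((b, y), (b, (y + 1) mod n)) \<in> ?R\<^sup>*" if "y < n" for y
        using step[OF that] 2 by (simp add: twist_def)
      then show ?thesis using cyclic_enumeration_connects[of n "Pair b" ?R] pq by auto
    next
      case 3
      \<comment> \<open>A total shift of \<open>-1\<close> runs through the fibre backwards, so the converse relation is used.\<close>
      have "((b, (y + 1) mod n), (b, y)) \<in> ?R\<^sup>*" if "y < n" for y
      proof -
        have "((y + 1) mod n + (2 * n - 1)) mod n = (y + 1 + (2 * n - 1)) mod n"
          by (rule mod_add_left_eq)
        also have "y + 1 + (2 * n - 1) = y + 2 * n" using that by arith
        finally have "((y + 1) mod n + (2 * n - 1)) mod n = y" using that by simp
        then show ?thesis using step[of "(y + 1) mod n"] that 3 by (simp add: twist_def)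
      qed
      then have "((b, y), (b, (y + 1) mod n)) \<in> ((?R\<inverse>)\<^sup>*)" if "y < n" for y
        using that by (simp add: rtrancl_converse)
      then have "((b, q), (b, p)) \<in> (?R\<inverse>)\<^sup>*"
        using cyclic_enumeration_connects[of n "Pair b" "?R\<inverse>"] pq by auto
      then show ?thesis by (simp add: rtrancl_converse)
    qed
  qed
  then show "\<exists>u\<in>V. \<forall>p<n. \<forall>q<n. ((u, p), (u, q)) \<in> ?R\<^sup>*" using bV by blast
qed

section \<open>The directed triangle with two layers\<close>

type_synonym cell = "nat \<times> nat"

text \<open>
  A pattern prescribes the numbers of core vertices in the three parts of the triangle and, for each of
  the two colours, a closed walk through all cells; a cell is a pair of a corner and a number.
\<close>

type_synonym pattern = "nat list \<times> cell list \<times> cell list"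

definition walk_arcs :: "'c list \<Rightarrow> 'c rel" where
  "walk_arcs w = set (zip w (tl w))"

lemma closed_walk_connected:
  assumes "w \<noteq> []" "hd w = last w" "x \<in> set w" "y \<in> set w"
  shows "(x, y) \<in> (walk_arcs w)\<^sup>*"
proof -
  have forward: "(w ! i, w ! j) \<in> (walk_arcs w)\<^sup>*" if "i \<le> j" "j < length w" for i j
    using that
  proof (induction j)
    case (Suc j)
    show ?case
    proof (cases "i = Suc j")
      case False
      then have "(w ! i, w ! j) \<in> (walk_arcs w)\<^sup>*" using Suc by simp
      moreover have "(w ! j, w ! Suc j) \<in> walk_arcs w"
        using Suc.prems unfolding walk_arcs_def in_set_zip
        by (intro exI[of _ j]) (simp add: nth_tl)
      ultimately show ?thesis by (rule rtrancl_into_rtrancl)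
    qed simp
  qed simp
  obtain i j where ij: "x = w ! i" "i < length w" "y = w ! j" "j < length w"
    using assms by (auto simp: in_set_conv_nth)
  have "(x, last w) \<in> (walk_arcs w)\<^sup>*"
    using forward[of i "length w - 1"] ij assms(1) by (simp add: last_conv_nth)
  moreover have "(hd w, y) \<in> (walk_arcs w)\<^sup>*"
    using forward[of 0 j] ij assms(1) by (simp add: hd_conv_nth)
  ultimately show ?thesis using assms(2) by simp
qed

definition rotate_pattern :: "nat \<Rightarrow> pattern \<Rightarrow> pattern" where
  "rotate_pattern r = (\<lambda>(ks, w, w').
     (rotate r ks, map (map_prod (\<lambda>j. (j + 3 - r) mod 3) id) w,
        map (map_prod (\<lambda>j. (j + 3 - r) mod 3) id) w'))"

text \<open>
  One pattern for each minimal way to avoid the exceptional digraphs, up to rotation: with parts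
  of order two, opposite arcs in one part, or arcs in two parts; with a part of order three,
  an arc in any of the three parts; and without inner arcs, a part of order four or two parts of order
  three. The walks were found by computer search.
\<close>

definition base_patterns :: "pattern list" where
  "base_patterns =
    [([2, 2, 2], [(0,0), (1,1), (2,0), (0,1), (1,0), (2,1), (0,0)],
       [(0,0), (1,0), (2,0), (0,0), (0,1), (1,1), (2,1), (0,1), (0,0)]),
     ([2, 2, 2], [(0,0), (1,0), (2,0), (0,1), (1,1), (2,1), (0,0)],
       [(0,0), (0,1), (1,0), (2,1), (0,1), (1,0), (1,1), (2,0), (0,0)]),
     ([2, 2, 3], [(0,0), (1,1), (2,0), (0,1), (1,0), (2,1), (0,1), (1,0), (2,2), (0,0)],
       [(0,0), (1,0), (2,0), (0,0), (0,1), (1,1), (2,2), (0,1), (1,1), (2,1), (0,0)]),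
     ([2, 2, 3], [(0,0), (1,0), (2,0), (0,1), (1,1), (2,1), (0,0), (1,0), (2,2), (0,0)],
       [(0,0), (1,1), (2,2), (0,1), (1,0), (2,1), (0,1), (1,0), (1,1), (2,0), (0,0)]),
     ([2, 2, 3], [(0,0), (1,0), (2,1), (0,1), (1,1), (2,0), (0,0), (1,0), (2,2), (0,0)],
       [(0,0), (1,1), (2,2), (0,1), (1,0), (2,0), (2,1), (0,0)]),
     ([2, 2, 4], [(0,0), (1,1), (2,0), (0,1), (1,0), (2,1), (0,1), (1,0), (2,3), (0,0), (1,1), (2,2), (0,0)],
       [(0,0), (1,0), (2,0), (0,0), (1,0), (2,2), (0,1), (1,1), (2,3), (0,1), (1,1), (2,1), (0,0)]),
     ([2, 3, 3], [(0,0), (1,1), (2,1), (0,0), (1,2), (2,0), (0,1), (1,0), (2,2), (0,0)],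
       [(0,0), (1,0), (2,1), (0,1), (1,2), (2,2), (0,1), (1,1), (2,0), (0,0)])]"

definition patterns :: "pattern list" where
  "patterns = concat (map (\<lambda>r. map (rotate_pattern r) base_patterns) [0, 1, 2])"

definition valid_pattern :: "pattern \<Rightarrow> bool" where
  "valid_pattern = (\<lambda>(ks, w, w').
     length ks = 3 \<and> list_all (\<lambda>k. 2 \<le> k) ks \<and>
     list_all (\<lambda>v. v \<noteq> [] \<and> hd v = last v \<and>
       set v = set (concat (map (\<lambda>j. map (Pair j) [0..<ks ! j]) [0, 1, 2])) \<and>
       list_all (\<lambda>((j, p), (j', q)). j' = j \<or> j' = (j + 1) mod 3) (zip v (tl v))) [w, w'] \<and>
     list_all (\<lambda>e. \<not> List.member (zip w' (tl w')) e) (zip w (tl w)))"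

text \<open>
  The arcs of the two walks that stay inside a part; these are what a pattern demands besides the sizes.
\<close>

definition inner_arcs :: "pattern \<Rightarrow> (nat \<times> nat \<times> nat) list" where
  "inner_arcs = (\<lambda>(ks, w, w'). map (\<lambda>((j, p), (j', q)). (j, p, q))
     (filter (\<lambda>((j, p), (j', q)). j = j') (zip w (tl w) @ zip w' (tl w'))))"

lemma inner_arcI:
  "((j, p), (j, q)) \<in> walk_arcs w \<union> walk_arcs w' \<Longrightarrow> (j, p, q) \<in> set (inner_arcs (ks, w, w'))"
  unfolding inner_arcs_def walk_arcs_def
  by (auto intro!: image_eqI[of _ _ "((j, p), (j, q))"])

lemma pattern_demands:
  "map (\<lambda>pat. (fst pat, inner_arcs pat)) patterns =
    [([2, 2, 2], [(0, 0, 1), (0, 1, 0)]),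
     ([2, 2, 2], [(0, 0, 1), (1, 0, 1)]),
     ([2, 2, 3], [(0, 0, 1)]),
     ([2, 2, 3], [(1, 0, 1)]),
     ([2, 2, 3], [(2, 0, 1)]),
     ([2, 2, 4], []),
     ([2, 3, 3], []),
     ([2, 2, 2], [(2, 0, 1), (2, 1, 0)]),
     ([2, 2, 2], [(2, 0, 1), (0, 0, 1)]),
     ([2, 3, 2], [(2, 0, 1)]),
     ([2, 3, 2], [(0, 0, 1)]),
     ([2, 3, 2], [(1, 0, 1)]),
     ([2, 4, 2], []),
     ([3, 3, 2], []),
     ([2, 2, 2], [(1, 0, 1), (1, 1, 0)]),
     ([2, 2, 2], [(1, 0, 1), (2, 0, 1)]),
     ([3, 2, 2], [(1, 0, 1)]),
     ([3, 2, 2], [(2, 0, 1)]),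
     ([3, 2, 2], [(0, 0, 1)]),
     ([4, 2, 2], []),
     ([3, 2, 3], [])]"
  by code_simp

lemma patterns_valid: "list_all valid_pattern patterns"
  by code_simp

definition corner :: "'a \<Rightarrow> 'a \<Rightarrow> 'a \<Rightarrow> nat \<Rightarrow> 'a" where
  "corner a b c j = (if j = 0 then a else if j = 1 then b else c)"

context numbered_composition
begin

definition pattern_fits :: "(nat \<Rightarrow> 'a) \<Rightarrow> pattern \<Rightarrow> bool" where
  "pattern_fits f pat \<longleftrightarrow>
     (\<forall>j<3. fst pat ! j \<le> N (f j)) \<and>
     (\<forall>(j, p, q) \<in> set (inner_arcs pat). (E (f j) p, E (f j) q) \<in> parcs (H (f j)))"

definition pattern_size :: "(nat \<Rightarrow> 'a) \<Rightarrow> pattern \<Rightarrow> 'a \<Rightarrow> nat" where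
  "pattern_size f = (\<lambda>(ks, w, w') u. if u = f 0 then ks ! 0 else if u = f 1 then ks ! 1 else ks ! 2)"

definition pattern_colour :: "(nat \<Rightarrow> 'a) \<Rightarrow> pattern \<Rightarrow> nat \<Rightarrow> ('a \<times> nat) rel" where
  "pattern_colour f = (\<lambda>(ks, w, w') i.
     map_prod (map_prod f id) (map_prod f id) ` walk_arcs (if i = 0 then w else w'))"

lemma pattern_core_packing:
  assumes T: "directed_triangle D a b c" and n: "n = 2"
    and pat: "pat \<in> set patterns" and fits: "pattern_fits (corner a b c) pat"
  shows "core_packing (pattern_size (corner a b c) pat) (pattern_colour (corner a b c) pat)"
proof -
  let ?f = "corner a b c"
  let ?F = "map_prod ?f id :: nat \<times> nat \<Rightarrow> _"
  have neq: "a \<noteq> b" "b \<noteq> c" "c \<noteq> a" and V: "V = {a, b, c}" and A: "A = {(a, b), (b, c), (c, a)}"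
    using T by (auto simp: directed_triangle_def)
  obtain ks w w' where p: "pat = (ks, w, w')" by (cases pat)
  have valid: "valid_pattern (ks, w, w')"
    using patterns_valid pat by (auto simp: list_all_iff p)
  define wk where "wk i = (if i = 0 then w else w')" for i :: nat
  have less3: "j < 3 \<longleftrightarrow> j = 0 \<or> j = 1 \<or> j = 2" for j :: nat by auto
  have wk: "wk i \<noteq> []" "hd (wk i) = last (wk i)" for i
    using valid by (simp_all add: valid_pattern_def wk_def)
  have wk_arc: "j' = j \<or> j' = (j + 1) mod 3" if "((j, q), (j', q')) \<in> walk_arcs (wk i)" for i j q j' q'
  proof -
    have "list_all (\<lambda>((j, p), (j', q)). j' = j \<or> j' = (j + 1) mod 3) (zip (wk i) (tl (wk i)))"
      using valid by (simp add: valid_pattern_def wk_def)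
    then show ?thesis using that unfolding list_all_iff walk_arcs_def by fast
  qed
  have cells: "set (wk i) = {(j, q). j < 3 \<and> q < ks ! j}" for i
  proof -
    have "set (wk i) = set (concat (map (\<lambda>j. map (Pair j) [0..<ks ! j]) [0, 1, 2]))"
      using valid unfolding valid_pattern_def wk_def by simp
    also have "\<dots> = {(j, q). j < 3 \<and> q < ks ! j}" by (auto simp: less3)
    finally show ?thesis .
  qed
  have ks: "2 \<le> ks ! j" if "j < 3" for j
    using valid that by (auto simp: valid_pattern_def list_all_length)
  have disj: "walk_arcs (wk 0) \<inter> walk_arcs (wk 1) = {}"
    using valid by (auto simp: valid_pattern_def wk_def walk_arcs_def list_all_iff)
  have size: "pattern_size ?f pat (?f j) = ks ! j" if "j < 3" for j
    using that neq by (auto simp: pattern_size_def p corner_def less3)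
  have f_inj: "inj_on ?f {..<3}"
    using neq by (auto simp: inj_on_def corner_def less3)
  have f_V: "V = ?f ` {..<3}"
    using V by (auto simp: corner_def image_iff less3)
  have f_A: "(?f j, ?f ((j + 1) mod 3)) \<in> A" if "j < 3" for j
    using that unfolding less3 A by (elim disjE) (simp_all add: corner_def)
  have col: "pattern_colour ?f pat i = map_prod ?F ?F ` walk_arcs (wk i)" for i
    by (simp add: pattern_colour_def p wk_def)
  have in_cells: "x \<in> set (wk i)" "y \<in> set (wk i)" if "(x, y) \<in> walk_arcs (wk i)" for x y i
    using that unfolding walk_arcs_def
    by (auto dest: set_zip_leftD set_zip_rightD list.set_sel(2)[OF wk(1)])
  show ?thesis
    unfolding core_packing_def
  proof (intro conjI allI ballI impI)
    fix u assume "u \<in> V"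
    then obtain j where "u = ?f j" "j < 3" using f_V by auto
    then show "n \<le> pattern_size ?f pat u" "pattern_size ?f pat u \<le> N u"
      using fits ks n size by (auto simp: pattern_fits_def p)
  next
    fix i e assume "i < n" "e \<in> pattern_colour ?f pat i"
    then obtain j q j' q' where e: "e = ((?f j, q), (?f j', q'))" "((j, q), (j', q')) \<in> walk_arcs (wk i)"
      unfolding col by auto
    have jq: "j < 3" "q < ks ! j" "j' < 3" "q' < ks ! j'"
      using in_cells[OF e(2)] cells by auto
    have "((j, q), (j', q')) \<in> walk_arcs w \<union> walk_arcs w'" using e(2) by (auto simp: wk_def split: if_splits)
    then have "(j, q, q') \<in> set (inner_arcs pat)" if "j = j'"
      unfolding p using that by (intro inner_arcI) simp
    then have "j = j' \<Longrightarrow> (E (?f j) q, E (?f j) q') \<in> parcs (H (?f j))"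
      using fits unfolding pattern_fits_def by fast
    then show "case e of (x, y) \<Rightarrow> (case x of (u, p) \<Rightarrow> \<lambda>(v, q). u \<in> V \<and> v \<in> V \<and>
        p < pattern_size ?f pat u \<and> q < pattern_size ?f pat v \<and>
        ((u, v) \<in> A \<or> u = v \<and> (E u p, E u q) \<in> parcs (H u))) y"
      using jq size f_V f_A[of j] wk_arc[OF e(2)] by (auto simp: e(1))
  next
    fix i j assume "i < n" "j < n" "i \<noteq> j"
    then have ij: "(i = 0 \<and> j = 1) \<or> (i = 1 \<and> j = 0)" using n by auto
    have inj: "inj_on (map_prod ?F ?F) (set (wk 0) \<times> set (wk 1))"
      using f_inj cells by (fastforce simp: inj_on_def)
    have "walk_arcs (wk 0) \<subseteq> set (wk 0) \<times> set (wk 1)" "walk_arcs (wk 1) \<subseteq> set (wk 0) \<times> set (wk 1)"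
      using in_cells cells by auto
    from inj_on_image_Int[OF inj this]
    have "pattern_colour ?f pat 0 \<inter> pattern_colour ?f pat 1 = {}" using disj by (simp add: col)
    then show "pattern_colour ?f pat i \<inter> pattern_colour ?f pat j = {}" using ij by auto
  next
    fix i x y assume "x \<in> core (pattern_size ?f pat)" "y \<in> core (pattern_size ?f pat)"
    moreover have "core (pattern_size ?f pat) \<subseteq> ?F ` set (wk i)"
      unfolding cells core_def f_V using size by (force simp: image_iff)
    ultimately have "x \<in> ?F ` set (wk i)" "y \<in> ?F ` set (wk i)" by (auto dest: subsetD)
    then obtain x' y' where "x = ?F x'" "y = ?F y'" "x' \<in> set (wk i)" "y' \<in> set (wk i)"
      by (elim imageE)
    then show "(x, y) \<in> (pattern_colour ?f pat i)\<^sup>*"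
      unfolding col using rtrancl_map_prod[OF closed_walk_connected[OF wk(1,2)]] by simp
  qed
qed

end


text \<open>
  The map is given from \<open>R\<close> to \<open>Q\<close>, because the exceptional digraphs have explicit vertices; the
  isomorphism is its inverse.
\<close>

lemma digraph_iso_of_image:
  assumes R: "pair_wf_digraph R" and inj: "inj_on \<psi> (pverts R)"
    and verts: "pverts Q = \<psi> ` pverts R" and arcs: "parcs Q = map_prod \<psi> \<psi> ` parcs R"
  shows "digraph_iso (with_proj Q) (with_proj R)"
proof -
  interpret R: pair_wf_digraph R by fact
  have Q: "pair_wf_digraph Q"
    using R.wellformed' by unfold_locales (auto simp: verts arcs)
  let ?\<phi> = "the_inv_into (pverts R) \<psi>"
  have \<phi>: "?\<phi> (\<psi> x) = x" if "x \<in> pverts R" for x using that inj by (rule the_inv_into_f_f[rotated])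
  let ?h = "\<lparr>iso_verts = ?\<phi>, iso_arcs = map_prod ?\<phi> ?\<phi>, iso_head = snd, iso_tail = fst\<rparr>"
  have v: "?\<phi> ` pverts Q = pverts R" unfolding verts image_image using \<phi> by (auto simp: image_iff)
  have a: "map_prod ?\<phi> ?\<phi> ` parcs Q = parcs R"
  proof -
    have "map_prod ?\<phi> ?\<phi> (map_prod \<psi> \<psi> e) = e" if "e \<in> parcs R" for e
      using that \<phi> R.wellformed' by (cases e) auto
    then show ?thesis unfolding arcs image_image by (simp cong: image_cong_simp)
  qed
  have "inj_on ?\<phi> (pverts Q)" unfolding verts by (rule inj_on_the_inv_into[OF inj])
  moreover from this have "inj_on (map_prod ?\<phi> ?\<phi>) (parcs Q)"
    using pair_wf_digraph.wellformed'[OF Q] by (intro inj_on_subset[OF map_prod_inj_on]) auto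
  ultimately have "pre_digraph.digraph_isomorphism (with_proj Q) ?h"
    using Q by (simp add: pre_digraph.digraph_isomorphism_def wf_digraph_wp_iff)
  moreover have "with_proj R = app_iso ?h (with_proj Q)"
    using v a by (simp add: app_iso_def with_proj_def)
  ultimately show ?thesis unfolding digraph_iso_def by blast
qed

text \<open>
  The numbering puts an arc, if there is one, at the positions \<open>0\<close> and \<open>1\<close>, where the patterns expect
  inner arcs.
\<close>

definition arranged :: "'b pair_pre_digraph \<Rightarrow> (nat \<Rightarrow> 'b) \<Rightarrow> bool" where
  "arranged G f \<longleftrightarrow> bij_betw f {..<card (pverts G)} (pverts G) \<and>
     (parcs G \<noteq> {} \<longrightarrow> (f 0, f 1) \<in> parcs G)"

context numbered_composition
begin

lemma triangle_composition_iso: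
  assumes T: "directed_triangle D a b c"
    and Hs: "\<And>j. j < 3 \<Longrightarrow> pverts (Hs j) = {..<N (corner a b c j)}"
      "\<And>j. j < 3 \<Longrightarrow> parcs (Hs j) \<subseteq> pverts (Hs j) \<times> pverts (Hs j)"
      "\<And>j. j < 3 \<Longrightarrow> parcs (H (corner a b c j)) =
         map_prod (E (corner a b c j)) (E (corner a b c j)) ` parcs (Hs j)"
  shows "digraph_iso (with_proj (composition D H)) (with_proj (composition dicycle3 Hs))"
proof -
  let ?f = "corner a b c"
  let ?R = "composition dicycle3 Hs"
  let ?\<psi> = "\<lambda>(j, p). (?f j, E (?f j) p)"
  have neq: "a \<noteq> b" "b \<noteq> c" "c \<noteq> a" and V: "V = {a, b, c}" and A: "A = {(a, b), (b, c), (c, a)}"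
    using T by (auto simp: directed_triangle_def)
  have less3: "j < 3 \<longleftrightarrow> j = 0 \<or> j = 1 \<or> j = 2" for j :: nat by auto
  have R: "pair_wf_digraph ?R"
    using Hs(2)[of 0] Hs(2)[of 1] Hs(2)[of 2]
    by unfold_locales (auto simp: composition_def dicycle3_def)
  have E: "bij_betw (E (?f j)) {..<N (?f j)} (pverts (H (?f j)))" if "j < 3" for j
    using numbering V by (simp add: corner_def)
  have inj: "inj_on ?\<psi> (pverts ?R)"
  proof (rule inj_onI)
    fix x y assume x: "x \<in> pverts ?R" and y: "y \<in> pverts ?R" and eq: "?\<psi> x = ?\<psi> y"
    obtain j p k q where xy: "x = (j, p)" "y = (k, q)" by (cases x, cases y)
    have jk: "j < 3" "k < 3" "p < N (?f j)" "q < N (?f k)"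
      using x y Hs(1) by (auto simp: xy composition_def dicycle3_def)
    have "j = k" using eq jk(1,2) neq
      by (auto simp: xy corner_def less3 split: if_splits)
    moreover from this have "p = q"
      using eq jk E[OF jk(1)] by (auto simp: xy bij_betw_def dest: inj_onD)
    ultimately show "x = y" by (simp add: xy)
  qed
  have H_img: "pverts (H (?f j)) = E (?f j) ` pverts (Hs j)" if "j < 3" for j
    using E[OF that] Hs(1)[OF that] by (simp add: bij_betw_def)
  have f_simps: "?f 0 = a" "?f 1 = b" "?f (Suc 0) = b" "?f 2 = c" by (simp_all add: corner_def)
  note H0 = H_img[of 0, unfolded f_simps] H_img[of 1, unfolded f_simps] H_img[of 2, unfolded f_simps]
  note A0 = Hs(3)[of 0, unfolded f_simps] Hs(3)[of 1, unfolded f_simps] Hs(3)[of 2, unfolded f_simps]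
  have verts: "pverts (composition D H) = ?\<psi> ` pverts ?R"
    using H0 by (auto simp: composition_def V dicycle3_def f_simps image_iff)
  have parts_arcs: "{((u, x), (u, y)) | u x y. u \<in> V \<and> (x, y) \<in> parcs (H u)} =
      map_prod ?\<psi> ?\<psi> ` {((u, x), (u, y)) | u x y. u \<in> pverts dicycle3 \<and> (x, y) \<in> parcs (Hs u)}"
    (is "?L = _ ` ?M")
  proof -
    have "?L = (\<Union>u\<in>V. map_prod (Pair u) (Pair u) ` parcs (H u))" by auto
    also have "\<dots> = (\<Union>j\<in>{0,1,2}. map_prod (Pair (?f j)) (Pair (?f j)) ` parcs (H (?f j)))"
      by (simp add: V f_simps)
    also have "\<dots> = (\<Union>j\<in>{0,1,2}. map_prod ?\<psi> ?\<psi> ` map_prod (Pair j) (Pair j) ` parcs (Hs j))"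
      using A0 by (simp add: image_image f_simps map_prod_def case_prod_beta)
    also have "\<dots> = map_prod ?\<psi> ?\<psi> ` (\<Union>j\<in>{0,1,2}. map_prod (Pair j) (Pair j) ` parcs (Hs j))"
      by (simp add: image_Un)
    also have "(\<Union>j\<in>{0,1,2}. map_prod (Pair j) (Pair j) ` parcs (Hs j)) = ?M"
      by (auto simp: dicycle3_def)
    finally show ?thesis .
  qed
  have cross_arcs: "{((u, x), (v, y)) | u v x y. (u, v) \<in> A \<and> x \<in> pverts (H u) \<and> y \<in> pverts (H v)} =
      map_prod ?\<psi> ?\<psi> ` {((u, x), (v, y)) | u v x y. (u, v) \<in> parcs dicycle3 \<and> x \<in> pverts (Hs u) \<and> y \<in> pverts (Hs v)}"
    (is "?L = _ ` ?M")
  proof -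
    have map_prod_times: "map_prod g h ` (X \<times> Y) = g ` X \<times> h ` Y"
      for g h :: "_ \<Rightarrow> 'a \<times> 'b" and X Y by force
    have "?L = (\<Union>(u, v)\<in>A. Pair u ` pverts (H u) \<times> Pair v ` pverts (H v))" by auto
    also have "\<dots> = (\<Union>(j, k)\<in>{(0,1),(1,2),(2,0)}. Pair (?f j) ` pverts (H (?f j)) \<times> Pair (?f k) ` pverts (H (?f k)))"
      by (simp add: A f_simps)
    also have "\<dots> = (\<Union>(j, k)\<in>{(0,1),(1,2),(2,0)}. map_prod ?\<psi> ?\<psi> ` (Pair j ` pverts (Hs j) \<times> Pair k ` pverts (Hs k)))"
      using H0 by (simp add: image_image f_simps map_prod_times)
    also have "\<dots> = map_prod ?\<psi> ?\<psi> ` (\<Union>(j, k)\<in>{(0,1),(1,2),(2,0)}. Pair j ` pverts (Hs j) \<times> Pair k ` pverts (Hs k))"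
      by (simp add: image_UN image_Un)
    also have "(\<Union>(j, k)\<in>{(0,1),(1,2),(2,0)}. Pair j ` pverts (Hs j) \<times> Pair k ` pverts (Hs k)) = ?M"
      by (auto simp: dicycle3_def)
    finally show ?thesis .
  qed
  have "parcs (composition D H) = map_prod ?\<psi> ?\<psi> ` parcs ?R"
    unfolding composition_def pair_pre_digraph.simps parts_arcs cross_arcs image_Un ..
  then show ?thesis using digraph_iso_of_image[OF R inj verts] by blast
qed

text \<open>
  A part of order two that contains an arc but not the opposite one is a path, so the three
  alternatives for \<open>c\<close> and the arcs of \<open>a\<close> are exactly the three exceptional digraphs.
\<close>

lemma exceptional_iso:
  assumes T: "directed_triangle D a b c"
    and arr: "\<And>u. u \<in> V \<Longrightarrow> arranged (H u) (E u)"
    and sizes: "N a = 2" "N b = 2" "N c = 2 \<or> N c = 3 \<and> parcs (H a) = {}"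
    and arcs: "parcs (H b) = {}" "parcs (H c) = {}" "(E a 1, E a 0) \<notin> parcs (H a)"
  shows "in_Q0 (composition D H)"
proof -
  have V: "a \<in> V" "b \<in> V" "c \<in> V" using T by (auto simp: directed_triangle_def)
  interpret a: pair_digraph "H a" using parts V by blast
  have a_arcs: "parcs (H a) = {(E a 0, E a 1)}" if "parcs (H a) \<noteq> {}"
  proof -
    have "pverts (H a) = E a ` {..<2}" using numbering[OF V(1)] sizes(1) by (simp add: bij_betw_def)
    then have "pverts (H a) = {E a 0, E a 1}" by (auto simp: less_2_cases_iff)
    then have "(x, y) = (E a 0, E a 1)" if "(x, y) \<in> parcs (H a)" for x y
      using that a.in_arcsD1[OF that] a.in_arcsD2[OF that] a.pair_no_loops[OF that] arcs(3) by auto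
    then show ?thesis using arr[OF V(1)] that by (auto simp: arranged_def)
  qed
  have less3: "j < 3 \<longleftrightarrow> j = 0 \<or> j = 1 \<or> j = 2" for j :: nat by auto
  consider "N c = 2" "parcs (H a) = {}" | "N c = 2" "parcs (H a) \<noteq> {}" | "N c = 3" "parcs (H a) = {}"
    using sizes(3) by blast
  then show ?thesis
  proof cases
    case 1
    then have "digraph_iso (with_proj (composition D H))
        (with_proj (composition dicycle3 (\<lambda>i. [arcless 2, arcless 2, arcless 2] ! i)))"
      using sizes arcs by (intro triangle_composition_iso[OF T]) (auto simp: less3 corner_def arcless_def)
    then show ?thesis by (auto simp: in_Q0_def Q0_def)
  next
    case 2
    then have "digraph_iso (with_proj (composition D H))
        (with_proj (composition dicycle3 (\<lambda>i. [dipath2, arcless 2, arcless 2] ! i)))"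
      using sizes arcs a_arcs
      by (intro triangle_composition_iso[OF T]) (auto simp: less3 corner_def arcless_def dipath2_def)
    then show ?thesis by (auto simp: in_Q0_def Q0_def)
  next
    case 3
    then have "digraph_iso (with_proj (composition D H))
        (with_proj (composition dicycle3 (\<lambda>i. [arcless 2, arcless 2, arcless 3] ! i)))"
      using sizes arcs by (intro triangle_composition_iso[OF T]) (auto simp: less3 corner_def arcless_def)
    then show ?thesis by (auto simp: in_Q0_def Q0_def)
  qed
qed

text \<open>
  If no pattern fits, the parts have orders two and three, at most one has order three, at most one
  contains arcs, the two do not occur together, and no part has opposite arcs. After rotation
  this is the situation of \<open>exceptional_iso\<close>.
\<close>

lemma fitting_pattern_exists:
  assumes T: "directed_triangle D a b c" and n: "n = 2"
    and arr: "\<And>u. u \<in> V \<Longrightarrow> arranged (H u) (E u)"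
    and not_Q0: "\<not> in_Q0 (composition D H)"
  shows "\<exists>pat\<in>set patterns. pattern_fits (corner a b c) pat"
proof (rule ccontr)
  assume none: "\<not> ?thesis"
  have V: "a \<in> V" "b \<in> V" "c \<in> V" using T by (auto simp: directed_triangle_def)
  have T': "directed_triangle D b c a" "directed_triangle D c a b"
    by (rule directed_triangle_rotate[OF T], rule directed_triangle_rotate[OF directed_triangle_rotate[OF T]])
  define g where "g u \<longleftrightarrow> (E u 0, E u 1) \<in> parcs (H u)" for u
  define g' where "g' u \<longleftrightarrow> (E u 1, E u 0) \<in> parcs (H u)" for u
  have g: "parcs (H u) = {} \<longleftrightarrow> \<not> g u" if "u \<in> V" for u
    using arr[OF that] by (auto simp: arranged_def g_def)
  have N2: "2 \<le> N a" "2 \<le> N b" "2 \<le> N c" using n_le V n by auto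
  let ?demand = "\<lambda>(ks, arcs). (\<forall>j<3. ks ! j \<le> N (corner a b c j)) \<and>
    (\<forall>(j, p, q) \<in> set arcs. (E (corner a b c j) p, E (corner a b c j) q) \<in> parcs (H (corner a b c j)))"
  have "list_all (\<lambda>d. \<not> ?demand d) (map (\<lambda>pat. (fst pat, inner_arcs pat)) patterns)"
    using none by (simp add: list_all_iff pattern_fits_def)
  note none' = this[unfolded pattern_demands]
  have all3: "(\<forall>j<3. P j) \<longleftrightarrow> P 0 \<and> P 1 \<and> P 2" for P :: "nat \<Rightarrow> bool"
  proof -
    have "j < 3 \<longleftrightarrow> j = 0 \<or> j = 1 \<or> j = 2" for j :: nat by auto
    then show ?thesis by auto
  qed
  have facts: "\<not> (g a \<and> g' a)" "\<not> (g b \<and> g' b)" "\<not> (g c \<and> g' c)"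
    "\<not> (g a \<and> g b)" "\<not> (g b \<and> g c)" "\<not> (g c \<and> g a)"
    "\<not> (3 \<le> N c \<and> g a)" "\<not> (3 \<le> N c \<and> g b)" "\<not> (3 \<le> N c \<and> g c)"
    "\<not> (3 \<le> N a \<and> g b)" "\<not> (3 \<le> N a \<and> g c)" "\<not> (3 \<le> N a \<and> g a)"
    "\<not> (3 \<le> N b \<and> g c)" "\<not> (3 \<le> N b \<and> g a)" "\<not> (3 \<le> N b \<and> g b)"
    "\<not> 4 \<le> N a" "\<not> 4 \<le> N b" "\<not> 4 \<le> N c"
    "\<not> (3 \<le> N a \<and> 3 \<le> N b)" "\<not> (3 \<le> N b \<and> 3 \<le> N c)" "\<not> (3 \<le> N a \<and> 3 \<le> N c)"
    using none' N2 unfolding all3 by (simp_all add: corner_def g_def g'_def)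
  have ng': "(E u 1, E u 0) \<notin> parcs (H u)" if "u \<in> V" "\<not> (g u \<and> g' u)" for u
    using g[OF that(1)] that(2) by (auto simp: g'_def)
  have N3: "N a = 2 \<or> N a = 3" "N b = 2 \<or> N b = 3" "N c = 2 \<or> N c = 3"
    using facts(16-18) N2 by linarith+
  have "in_Q0 (composition D H)"
  proof (cases "3 \<le> N a \<or> g b")
    case True
    have "\<not> 3 \<le> N b" "\<not> 3 \<le> N c" "\<not> g c" "\<not> g a" "\<not> (3 \<le> N a \<and> g b)"
      using facts True by satx+
    then have "N b = 2" "N c = 2" "N a = 2 \<or> N a = 3 \<and> \<not> g b" "\<not> g c" "\<not> g a"
      using N3 by auto
    then show ?thesis
      using g[OF V(1)] g[OF V(2)] g[OF V(3)] ng'[OF V(2)] facts(2)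
      by (intro exceptional_iso[OF T'(1) arr]) simp_all
  next
    case ab: False
    show ?thesis
    proof (cases "3 \<le> N b \<or> g c")
      case True
      have "\<not> 3 \<le> N c" "\<not> 3 \<le> N a" "\<not> g a" "\<not> g b" "\<not> (3 \<le> N b \<and> g c)"
        using facts True by satx+
      then have "N c = 2" "N a = 2" "N b = 2 \<or> N b = 3 \<and> \<not> g c" "\<not> g a" "\<not> g b"
        using N3 by auto
      then show ?thesis
        using g[OF V(1)] g[OF V(2)] g[OF V(3)] ng'[OF V(3)] facts(3)
        by (intro exceptional_iso[OF T'(2) arr]) simp_all
    next
      case bc: False
      have "\<not> 3 \<le> N a" "\<not> 3 \<le> N b" "\<not> g b" "\<not> g c" "\<not> (3 \<le> N c \<and> g a)"
        using facts ab bc by satx+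
      then have "N a = 2" "N b = 2" "N c = 2 \<or> N c = 3 \<and> \<not> g a" "\<not> g b" "\<not> g c"
        using N3 by auto
      then show ?thesis
        using g[OF V(1)] g[OF V(2)] g[OF V(3)] ng'[OF V(1)] facts(1)
        by (intro exceptional_iso[OF T arr]) simp_all
    qed
  qed
  then show False using not_Q0 by contradiction
qed

end


section \<open>Existence of the packing\<close>

text \<open>
  A permutation with \<open>0 \<mapsto> x\<close> and \<open>1 \<mapsto> y\<close>, as two transpositions so that a program can apply
  it to an array in place.
\<close>

definition bring_to_front :: "nat \<Rightarrow> nat \<Rightarrow> nat \<Rightarrow> nat" where
  "bring_to_front x y = transpose 0 x \<circ> transpose 1 (transpose 0 x y)"

lemma bring_to_front:
  assumes "x < m" "y < m" "x \<noteq> y"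
  shows "bij_betw (bring_to_front x y) {..<m} {..<m}"
    and "bring_to_front x y 0 = x" and "bring_to_front x y 1 = y"
proof -
  have tr: "bij_betw (transpose a b) {..<m} {..<m}" if "a < m" "b < m" for a b
    using that by (simp add: bij_betw_def)
  have "transpose 0 x y < m" using assms by (simp add: transpose_def)
  then show "bij_betw (bring_to_front x y) {..<m} {..<m}"
    unfolding bring_to_front_def using assms by (intro bij_betw_trans[OF tr tr]) auto
  show "bring_to_front x y 0 = x" "bring_to_front x y 1 = y"
    using assms(3) by (auto simp: bring_to_front_def transpose_def)
qed

lemma arranged_bring_to_front:
  assumes "bij_betw f {..<card (pverts G)} (pverts G)"
    and "x < card (pverts G)" "y < card (pverts G)" "x \<noteq> y" "(f x, f y) \<in> parcs G"
  shows "arranged G (f \<circ> bring_to_front x y)"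
  using bij_betw_trans[OF bring_to_front(1)[OF assms(2-4)] assms(1)] assms(5)
    bring_to_front(2,3)[OF assms(2-4)] by (simp add: arranged_def)

lemma arranged_exists:
  assumes "pair_digraph G"
  shows "\<exists>f. arranged G f"
proof -
  interpret pair_digraph G by fact
  obtain f where f: "bij_betw f {..<card (pverts G)} (pverts G)"
    using ex_bij_betw_nat_finite[OF pair_finite_verts] by (auto simp: lessThan_atLeast0)
  show ?thesis
  proof (cases "parcs G = {}")
    case False
    then obtain a b where ab: "(a, b) \<in> parcs G" by auto
    then have "a \<in> f ` {..<card (pverts G)}" "b \<in> f ` {..<card (pverts G)}" "a \<noteq> b"
      using f in_arcsD1 in_arcsD2 pair_no_loops[OF ab] by (auto simp: bij_betw_def)
    then obtain x y where "a = f x" "b = f y" "x < card (pverts G)" "y < card (pverts G)" "x \<noteq> y"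
      by auto
    then show ?thesis using arranged_bring_to_front[OF f] ab by blast
  qed (use f in \<open>auto simp: arranged_def\<close>)
qed

lemma numbered_compositionI:
  assumes hyp: "packing_hypotheses D H S" and pos: "min_part D H \<noteq> 0"
    and num: "\<And>u. u \<in> pverts D \<Longrightarrow> arranged (H u) (E u)"
  shows "numbered_composition D H E (min_part D H)"
proof -
  have D: "pair_digraph D" and H: "\<And>u. u \<in> pverts D \<Longrightarrow> pair_digraph (H u)"
    and strong: "strongly_connected (with_proj D)" and two: "2 \<le> card (pverts D)"
    using hyp by (auto simp: packing_hypotheses_def)
  interpret D: pair_digraph D by fact
  have "strong_digraph D" using D strong two by (simp add: strong_digraph_def strong_digraph_axioms_def)
  moreover have "min_part D H \<le> card (pverts (H u))" if "u \<in> pverts D" for u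
    using that D.pair_finite_verts by (auto simp: min_part_def intro: Min_le)
  ultimately show ?thesis
    using H num pos by (simp add: numbered_composition_def numbered_composition_axioms_def arranged_def)
qed

lemma core_cases:
  assumes hyp: "packing_hypotheses D H S"
  obtains a b c d where "closed_4_walk (parcs D) a b c d"
  | a b c where "\<nexists>a b c d. closed_4_walk (parcs D) a b c d" "directed_triangle D a b c"
      "\<not> in_Q0 (composition D H)"
proof (cases "\<exists>a b c d. closed_4_walk (parcs D) a b c d")
  case False
  have "pair_digraph D" "strongly_connected (with_proj D)" "2 \<le> card (pverts D)"
    using hyp by (auto simp: packing_hypotheses_def)
  then interpret strong_digraph D by (simp add: strong_digraph_def strong_digraph_axioms_def)
  have "\<not> symmetric (with_proj D)" using symmetric_closed_4_walk False by blast
  then have "semicomplete D" "\<not> in_Q0 (composition D H)"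
    using hyp by (auto simp: packing_hypotheses_def)
  then show thesis using semicomplete_no_closed_4_walk False that(2) by blast
qed (use that(1) in blast)

theorem packing_exists:
  fixes D :: "'a pair_pre_digraph" and H :: "'a \<Rightarrow> 'b pair_pre_digraph"
  assumes hyp: "packing_hypotheses D H S"
  shows "\<exists>\<F>. arc_disjoint_strong_subgraphs (composition D H) S \<F> \<and> min_part D H \<le> card \<F>"
proof (cases "min_part D H = 0")
  case True
  then have "arc_disjoint_strong_subgraphs (composition D H) S {}"
    by (simp add: arc_disjoint_strong_subgraphs_def)
  then show ?thesis using True by (metis le0)
next
  case False
  let ?n = "min_part D H"
  have "\<forall>u\<in>pverts D. \<exists>f. arranged (H u) f"
    using hyp arranged_exists by (auto simp: packing_hypotheses_def)
  then obtain E where E: "\<And>u. u \<in> pverts D \<Longrightarrow> arranged (H u) (E u)" by metis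
  interpret numbered_composition D H E ?n using hyp False E by (rule numbered_compositionI)
  have "\<exists>k R. core_packing k R"
  proof (rule core_cases[OF hyp])
    fix a b c d assume "closed_4_walk A a b c d"
    then show ?thesis using walk_core_packing by blast
  next
    fix a b c assume T: "directed_triangle D a b c" and Q0: "\<not> in_Q0 (composition D H)"
    show ?thesis
    proof (cases "?n = 2")
      case True
      then show ?thesis using fitting_pattern_exists[OF T True E Q0] pattern_core_packing[OF T True] by blast
    next
      case False
      then show ?thesis using triangle_core_packing[OF T] by blast
    qed
  qed
  then obtain k R where R: "core_packing k R" by blast
  have S: "S \<subseteq> pverts (composition D H)" using hyp by (simp add: packing_hypotheses_def)
  show ?thesis using core_packing_extends[OF R S] by (metis order_refl)
qed

section \<open>Total correctness with time bounds\<close>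

fun writes :: "com \<Rightarrow> string set" where
  "writes Skip = {}"
| "writes (Put a es e) = {a}"
| "writes (Seq c1 c2) = writes c1 \<union> writes c2"
| "writes (Cond e c1 c2) = writes c1 \<union> writes c2"
| "writes (While e c) = writes c"

lemma runs_frame: "runs w c s T s' \<Longrightarrow> a \<notin> writes c \<Longrightarrow> s' a = s a"
  by (induction rule: runs.induct) auto

text \<open>
  Total correctness: \<open>c\<close> halts within \<open>B\<close> steps, and \<open>Q\<close> holds for the final state. Execution being
  deterministic, this determines the run. Arrays that \<open>c\<close> does not write to are unchanged
  (\<open>runs_frame\<close>), and the rules below hand this fact on so that \<open>Q\<close> need not mention them.
\<close>

definition halts :: "nat \<Rightarrow> com \<Rightarrow> state \<Rightarrow> nat \<Rightarrow> (state \<Rightarrow> bool) \<Rightarrow> bool" where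
  "halts w c s B Q \<longleftrightarrow> (\<exists>T s'. runs w c s T s' \<and> T \<le> B \<and> Q s')"

lemma halts_mono:
  assumes "halts w c s B Q" "B \<le> B'"
    and "\<And>s'. Q s' \<Longrightarrow> (\<And>a. a \<notin> writes c \<Longrightarrow> s' a = s a) \<Longrightarrow> Q' s'"
  shows "halts w c s B' Q'"
  using assms runs_frame unfolding halts_def by (meson le_trans)

lemma halts_Skip: "Q s \<Longrightarrow> 1 \<le> B \<Longrightarrow> halts w Skip s B Q"
  unfolding halts_def using runs.Skip by blast

lemma halts_Put:
  assumes "\<And>e'. e' \<in> set (e # es) \<Longrightarrow> fits w s e'"
    and "1 + sum_list (map cost (e # es)) \<le> B"
    and "Q (s(a := (s a)(map (eval s) es := eval s e)))"
  shows "halts w (Put a es e) s B Q"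
  unfolding halts_def using runs.Put[of e es w s a] assms by blast

lemma halts_Seq:
  assumes "halts w c1 s B1 R"
    and "\<And>s1. R s1 \<Longrightarrow> (\<And>a. a \<notin> writes c1 \<Longrightarrow> s1 a = s a) \<Longrightarrow> halts w c2 s1 B2 Q"
    and "1 + B1 + B2 \<le> B"
  shows "halts w (Seq c1 c2) s B Q"
proof -
  obtain T1 s1 where 1: "runs w c1 s T1 s1" "T1 \<le> B1" "R s1" using assms(1) by (auto simp: halts_def)
  then obtain T2 s2 where 2: "runs w c2 s1 T2 s2" "T2 \<le> B2" "Q s2"
    using assms(2)[of s1] runs_frame by (auto simp: halts_def)
  have "1 + T1 + T2 \<le> B" using 1 2 assms(3) by linarith
  then show ?thesis using runs.Seq[OF 1(1) 2(1)] 2(3) unfolding halts_def by blast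
qed

lemma halts_Cond:
  assumes "fits w s e"
    and "eval s e \<noteq> 0 \<Longrightarrow> halts w c1 s B1 Q" and "eval s e = 0 \<Longrightarrow> halts w c2 s B1 Q"
    and "1 + cost e + B1 \<le> B"
  shows "halts w (Cond e c1 c2) s B Q"
proof (cases "eval s e = 0")
  case True
  then obtain T s' where "runs w c2 s T s'" "T \<le> B1" "Q s'" using assms(3) by (auto simp: halts_def)
  then show ?thesis
    using runs.CondFalse[OF assms(1) True, of c2 T s' c1] assms(4) unfolding halts_def
    by (intro exI[of _ "1 + cost e + T"] exI[of _ s']) auto
next
  case False
  then obtain T s' where "runs w c1 s T s'" "T \<le> B1" "Q s'" using assms(2) by (auto simp: halts_def)
  then show ?thesis
    using runs.CondTrue[OF assms(1) False, of c1 T s' c2] assms(4) unfolding halts_def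
    by (intro exI[of _ "1 + cost e + T"] exI[of _ s']) auto
qed

text \<open>
  The first argument of the invariant is an upper bound for the number of iterations left.
\<close>

lemma halts_While:
  assumes step: "\<And>m s'. I m s' \<Longrightarrow> (\<And>a. a \<notin> writes c \<Longrightarrow> s' a = s a) \<Longrightarrow>
      fits w s' e \<and> (eval s' e = 0 \<longrightarrow> Q s') \<and>
      (eval s' e \<noteq> 0 \<longrightarrow> 0 < m \<and> halts w c s' B (I (m - 1)))"
    and init: "I m s"
    and bound: "m * (B + cost e + 1) + cost e + 1 \<le> B'"
  shows "halts w (While e c) s B' Q"
proof -
  have "halts w (While e c) s' (m * (B + cost e + 1) + cost e + 1) Q"
    if "I m s'" "\<And>a. a \<notin> writes c \<Longrightarrow> s' a = s a" for s'
    using that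
  proof (induction m arbitrary: s')
    case 0
    then have "fits w s' e" "eval s' e = 0" "Q s'" using step[of 0 s'] by auto
    then show ?case using runs.WhileFalse[of w s' e c] unfolding halts_def by auto
  next
    case (Suc m)
    note st = step[OF Suc.prems]
    show ?case
    proof (cases "eval s' e = 0")
      case True
      then show ?thesis
        using st runs.WhileFalse[of w s' e c] unfolding halts_def
        by (intro exI[of _ "1 + cost e"] exI[of _ s']) auto
    next
      case False
      then obtain T1 s1 where 1: "runs w c s' T1 s1" "T1 \<le> B" "I m s1"
        using st by (auto simp: halts_def)
      then have "\<And>a. a \<notin> writes c \<Longrightarrow> s1 a = s a"
        using runs_frame[OF 1(1)] Suc.prems(2) by simp
      from Suc.IH[OF 1(3) this] obtain T2 s2 where
        2: "runs w (While e c) s1 T2 s2" "T2 \<le> m * (B + cost e + 1) + cost e + 1" "Q s2"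
        by (auto simp: halts_def)
      have "runs w (While e c) s' (1 + cost e + T1 + T2) s2"
        using runs.WhileTrue[OF _ False 1(1) 2(1)] st by blast
      then show ?thesis using 1(2) 2(2,3) unfolding halts_def
        by (intro exI[of _ "1 + cost e + T1 + T2"] exI[of _ s2]) auto
    qed
  qed
  from this[OF init] show ?thesis using bound unfolding halts_def by (meson le_trans)
qed

abbreviation seq :: "com \<Rightarrow> com \<Rightarrow> com" (infixr \<open>;;\<close> 60) where
  "c1 ;; c2 \<equiv> Seq c1 c2"

abbreviation var :: "string \<Rightarrow> exp" where
  "var x \<equiv> Get x []"

abbreviation assign :: "string \<Rightarrow> exp \<Rightarrow> com" (infix \<open>::=\<close> 65) where
  "x ::= e \<equiv> Put x [] e"

definition For :: "string \<Rightarrow> exp \<Rightarrow> exp \<Rightarrow> com \<Rightarrow> com" where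
  "For x lo hi c = x ::= lo ;; While (Bin Less (var x) hi) (c ;; x ::= Bin Add (var x) (Num 1))"

lemma writes_For [simp]: "writes (For x lo hi c) = insert x (writes c)"
  by (auto simp: For_def)

definition set_var :: "string \<Rightarrow> nat \<Rightarrow> state \<Rightarrow> state" where
  "set_var x v s = s(x := (s x)([] := v))"

lemma set_var_simps [simp]:
  "set_var x v s x [] = v" "a \<noteq> x \<Longrightarrow> set_var x v s a = s a"
  by (auto simp: set_var_def)

lemma halts_assign:
  assumes "fits w s e" "1 + cost e \<le> B" "Q (set_var x (eval s e) s)"
  shows "halts w (x ::= e) s B Q"
  using assms by (intro halts_Put) (auto simp: set_var_def)

text \<open>
  The bound has the form \<open>k M\<^sup>d\<close> so that nested loops over at most \<open>M\<close> values just raise the exponent; the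
  \<open>20\<close> pays for the initialisation, the tests and the increments.
\<close>

lemma halts_For:
  assumes lo: "fits w s lo" "eval s lo = a" "cost lo \<le> 2"
    and hi: "\<And>s'. (\<And>y. y \<notin> insert x (writes c) \<Longrightarrow> s' y = s y) \<Longrightarrow> fits w s' hi \<and> eval s' hi = b"
      "cost hi \<le> 2"
    and x: "x \<notin> writes c" and ab: "a \<le> b" "b \<le> w" "1 \<le> w" "b - a \<le> M" "1 \<le> M"
    and init: "I a (set_var x a s)"
    and body: "\<And>i s'. a \<le> i \<Longrightarrow> i < b \<Longrightarrow> s' x [] = i \<Longrightarrow> I i s' \<Longrightarrow>
        (\<And>y. y \<notin> insert x (writes c) \<Longrightarrow> s' y = s y) \<Longrightarrow>
        halts w c s' (k * M ^ d) (\<lambda>s''. I (Suc i) (set_var x (Suc i) s''))"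
    and final: "\<And>s'. I b s' \<Longrightarrow> (\<And>y. y \<notin> insert x (writes c) \<Longrightarrow> s' y = s y) \<Longrightarrow> Q s'"
    and B: "(k + 20) * M ^ Suc d \<le> B"
  shows "halts w (For x lo hi c) s B Q"
proof -
  let ?c = "c ;; x ::= Bin Add (var x) (Num 1)"
  let ?e = "Bin Less (var x) hi"
  let ?I = "\<lambda>m s'. \<exists>i. a \<le> i \<and> i \<le> b \<and> m = b - i \<and> s' x [] = i \<and> I i s'"
  have "halts w (While ?e ?c) (set_var x a s) ((b - a) * ((k * M ^ d + 5) + cost ?e + 1) + cost ?e + 1) Q"
  proof (rule halts_While[where I = ?I and m = "b - a" and B = "k * M ^ d + 5"])
    fix m s' assume I: "?I m s'" and fr: "\<And>y. y \<notin> writes ?c \<Longrightarrow> s' y = set_var x a s y"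
    then obtain i where i: "a \<le> i" "i \<le> b" "m = b - i" "s' x [] = i" "I i s'" by blast
    have fr': "y \<notin> insert x (writes c) \<Longrightarrow> s' y = s y" for y using fr[of y] by simp
    note h = hi(1)[OF fr']
    have "halts w ?c s' (k * M ^ d + 5) (?I (m - 1))" if "i < b"
    proof (rule halts_Seq[OF body[OF i(1) that i(4,5) fr']])
      fix s1 assume I1: "I (Suc i) (set_var x (Suc i) s1)" and fr1: "\<And>a. a \<notin> writes c \<Longrightarrow> s1 a = s' a"
      have "s1 x [] = i" using fr1[OF x] i by simp
      then show "halts w (x ::= Bin Add (var x) (Num 1)) s1 4 (?I (m - 1))"
        using i that I1 ab by (intro halts_assign) auto
    qed auto
    then show "fits w s' ?e \<and> (eval s' ?e = 0 \<longrightarrow> Q s') \<and>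
      (eval s' ?e \<noteq> 0 \<longrightarrow> 0 < m \<and> halts w ?c s' (k * M ^ d + 5) (?I (m - 1)))"
      using i h ab final[OF _ fr'] by auto
  qed (use init ab in auto)
  moreover have "(b - a) * ((k * M ^ d + 5) + cost ?e + 1) + cost ?e + 1 + 4 \<le> B"
  proof -
    have "(b - a) * ((k * M ^ d + 5) + cost ?e + 1) \<le> M * (k * M ^ d + 10)"
      using ab hi(2) by (intro mult_le_mono) auto
    also have "\<dots> = k * M ^ Suc d + 10 * M" by (simp add: algebra_simps)
    finally have 1: "(b - a) * ((k * M ^ d + 5) + cost ?e + 1) \<le> k * M ^ Suc d + 10 * M" .
    have "M * 1 \<le> M * M ^ d" using ab by (intro mult_le_mono) auto
    then have 2: "M \<le> M ^ Suc d" by simp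
    then have 3: "1 \<le> M ^ Suc d" using ab by linarith
    have 4: "(k + 20) * M ^ Suc d = k * M ^ Suc d + 20 * M ^ Suc d" by (simp only: distrib_right)
    have "cost ?e = 2 + cost hi" by simp
    then show ?thesis using 1 2 3 4 hi(2) B by linarith
  qed
  ultimately show ?thesis
    unfolding For_def using lo
    by (intro halts_Seq[where R = "\<lambda>s1. s1 = set_var x a s" and ?B1.0 = 3
          and ?B2.0 = "(b - a) * ((k * M ^ d + 5) + cost ?e + 1) + cost ?e + 1"] halts_assign) auto
qed

text \<open>
  Sets of vertices and arcs are stored as characteristic functions.
\<close>

definition cells :: "string \<Rightarrow> state \<Rightarrow> nat list set" where
  "cells a s = {is. s a is \<noteq> 0}"

lemma cells_set_var [simp]: "a \<noteq> x \<Longrightarrow> cells a (set_var x v s) = cells a s"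
  by (simp add: cells_def)

text \<open>
  For loops that only add entries to an array: what the iterations add is collected.
\<close>

lemma halts_For_collect:
  assumes lo: "fits w s lo" "eval s lo = i0" "cost lo \<le> 2"
    and hi: "\<And>s'. (\<And>y. y \<notin> insert x (writes c) \<Longrightarrow> s' y = s y) \<Longrightarrow> fits w s' hi \<and> eval s' hi = b"
      "cost hi \<le> 2"
    and x: "x \<notin> writes c" "a \<noteq> x" and ab: "i0 \<le> b" "b \<le> w" "1 \<le> w" "b - i0 \<le> M" "1 \<le> M"
    and body: "\<And>i s'. i0 \<le> i \<Longrightarrow> i < b \<Longrightarrow> s' x [] = i \<Longrightarrow>
        (\<And>y. y \<notin> insert x (writes c) \<Longrightarrow> s' y = s y) \<Longrightarrow>
        halts w c s' (k * M ^ d) (\<lambda>s''. cells a s'' = cells a s' \<union> G i)"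
    and B: "(k + 20) * M ^ Suc d \<le> B"
  shows "halts w (For x lo hi c) s B
    (\<lambda>s'. cells a s' = cells a s \<union> (\<Union>i\<in>{i0..<b}. G i))"
proof (rule halts_For[OF lo hi x(1) ab, where I = "\<lambda>i s'. cells a s' = cells a s \<union> (\<Union>j\<in>{i0..<i}. G j)"])
  fix i s' assume i: "i0 \<le> i" "i < b" "s' x [] = i" "cells a s' = cells a s \<union> (\<Union>j\<in>{i0..<i}. G j)"
    and fr: "\<And>y. y \<notin> insert x (writes c) \<Longrightarrow> s' y = s y"
  show "halts w c s' (k * M ^ d)
      (\<lambda>s''. cells a (set_var x (Suc i) s'') = cells a s \<union> (\<Union>j\<in>{i0..<Suc i}. G j))"
    using i x by (intro halts_mono[OF body[OF i(1-3) fr]]) (auto simp: atLeastLessThanSuc)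
qed (use x B in auto)

text \<open>
  For loops that look for a value with property \<open>P\<close>: as long as the flag \<open>f\<close> is zero nothing has been
  found, and \<open>J\<close> says that a nonzero flag comes with a witness.
\<close>

lemma halts_For_search:
  assumes lo: "fits w s lo" "eval s lo = i0" "cost lo \<le> 2"
    and hi: "\<And>s'. (\<And>y. y \<notin> insert x (writes c) \<Longrightarrow> s' y = s y) \<Longrightarrow> fits w s' hi \<and> eval s' hi = b"
      "cost hi \<le> 2"
    and x: "x \<notin> writes c" "f \<noteq> x" and ab: "i0 \<le> b" "b \<le> w" "1 \<le> w" "b - i0 \<le> M" "1 \<le> M"
    and J: "J s" "\<And>s' v. J (set_var x v s') = J s'"
    and body: "\<And>i s'. i0 \<le> i \<Longrightarrow> i < b \<Longrightarrow> s' x [] = i \<Longrightarrow> J s' \<Longrightarrow>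
        (\<And>y. y \<notin> insert x (writes c) \<Longrightarrow> s' y = s y) \<Longrightarrow>
        halts w c s' (k * M ^ d) (\<lambda>s''. J s'' \<and> (s'' f [] = 0 \<longrightarrow> s' f [] = 0 \<and> \<not> P i))"
    and B: "(k + 20) * M ^ Suc d \<le> B"
  shows "halts w (For x lo hi c) s B
    (\<lambda>s'. J s' \<and> (s' f [] = 0 \<longrightarrow> s f [] = 0 \<and> (\<forall>i\<in>{i0..<b}. \<not> P i)))"
proof (rule halts_For[OF lo hi x(1) ab, where
      I = "\<lambda>i s'. J s' \<and> (s' f [] = 0 \<longrightarrow> s f [] = 0 \<and> (\<forall>j\<in>{i0..<i}. \<not> P j))"])
  fix i s' assume i: "i0 \<le> i" "i < b" "s' x [] = i"
    and I: "J s' \<and> (s' f [] = 0 \<longrightarrow> s f [] = 0 \<and> (\<forall>j\<in>{i0..<i}. \<not> P j))"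
    and fr: "\<And>y. y \<notin> insert x (writes c) \<Longrightarrow> s' y = s y"
  show "halts w c s' (k * M ^ d) (\<lambda>s''. J (set_var x (Suc i) s'') \<and> (set_var x (Suc i) s'' f [] = 0 \<longrightarrow>
      s f [] = 0 \<and> (\<forall>j\<in>{i0..<Suc i}. \<not> P j)))"
    using I x J(2) by (intro halts_mono[OF body[OF i _ fr]]) (auto simp: atLeastLessThanSuc)
qed (use x J B in auto)

text \<open>
  Programs without loops are executed symbolically: \<open>exec\<close> gives the final state, \<open>safe\<close> says that no
  value exceeds the word bound, and \<open>worst_cost\<close> bounds the time.
\<close>

fun exec :: "com \<Rightarrow> state \<Rightarrow> state" where
  "exec Skip s = s"
| "exec (Put a es e) s = s(a := (s a)(map (eval s) es := eval s e))"
| "exec (Seq c1 c2) s = exec c2 (exec c1 s)"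
| "exec (Cond e c1 c2) s = (if eval s e \<noteq> 0 then exec c1 s else exec c2 s)"
| "exec (While e c) s = s"

fun safe :: "nat \<Rightarrow> com \<Rightarrow> state \<Rightarrow> bool" where
  "safe w Skip s \<longleftrightarrow> True"
| "safe w (Put a es e) s \<longleftrightarrow> (\<forall>e'\<in>set (e # es). fits w s e')"
| "safe w (Seq c1 c2) s \<longleftrightarrow> safe w c1 s \<and> safe w c2 (exec c1 s)"
| "safe w (Cond e c1 c2) s \<longleftrightarrow> fits w s e \<and> (if eval s e \<noteq> 0 then safe w c1 s else safe w c2 s)"
| "safe w (While e c) s \<longleftrightarrow> False"

fun worst_cost :: "com \<Rightarrow> nat" where
  "worst_cost Skip = 1"
| "worst_cost (Put a es e) = 1 + sum_list (map cost (e # es))"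
| "worst_cost (Seq c1 c2) = 1 + worst_cost c1 + worst_cost c2"
| "worst_cost (Cond e c1 c2) = 1 + cost e + max (worst_cost c1) (worst_cost c2)"
| "worst_cost (While e c) = 0"

lemma halts_loop_free:
  "safe w c s \<Longrightarrow> worst_cost c \<le> B \<Longrightarrow> Q (exec c s) \<Longrightarrow> halts w c s B Q"
proof (induction c arbitrary: s B Q)
  case (Put a es e)
  then show ?case by (intro halts_Put) auto
next
  case (Seq c1 c2)
  then show ?case by (intro halts_Seq[where R = "\<lambda>s1. s1 = exec c1 s" and ?B1.0 = "worst_cost c1" and ?B2.0 = "worst_cost c2"]) auto
next
  case (Cond e c1 c2)
  then show ?case by (intro halts_Cond[where ?B1.0 = "max (worst_cost c1) (worst_cost c2)"]) auto
qed (auto intro: halts_Skip)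

section \<open>The program\<close>

abbreviation order_of :: "exp \<Rightarrow> exp" where
  "order_of e \<equiv> Get ''order'' [e]"

text \<open>
  The loop ends at the first empty part. Otherwise its time could exceed every bound in the order of
  the composition, because many other parts may be empty too.
\<close>

definition minimum :: com where
  "minimum =
     ''n'' ::= order_of (Num 0) ;; ''u'' ::= Num 1 ;;
     While (Bin Mul (Bin Less (var ''u'') (var ''t'')) (var ''n''))
       (Cond (Bin Less (order_of (var ''u'')) (var ''n'')) (''n'' ::= order_of (var ''u'')) Skip ;;
        ''u'' ::= Bin Add (var ''u'') (Num 1))"

definition all_vertices :: com where
  "all_vertices =
     For ''l'' (Num 0) (var ''n'') (For ''u'' (Num 0) (var ''t'')
       (For ''p'' (Num 0) (order_of (var ''u''))
         (Put ''V'' [var ''l'', var ''u'', var ''p''] (Num 1))))"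

definition arrange_part :: com where
  "arrange_part =
     Put ''E'' [var ''u'', Num 0] (var ''x'') ;;
     Put ''E'' [var ''u'', var ''x''] (Num 0) ;;
     ''q'' ::= Get ''E'' [var ''u'', var ''y''] ;;
     ''p'' ::= Get ''E'' [var ''u'', Num 1] ;;
     Put ''E'' [var ''u'', Num 1] (var ''y'') ;;
     Put ''E'' [var ''u'', var ''q''] (var ''p'')"

text \<open>
  \<open>E [u, p]\<close> becomes the vertex of part \<open>u\<close> with number \<open>p\<close>, and \<open>K [u]\<close> the number of core vertices in
  part \<open>u\<close>.
\<close>

definition number_part :: com where
  "number_part =
     ''g'' ::= Num 0 ;;
     Put ''K'' [var ''u''] (var ''n'') ;;
     For ''p'' (Num 0) (order_of (var ''u'')) (Put ''E'' [var ''u'', var ''p''] (var ''p'')) ;;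
     For ''p'' (Num 0) (order_of (var ''u'')) (For ''q'' (Num 0) (order_of (var ''u''))
       (Cond (Get ''H'' [var ''u'', var ''p'', var ''q''])
         (''x'' ::= var ''p'' ;; ''y'' ::= var ''q'' ;; ''g'' ::= Num 1) Skip)) ;;
     Cond (var ''g'') arrange_part Skip"

definition number_parts :: com where
  "number_parts = For ''u'' (Num 0) (var ''t'') number_part"

definition find_walk :: com where
  "find_walk =
     ''f'' ::= Num 0 ;;
     For ''a'' (Num 0) (var ''t'') (For ''b'' (Num 0) (var ''t'') (For ''c'' (Num 0) (var ''t'')
       (For ''d'' (Num 0) (var ''t'')
         (Cond (Bin Mul (Bin Mul (Get ''D'' [var ''a'', var ''b'']) (Get ''D'' [var ''b'', var ''c'']))
             (Bin Mul (Get ''D'' [var ''c'', var ''d'']) (Get ''D'' [var ''d'', var ''a''])))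
           (''w0'' ::= var ''a'' ;; ''w1'' ::= var ''b'' ;; ''w2'' ::= var ''c'' ;; ''w3'' ::= var ''d'' ;;
            ''f'' ::= Num 1)
           Skip))))"

text \<open>
  Puts the arc from number \<open>p\<close> of part \<open>u\<close> to number \<open>q\<close> of part \<open>v\<close> into the subgraph \<open>l\<close>.
\<close>

definition emit :: "exp \<Rightarrow> exp \<Rightarrow> exp \<Rightarrow> exp \<Rightarrow> exp \<Rightarrow> com" where
  "emit l u p v q = Put ''A'' [l, u, Get ''E'' [u, p], v, Get ''E'' [v, q]] (Num 1)"

definition emit_layers :: "com \<Rightarrow> com" where
  "emit_layers step =
     For ''l'' (Num 0) (var ''n'') (For ''u'' (Num 0) (var ''t'') (For ''v'' (Num 0) (var ''t'')
       (Cond (Get ''D'' [var ''u'', var ''v''])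
         (For ''p'' (Num 0) (var ''n'')
           (step ;; emit (var ''l'') (var ''u'') (var ''p'') (var ''v'') (var ''q'')))
         Skip)))"

definition emit_spread :: com where
  "emit_spread =
     For ''l'' (Num 0) (var ''n'') (For ''u'' (Num 0) (var ''t'') (For ''v'' (Num 0) (var ''t'')
       (Cond (Get ''D'' [var ''u'', var ''v''])
         (For ''p'' (Get ''K'' [var ''u'']) (order_of (var ''u''))
            (emit (var ''l'') (var ''u'') (var ''p'') (var ''v'') (var ''l'')) ;;
          For ''p'' (Get ''K'' [var ''v'']) (order_of (var ''v''))
            (emit (var ''l'') (var ''u'') (var ''l'') (var ''v'') (var ''p'')))
         Skip)))"

abbreviation both :: "exp \<Rightarrow> exp \<Rightarrow> exp" where
  "both \<equiv> Bin Mul"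

abbreviation negate :: "exp \<Rightarrow> exp" where
  "negate \<equiv> Bin Sub (Num 1)"

definition step_on_walk :: com where
  "step_on_walk =
     Cond (both (Bin Eq (var ''u'') (var ''w3'')) (Bin Eq (var ''v'') (var ''w0'')))
       (''z'' ::= Bin Sub (Bin Add (var ''n'') (Num 1)) (var ''l''))
       (Cond (both (Bin Eq (var ''u'') (var ''w1'')) (Bin Eq (var ''v'') (var ''w2'')))
         (''z'' ::= Bin Sub (var ''n'') (var ''l''))
         (''z'' ::= var ''l'')) ;;
     ''q'' ::= Bin Mod (Bin Add (var ''p'') (var ''z'')) (var ''n'')"

abbreviation l_odd :: exp where "l_odd \<equiv> Bin Mod (var ''l'') (Num 2)"
abbreviation n_mod4_is :: "nat \<Rightarrow> exp" where
  "n_mod4_is r \<equiv> Bin Eq (Bin Mod (var ''n'') (Num 4)) (Num r)"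
abbreviation l_upper :: exp where
  "l_upper \<equiv> both (n_mod4_is 0) (negate (Bin Less (Bin Mul (Num 2) (var ''l'')) (var ''n'')))"
abbreviation double :: "string \<Rightarrow> exp" where
  "double x \<equiv> Bin Mul (Num 2) (var x)"

definition twist_code :: com where
  "twist_code =
     Cond (n_mod4_is 2)
       (Cond (Bin Eq (var ''p'') (Num 0)) (''q'' ::= Num 1)
       (Cond (Bin Eq (var ''p'') (Num 1)) (Cond l_odd (''q'' ::= Num 0) (''q'' ::= Num 2))
       (Cond (Bin Eq (var ''p'') (Num 2)) (Cond l_odd (''q'' ::= Num 2) (''q'' ::= Num 0))
         (''q'' ::= var ''p''))))
       (''q'' ::= var ''p'')"

definition middle_shift_code :: com where
  "middle_shift_code =
     Cond l_upper
       (Cond l_odd (''z'' ::= Bin Sub (var ''l'') (Num 1)) (''z'' ::= Bin Add (var ''l'') (Num 1)))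
       (''z'' ::= var ''l'')"

definition last_shift_code :: com where
  "last_shift_code =
     Cond l_odd
       (Cond (n_mod4_is 2) (''z'' ::= Bin Sub (Bin Add (double ''n'') (Num 2)) (double ''l''))
       (Cond l_upper (''z'' ::= Bin Sub (Bin Add (double ''n'') (Num 2)) (double ''l''))
         (''z'' ::= Bin Sub (Bin Add (double ''n'') (Num 1)) (double ''l''))))
       (Cond l_upper (''z'' ::= Bin Sub (Bin Sub (double ''n'') (Num 2)) (double ''l''))
         (''z'' ::= Bin Sub (Bin Add (double ''n'') (Num 1)) (double ''l'')))"

definition step_on_triangle :: com where
  "step_on_triangle =
     Cond (Bin Eq (var ''u'') (var ''a''))
       (''q'' ::= var ''p'' ;; ''z'' ::= var ''l'')
     (Cond (Bin Eq (var ''u'') (var ''b''))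
       (twist_code ;; middle_shift_code)
       (''q'' ::= var ''p'' ;; last_shift_code)) ;;
     ''q'' ::= Bin Mod (Bin Add (var ''q'') (var ''z'')) (var ''n'')"

text \<open>
  The triangle has the vertices \<open>0\<close>, \<open>1\<close>, \<open>2\<close>; whether \<open>01\<close> is an arc decides its orientation.
\<close>

definition find_corners :: com where
  "find_corners =
     ''a'' ::= Num 0 ;;
     ''b'' ::= Bin Sub (Num 2) (Get ''D'' [Num 0, Num 1]) ;;
     ''c'' ::= Bin Add (Num 1) (Get ''D'' [Num 0, Num 1])"

definition corner_var :: "nat \<Rightarrow> exp" where
  "corner_var j = var (corner ''a'' ''b'' ''c'' j)"

definition pattern_test :: "pattern \<Rightarrow> exp" where
  "pattern_test pat = foldr both
     (map (\<lambda>j. negate (Bin Less (order_of (corner_var j)) (Num (fst pat ! j)))) [0, 1, 2] @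
      map (\<lambda>(j, p, q). Get ''H'' [corner_var j, Get ''E'' [corner_var j, Num p],
         Get ''E'' [corner_var j, Num q]]) (inner_arcs pat))
     (Num 1)"

definition emit_arcs :: "nat \<Rightarrow> (cell \<times> cell) list \<Rightarrow> com" where
  "emit_arcs l es = foldr (\<lambda>((j, p), (j', q)).
     Seq (emit (Num l) (corner_var j) (Num p) (corner_var j') (Num q))) es Skip"

definition emit_pattern :: "pattern \<Rightarrow> com" where
  "emit_pattern = (\<lambda>(ks, w, w').
     Put ''K'' [corner_var 0] (Num (ks ! 0)) ;; Put ''K'' [corner_var 1] (Num (ks ! 1)) ;;
     Put ''K'' [corner_var 2] (Num (ks ! 2)) ;;
     emit_arcs 0 (zip w (tl w)) ;; emit_arcs 1 (zip w' (tl w')))"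

definition try_patterns :: "pattern list \<Rightarrow> com" where
  "try_patterns ps = foldr (\<lambda>pat. Cond (pattern_test pat) (emit_pattern pat)) ps Skip"

definition core_phase :: com where
  "core_phase =
     Cond (var ''f'') (emit_layers step_on_walk)
       (find_corners ;;
        Cond (Bin Eq (var ''n'') (Num 2)) (try_patterns patterns) (emit_layers step_on_triangle))"

definition program :: com where
  "program =
     minimum ;; ''count'' ::= var ''n'' ;;
     Cond (var ''n'')
       (all_vertices ;; number_parts ;; find_walk ;;
        core_phase ;; emit_spread)
       Skip"


section \<open>Correctness of the program\<close>

text \<open>
  \<open>M\<close> is the order of the composition; the word bound \<open>w\<close> leaves room for the small multiples of \<open>n\<close> that
  occur as intermediate values.
\<close>

locale packing_instance =
  fixes D :: "nat pair_pre_digraph" and H :: "nat \<Rightarrow> nat pair_pre_digraph" and S :: "(nat \<times> nat) set"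
  assumes hyp: "packing_hypotheses D H S" and labels: "standard_labels D H"
begin

definition N :: "nat \<Rightarrow> nat" where "N u = card (pverts (H u))"
definition t :: nat where "t = card (pverts D)"
definition M :: nat where "M = card (pverts (composition D H))"
definition n :: nat where "n = min_part D H"
definition w :: nat where "w = 100 * (M + t)"

lemma pverts_D: "pverts D = {..<t}"
  using labels by (auto simp: standard_labels_def t_def)

lemma pverts_H: "u < t \<Longrightarrow> pverts (H u) = {..<N u}"
proof -
  assume "u < t"
  then obtain m where "pverts (H u) = {..<m}"
    using labels pverts_D unfolding standard_labels_def by (metis lessThan_iff)
  then show ?thesis by (simp add: N_def)
qed

lemma pair_digraphs: "pair_digraph D" "u < t \<Longrightarrow> pair_digraph (H u)"
  using hyp by (auto simp: packing_hypotheses_def pverts_D)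

lemma t_ge2: "2 \<le> t" using hyp by (simp add: packing_hypotheses_def t_def)

lemma M_sum: "M = (\<Sum>u<t. N u)"
proof -
  have "finite (pverts (H u))" if "u < t" for u using pverts_H[OF that] by simp
  then show ?thesis by (simp add: M_def composition_def pverts_D N_def)
qed

lemma M_ge2: "2 \<le> M"
  using hyp by (simp add: packing_hypotheses_def M_def)

lemma N_le_M: "u < t \<Longrightarrow> N u \<le> M"
  unfolding M_sum by (intro member_le_sum) auto

lemma n_Min: "n = Min (N ` {..<t})"
  by (simp add: n_def min_part_def pverts_D N_def)

lemma n_le_N: "u < t \<Longrightarrow> n \<le> N u"
  by (simp add: n_Min)

lemma n_le_M: "n \<le> M"
  using n_le_N[of 0] N_le_M[of 0] t_ge2 by simp

lemma arc_D_less: "(u, v) \<in> parcs D \<Longrightarrow> u < t \<and> v < t"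
  using pair_wf_digraph.in_arcsD1[of D u v] pair_wf_digraph.in_arcsD2[of D u v] pair_digraphs(1)
  by (auto simp: pverts_D pair_digraph_def pair_fin_digraph_def)

lemma arc_H_less: "(p, q) \<in> parcs (H u) \<Longrightarrow> u < t \<Longrightarrow> p < N u \<and> q < N u \<and> p \<noteq> q"
proof -
  assume pq: "(p, q) \<in> parcs (H u)" and u: "u < t"
  interpret pair_digraph "H u" using pair_digraphs(2) u .
  show ?thesis using in_arcsD1[OF pq] in_arcsD2[OF pq] pair_no_loops[OF pq] pverts_H[OF u] by auto
qed

definition input_kept :: "state \<Rightarrow> bool" where
  "input_kept s \<longleftrightarrow> (\<forall>a\<in>{''t'', ''order'', ''D'', ''H''}. s a = input_state D H S a)"

lemma input_kept_reads:
  assumes "input_kept s"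
  shows "s ''t'' [] = t" "u < t \<Longrightarrow> s ''order'' [u] = N u"
    "s ''D'' [u, v] = of_bool ((u, v) \<in> parcs D)"
    "u < t \<Longrightarrow> s ''H'' [u, p, q] = of_bool ((p, q) \<in> parcs (H u))"
proof -
  have s: "s ''t'' = input_state D H S ''t''" "s ''order'' = input_state D H S ''order''"
    "s ''D'' = input_state D H S ''D''" "s ''H'' = input_state D H S ''H''"
    using assms by (simp_all add: input_kept_def)
  show "s ''t'' [] = t" by (simp add: s input_state_def t_def)
  show "s ''order'' [u] = N u" if "u < t" using that by (simp add: s input_state_def N_def pverts_D)
  show "s ''D'' [u, v] = of_bool ((u, v) \<in> parcs D)" by (simp add: s input_state_def)
  show "s ''H'' [u, p, q] = of_bool ((p, q) \<in> parcs (H u))" if "u < t"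
    using that by (simp add: s input_state_def pverts_D)
qed

lemma input_kept_cong:
  "input_kept s \<Longrightarrow> (\<And>a. a \<in> {''t'', ''order'', ''D'', ''H''} \<Longrightarrow> s' a = s a) \<Longrightarrow> input_kept s'"
  by (simp add: input_kept_def)

lemma w_ge: "100 * M \<le> w" "100 * t \<le> w" "400 \<le> w"
  using M_ge2 t_ge2 by (auto simp: w_def)

text \<open>
  As long as the loop continues, the parts seen so far are nonempty, so their number is at most \<open>M\<close>.
  If it stops early, the current minimum is \<open>0\<close> and hence final.
\<close>

lemma halts_minimum:
  assumes s: "input_kept s"
  shows "halts w minimum s (100 * M) (\<lambda>s'. s' ''n'' [] = n)"
proof -
  let ?c = "Cond (Bin Less (order_of (var ''u'')) (var ''n'')) (''n'' ::= order_of (var ''u'')) Skip ;;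
        ''u'' ::= Bin Add (var ''u'') (Num 1)"
  let ?I = "\<lambda>m s'. \<exists>i. 1 \<le> i \<and> i \<le> t \<and> i \<le> M + 1 \<and> m = M + 1 - i \<and> s' ''u'' [] = i \<and>
    s' ''n'' [] = Min (N ` {..<i})"
  let ?e = "Bin Mul (Bin Less (var ''u'') (var ''t'')) (var ''n'')"
  have Min_Suc: "Min (N ` {..<Suc i}) = min (N i) (Min (N ` {..<i}))" if "1 \<le> i" for i
  proof -
    have "N ` {..<i} \<noteq> {}" using that by (auto simp: lessThan_empty_iff)
    then show ?thesis by (simp add: lessThan_Suc)
  qed
  have Min_le_M: "Min (N ` {..<i}) \<le> M" if "1 \<le> i" "i \<le> t" for i
    using that N_le_M[of 0] t_ge2 by (intro order_trans[OF Min_le[of _ "N 0"]]) auto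
  have loop: "halts w (While ?e ?c) s' (M * (20 + cost ?e + 1) + cost ?e + 1) (\<lambda>s'. s' ''n'' [] = n)"
    if s': "input_kept s'" and init: "s' ''u'' [] = 1" "s' ''n'' [] = N 0" for s'
  proof (rule halts_While[where I = ?I and B = 20 and m = M])
    fix m s1 assume I: "?I m s1" and fr: "\<And>a. a \<notin> writes ?c \<Longrightarrow> s1 a = s' a"
    then obtain i where i: "1 \<le> i" "i \<le> t" "i \<le> M + 1" "m = M + 1 - i" "s1 ''u'' [] = i"
      "s1 ''n'' [] = Min (N ` {..<i})" by blast
    have kept: "input_kept s1" using s' by (rule input_kept_cong) (auto simp: fr)
    note reads = input_kept_reads[OF kept]
    have small: "Min (N ` {..<i}) \<le> w" "t \<le> w" "1 \<le> w" "i < w"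
      using Min_le_M[OF i(1,2)] w_ge i M_ge2 by linarith+
    have fits: "fits w s1 ?e" using i reads small by auto
    have "s1 ''n'' [] = n" if "eval s1 ?e = 0"
    proof (cases "i < t")
      case True
      then have 0: "Min (N ` {..<i}) = 0" using that i reads by simp
      have "n \<le> Min (N ` {..<i})"
        unfolding n_Min using i by (intro Min_antimono) (auto simp: lessThan_empty_iff)
      then show ?thesis using 0 i by simp
    next
      case False
      then show ?thesis using i by (simp add: n_Min)
    qed
    moreover have "0 < m \<and> halts w ?c s1 20 (?I (m - 1))" if "eval s1 ?e \<noteq> 0"
    proof -
      have it: "i < t" and pos: "Min (N ` {..<i}) \<noteq> 0" using that i reads by (auto split: if_splits)
      have "1 \<le> N j" if "j < i" for j
        using pos Min_le[of "N ` {..<i}" "N j"] that by (cases "N j") auto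
      \<comment> \<open>The parts before \<open>i\<close> are nonempty, so there are at most \<open>M\<close> of them.\<close>
      then have "(\<Sum>j<i. 1) \<le> (\<Sum>j<i. N j)" by (intro sum_mono) auto
      also have "\<dots> \<le> M" unfolding M_sum using it by (intro sum_mono2) auto
      finally have iM: "i \<le> M" by simp
      have "halts w ?c s1 20 (?I (m - 1))"
      proof (rule halts_loop_free)
        show "safe w ?c s1" using i it reads small N_le_M[OF it] w_ge by auto
        have "exec ?c s1 ''u'' [] = Suc i" "exec ?c s1 ''n'' [] = Min (N ` {..<Suc i})"
          using i it reads Min_Suc[OF i(1)] by auto
        then show "?I (m - 1) (exec ?c s1)" using i it iM by auto
      qed simp
      then show ?thesis using iM i by simp
    qed
    ultimately show "fits w s1 ?e \<and> (eval s1 ?e = 0 \<longrightarrow> s1 ''n'' [] = n) \<and>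
        (eval s1 ?e \<noteq> 0 \<longrightarrow> 0 < m \<and> halts w ?c s1 20 (?I (m - 1)))" using fits by blast
  next
    show "?I M s'" using init t_ge2 by (auto simp: lessThan_Suc)
  qed simp
  show ?thesis
    unfolding minimum_def
  proof (rule halts_Seq[where R = "\<lambda>s1. s1 = exec (''n'' ::= order_of (Num 0)) s" and ?B1.0 = 3])
    show "halts w (''n'' ::= order_of (Num 0)) s 3 (\<lambda>s1. s1 = exec (''n'' ::= order_of (Num 0)) s)"
      using input_kept_reads[OF s] N_le_M[of 0] w_ge t_ge2 by (intro halts_loop_free) auto
    fix s1 assume s1: "s1 = exec (''n'' ::= order_of (Num 0)) s"
    show "halts w (''u'' ::= Num 1 ;; While ?e ?c) s1 (M * 30 + 20) (\<lambda>s'. s' ''n'' [] = n)"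
    proof (rule halts_Seq[where R = "\<lambda>s2. s2 = exec (''u'' ::= Num 1) s1" and ?B1.0 = 2])
      show "halts w (''u'' ::= Num 1) s1 2 (\<lambda>s2. s2 = exec (''u'' ::= Num 1) s1)"
        using w_ge by (intro halts_loop_free) auto
      fix s2 assume s2: "s2 = exec (''u'' ::= Num 1) s1"
      have "input_kept s2" using s by (rule input_kept_cong) (auto simp: s1 s2)
      then show "halts w (While ?e ?c) s2 (M * (20 + cost ?e + 1) + cost ?e + 1) (\<lambda>s'. s' ''n'' [] = n)"
        using input_kept_reads[OF s] t_ge2 by (intro loop) (auto simp: s1 s2)
    qed auto
  qed (use M_ge2 in auto)
qed

end

section \<open>Listing the vertices and searching a closed walk\<close>

locale nonempty_packing_instance = packing_instance +
  assumes n_pos: "0 < n"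
begin

lemma t_le_M: "t \<le> M"
proof -
  have "(\<Sum>u<t. 1) \<le> (\<Sum>u<t. N u)"
    using n_pos n_le_N by (intro sum_mono) (fastforce intro: less_le_trans simp: Suc_le_eq)
  then show ?thesis by (simp add: M_sum)
qed

definition prepared :: "state \<Rightarrow> bool" where
  "prepared s \<longleftrightarrow> input_kept s \<and> s ''n'' [] = n"

lemma prepared_reads:
  assumes "prepared s"
  shows "s ''n'' [] = n" "s ''t'' [] = t" "u < t \<Longrightarrow> s ''order'' [u] = N u"
    "s ''D'' [u, v] = of_bool ((u, v) \<in> parcs D)"
    "u < t \<Longrightarrow> s ''H'' [u, p, q] = of_bool ((p, q) \<in> parcs (H u))"
  using assms by (auto simp: prepared_def input_kept_reads)

lemma prepared_cong:
  "prepared s \<Longrightarrow> (\<And>a. a \<in> {''t'', ''order'', ''D'', ''H'', ''n''} \<Longrightarrow> s' a = s a) \<Longrightarrow> prepared s'"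
  by (auto simp: prepared_def intro: input_kept_cong)

lemma bounds: "u < t \<Longrightarrow> N u \<le> M" "n \<le> M" "t \<le> M" "100 * M \<le> w" "400 \<le> w" "2 \<le> M"
  using N_le_M n_le_M t_le_M w_ge M_ge2 by auto

lemma less_w: "u < t \<Longrightarrow> N u \<le> w" "n \<le> w" "t \<le> w" "M \<le> w" "1 \<le> w" "1 \<le> M" "k \<le> 400 \<Longrightarrow> k \<le> w"
  using bounds(1)[of u] bounds(2-) by linarith+

lemma halts_all_vertices:
  assumes s: "prepared s"
  shows "halts w all_vertices s (65 * M ^ 3) (\<lambda>s'. cells ''V'' s' =
    cells ''V'' s \<union> (\<Union>l\<in>{0..<n}. \<Union>u\<in>{0..<t}. \<Union>p\<in>{0..<N u}. {[l, u, p]}))"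
  unfolding all_vertices_def
proof (rule halts_For_collect[where k = 45 and d = 2 and M = M and b = n])
  fix l s1 assume l: "l < n" "s1 ''l'' [] = l"
    and fr1: "\<And>y. y \<notin> insert ''l'' (writes (For ''u'' (Num 0) (var ''t'')
       (For ''p'' (Num 0) (order_of (var ''u''))
         (Put ''V'' [var ''l'', var ''u'', var ''p''] (Num 1))))) \<Longrightarrow> s1 y = s y"
  have s1: "prepared s1" using s by (rule prepared_cong) (auto simp: fr1)
  show "halts w (For ''u'' (Num 0) (var ''t'') (For ''p'' (Num 0) (order_of (var ''u''))
         (Put ''V'' [var ''l'', var ''u'', var ''p''] (Num 1)))) s1 (45 * M ^ 2) (\<lambda>s'. cells ''V'' s' =
    cells ''V'' s1 \<union> (\<Union>u\<in>{0..<t}. \<Union>p\<in>{0..<N u}. {[l, u, p]}))"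
  proof (rule halts_For_collect[where k = 25 and d = 1 and M = M and b = t])
    fix u s2 assume u: "u < t" "s2 ''u'' [] = u"
      and fr2: "\<And>y. y \<notin> insert ''u'' (writes (For ''p'' (Num 0) (order_of (var ''u''))
         (Put ''V'' [var ''l'', var ''u'', var ''p''] (Num 1)))) \<Longrightarrow> s2 y = s1 y"
    have s2: "prepared s2" using s1 by (rule prepared_cong) (auto simp: fr2)
    show "halts w (For ''p'' (Num 0) (order_of (var ''u''))
         (Put ''V'' [var ''l'', var ''u'', var ''p''] (Num 1))) s2 (25 * M ^ 1) (\<lambda>s'. cells ''V'' s' =
        cells ''V'' s2 \<union> (\<Union>p\<in>{0..<N u}. {[l, u, p]}))"
    proof (rule halts_For_collect[where k = 5 and d = 0 and M = M and b = "N u"])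
      fix p s3 assume p: "p < N u" "s3 ''p'' [] = p"
        and fr3: "\<And>y. y \<notin> insert ''p'' (writes
         (Put ''V'' [var ''l'', var ''u'', var ''p''] (Num 1))) \<Longrightarrow> s3 y = s2 y"
      have "s3 ''u'' [] = u" "s3 ''l'' [] = l" using u l by (auto simp: fr3 fr2)
      then show "halts w (Put ''V'' [var ''l'', var ''u'', var ''p''] (Num 1)) s3 (5 * M ^ 0)
          (\<lambda>s'. cells ''V'' s' = cells ''V'' s3 \<union> {[l, u, p]})"
        using p u l less_w(1)[of u] less_w(2-) by (intro halts_loop_free) (auto simp: cells_def)
    qed (use u prepared_reads[OF s2] less_w bounds in auto)
  qed (use prepared_reads[OF s1] less_w bounds in \<open>auto simp: eval_nat_numeral\<close>)
qed (use prepared_reads[OF s] less_w bounds in \<open>auto simp: eval_nat_numeral\<close>)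

lemma halts_find_walk:
  assumes s: "prepared s"
  shows "halts w find_walk s (120 * M ^ 4) (\<lambda>s'.
     (s' ''f'' [] = 0 \<and> (\<nexists>a b c d. closed_4_walk (parcs D) a b c d)) \<or>
     (s' ''f'' [] = 1 \<and> closed_4_walk (parcs D) (s' ''w0'' []) (s' ''w1'' []) (s' ''w2'' []) (s' ''w3'' [])))"
  (is "halts w find_walk s _ ?Q")
proof -
  define J where "J s \<longleftrightarrow> s ''f'' [] \<le> 1 \<and> (s ''f'' [] \<noteq> 0 \<longrightarrow>
     closed_4_walk (parcs D) (s ''w0'' []) (s ''w1'' []) (s ''w2'' []) (s ''w3'' []))" for s :: state
  have J_set: "J (set_var x v s) = J s" if "x \<in> {''a'', ''b'', ''c'', ''d''}" for x v s
    using that by (auto simp: J_def)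
  define C where "C = Cond (Bin Mul (Bin Mul (Get ''D'' [var ''a'', var ''b'']) (Get ''D'' [var ''b'', var ''c'']))
             (Bin Mul (Get ''D'' [var ''c'', var ''d'']) (Get ''D'' [var ''d'', var ''a''])))
           (''w0'' ::= var ''a'' ;; ''w1'' ::= var ''b'' ;; ''w2'' ::= var ''c'' ;; ''w3'' ::= var ''d'' ;;
            ''f'' ::= Num 1)
           Skip"
  have wC [simp]: "writes C = {''w0'', ''w1'', ''w2'', ''w3'', ''f''}" by (auto simp: C_def)
  let ?cw = "closed_4_walk (parcs D)"
  have body: "halts w C s' (30 * M ^ 0) (\<lambda>s''. J s'' \<and> (s'' ''f'' [] = 0 \<longrightarrow> s' ''f'' [] = 0 \<and> \<not> ?cw a b c d))"
    if "prepared s'" "s' ''a'' [] = a" "s' ''b'' [] = b" "s' ''c'' [] = c" "s' ''d'' [] = d"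
      "a < t" "b < t" "c < t" "d < t" "J s'" for s' a b c d
    using that prepared_reads[OF that(1)] less_w
    by (intro halts_loop_free) (auto simp: C_def J_def closed_4_walk_def)
  have loop_d: "halts w (For ''d'' (Num 0) (var ''t'') C) s' (50 * M ^ 1)
      (\<lambda>s''. J s'' \<and> (s'' ''f'' [] = 0 \<longrightarrow> s' ''f'' [] = 0 \<and> (\<forall>d\<in>{0..<t}. \<not> ?cw a b c d)))"
    if s': "prepared s'" "s' ''a'' [] = a" "s' ''b'' [] = b" "s' ''c'' [] = c" "a < t" "b < t" "c < t" "J s'"
    for s' a b c
  proof (rule halts_For_search[where k = 30 and d = 0 and M = M and b = t])
    fix d s1 assume d: "d < t" "s1 ''d'' [] = d" "J s1"
      and fr: "\<And>y. y \<notin> insert ''d'' (writes C) \<Longrightarrow> s1 y = s' y"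
    have s1: "prepared s1" using s'(1) by (rule prepared_cong) (auto simp: fr)
    show "halts w C s1 (30 * M ^ 0) (\<lambda>s''. J s'' \<and> (s'' ''f'' [] = 0 \<longrightarrow> s1 ''f'' [] = 0 \<and> \<not> ?cw a b c d))"
      using s' d by (intro body[OF s1]) (auto simp: fr)
  qed (use that prepared_reads[OF s'(1)] less_w bounds in \<open>auto simp: J_set\<close>)
  have loop_c: "halts w (For ''c'' (Num 0) (var ''t'') (For ''d'' (Num 0) (var ''t'') C)) s' (70 * M ^ 2)
      (\<lambda>s''. J s'' \<and> (s'' ''f'' [] = 0 \<longrightarrow> s' ''f'' [] = 0 \<and> (\<forall>c\<in>{0..<t}. \<not> (\<exists>d\<in>{0..<t}. ?cw a b c d))))"
    if s': "prepared s'" "s' ''a'' [] = a" "s' ''b'' [] = b" "a < t" "b < t" "J s'"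
    for s' a b
  proof (rule halts_For_search[where k = 50 and d = 1 and M = M and b = t])
    fix c s1 assume c: "c < t" "s1 ''c'' [] = c" "J s1"
      and fr: "\<And>y. y \<notin> insert ''c'' (writes (For ''d'' (Num 0) (var ''t'') C)) \<Longrightarrow> s1 y = s' y"
    have s1: "prepared s1" using s'(1) by (rule prepared_cong) (auto simp: fr)
    show "halts w (For ''d'' (Num 0) (var ''t'') C) s1 (50 * M ^ 1) (\<lambda>s''. J s'' \<and>
        (s'' ''f'' [] = 0 \<longrightarrow> s1 ''f'' [] = 0 \<and> \<not> (\<exists>d\<in>{0..<t}. ?cw a b c d)))"
      using s' c by (intro halts_mono[OF loop_d[OF s1]]) (auto simp: fr)
  qed (use that prepared_reads[OF s'(1)] less_w bounds in \<open>auto simp: J_set eval_nat_numeral\<close>)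
  have loop_b: "halts w (For ''b'' (Num 0) (var ''t'') (For ''c'' (Num 0) (var ''t'') (For ''d'' (Num 0) (var ''t'') C)))
      s' (90 * M ^ 3)
      (\<lambda>s''. J s'' \<and> (s'' ''f'' [] = 0 \<longrightarrow> s' ''f'' [] = 0 \<and>
         (\<forall>b\<in>{0..<t}. \<not> (\<exists>c\<in>{0..<t}. \<exists>d\<in>{0..<t}. ?cw a b c d))))"
    if s': "prepared s'" "s' ''a'' [] = a" "a < t" "J s'"
    for s' a
  proof (rule halts_For_search[where k = 70 and d = 2 and M = M and b = t])
    fix b s1 assume b: "b < t" "s1 ''b'' [] = b" "J s1"
      and fr: "\<And>y. y \<notin> insert ''b'' (writes (For ''c'' (Num 0) (var ''t'') (For ''d'' (Num 0) (var ''t'') C))) \<Longrightarrow> s1 y = s' y"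
    have s1: "prepared s1" using s'(1) by (rule prepared_cong) (auto simp: fr)
    show "halts w (For ''c'' (Num 0) (var ''t'') (For ''d'' (Num 0) (var ''t'') C)) s1 (70 * M ^ 2) (\<lambda>s''. J s'' \<and>
        (s'' ''f'' [] = 0 \<longrightarrow> s1 ''f'' [] = 0 \<and> \<not> (\<exists>c\<in>{0..<t}. \<exists>d\<in>{0..<t}. ?cw a b c d)))"
      using s' b by (intro halts_mono[OF loop_c[OF s1]]) (auto simp: fr)
  qed (use that prepared_reads[OF s'(1)] less_w bounds in \<open>auto simp: J_set eval_nat_numeral\<close>)
  let ?L = "For ''b'' (Num 0) (var ''t'') (For ''c'' (Num 0) (var ''t'') (For ''d'' (Num 0) (var ''t'') C))"
  have loop_a: "halts w (For ''a'' (Num 0) (var ''t'') ?L) s' (110 * M ^ 4) ?Q"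
    if s': "prepared s'" "s' ''f'' [] = 0" for s'
  proof (rule halts_mono[OF halts_For_search[where k = 90 and d = 3 and M = M and b = t and ?i0.0 = 0 and f = "''f''"
        and J = J and P = "\<lambda>a. \<exists>b\<in>{0..<t}. \<exists>c\<in>{0..<t}. \<exists>d\<in>{0..<t}. ?cw a b c d" and B = "110 * M ^ 4"]])
    fix a s1 assume a: "a < t" "s1 ''a'' [] = a" "J s1"
      and fr: "\<And>y. y \<notin> insert ''a'' (writes ?L) \<Longrightarrow> s1 y = s' y"
    have s1: "prepared s1" using s'(1) by (rule prepared_cong) (auto simp: fr)
    show "halts w ?L s1 (90 * M ^ 3) (\<lambda>s''. J s'' \<and>
        (s'' ''f'' [] = 0 \<longrightarrow> s1 ''f'' [] = 0 \<and>
           \<not> (\<exists>b\<in>{0..<t}. \<exists>c\<in>{0..<t}. \<exists>d\<in>{0..<t}. ?cw a b c d)))"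
      using s' a by (intro halts_mono[OF loop_b[OF s1]]) (auto simp: fr)
  next
    fix s1 assume J: "J s1 \<and> (s1 ''f'' [] = 0 \<longrightarrow> s' ''f'' [] = 0 \<and>
      (\<forall>a\<in>{0..<t}. \<not> (\<exists>b\<in>{0..<t}. \<exists>c\<in>{0..<t}. \<exists>d\<in>{0..<t}. ?cw a b c d)))"
    have less: "a \<in> {0..<t} \<and> b \<in> {0..<t} \<and> c \<in> {0..<t} \<and> d \<in> {0..<t}" if "?cw a b c d" for a b c d
      using that arc_D_less by (auto simp: closed_4_walk_def)
    show "?Q s1"
    proof (cases "s1 ''f'' [] = 0")
      case True
      then have "\<not> ?cw a b c d" for a b c d using J less[of a b c d] by blast
      then show ?thesis using True by simp
    next
      case False
      then have "s1 ''f'' [] = 1" using J by (simp add: J_def)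
      then show ?thesis using J by (simp add: J_def)
    qed
  qed (use that prepared_reads[OF s'(1)] less_w bounds in \<open>auto simp: J_set J_def eval_nat_numeral\<close>)
  show ?thesis
    unfolding find_walk_def C_def[symmetric]
  proof (rule halts_Seq[where R = "\<lambda>s1. s1 = exec (''f'' ::= Num 0) s" and ?B1.0 = 2])
    show "halts w (''f'' ::= Num 0) s 2 (\<lambda>s1. s1 = exec (''f'' ::= Num 0) s)"
      by (intro halts_loop_free) auto
    fix s1 assume s1: "s1 = exec (''f'' ::= Num 0) s"
    have "prepared s1" using s by (rule prepared_cong) (auto simp: s1)
    then show "halts w (For ''a'' (Num 0) (var ''t'') ?L) s1 (110 * M ^ 4) ?Q"
      by (rule loop_a) (simp add: s1)
  qed (use bounds one_le_power[of M 4] in linarith)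
qed

end

section \<open>Numbering the parts\<close>

lemma arranged_of_front:
  assumes verts: "pverts G = {..<m}" and xy: "x < m" "y < m" "x \<noteq> y" "(x, y) \<in> parcs G"
    and f: "\<And>p. p < m \<Longrightarrow> f p = bring_to_front x y p"
  shows "arranged G f"
proof -
  have "bij_betw f {..<m} {..<m}"
    using bring_to_front(1)[OF xy(1-3)] f by (subst bij_betw_cong[of _ f "bring_to_front x y"]) auto
  moreover have "f 0 = x" "f 1 = y" using f xy bring_to_front(2,3)[OF xy(1-3)] by auto
  ultimately show ?thesis using verts xy(4) by (simp add: arranged_def)
qed

context nonempty_packing_instance
begin

text \<open>
  The search leaves in \<open>x\<close>, \<open>y\<close> the ends of the last arc found, if there is one, and the final
  assignments apply \<open>bring_to_front x y\<close> to the identical numbering.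
\<close>

lemma halts_number_part:
  assumes s: "prepared s" and u: "u < t" "s ''u'' [] = u"
    and E: "\<And>v p. s ''E'' [v, p] \<le> w"
  shows "halts w number_part s (150 * M ^ 2) (\<lambda>s'. arranged (H u) (\<lambda>p. s' ''E'' [u, p]) \<and>
     s' ''K'' [u] = n \<and> (\<forall>v. v \<noteq> u \<longrightarrow> (\<forall>p. s' ''E'' [v, p] = s ''E'' [v, p]) \<and> s' ''K'' [v] = s ''K'' [v]) \<and>
     (\<forall>v p. s' ''E'' [v, p] \<le> w))"
  (is "halts w number_part s _ ?Q")
proof -
  note less_w' = less_w(1)[OF u(1)] less_w(2-)
  define c1 where "c1 = ''g'' ::= Num 0"
  define c2 where "c2 = Put ''K'' [var ''u''] (var ''n'')"
  define c3 where "c3 = For ''p'' (Num 0) (order_of (var ''u'')) (Put ''E'' [var ''u'', var ''p''] (var ''p''))"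
  define body where "body = Cond (Get ''H'' [var ''u'', var ''p'', var ''q''])
         (''x'' ::= var ''p'' ;; ''y'' ::= var ''q'' ;; ''g'' ::= Num 1) Skip"
  define c4 where "c4 = For ''p'' (Num 0) (order_of (var ''u'')) (For ''q'' (Num 0) (order_of (var ''u'')) body)"
  define c5 where "c5 = Cond (var ''g'') arrange_part Skip"
  have number_part: "number_part = c1 ;; c2 ;; c3 ;; c4 ;; c5"
    by (simp add: number_part_def c1_def c2_def c3_def c4_def c5_def body_def)
  have w3: "writes c3 = {''p'', ''E''}" by (auto simp: c3_def)
  have wb [simp]: "writes body = {''x'', ''y'', ''g''}" by (auto simp: body_def)
  have w4: "writes c4 = {''p'', ''q'', ''x'', ''y'', ''g''}" by (auto simp: c4_def)
  define J where "J s' \<longleftrightarrow> s' ''g'' [] \<le> 1 \<and> (s' ''g'' [] \<noteq> 0 \<longrightarrow> (s' ''x'' [], s' ''y'' []) \<in> parcs (H u))" for s' :: state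
  have J_set: "J (set_var x v s) = J s" if "x \<in> {''p'', ''q''}" for x v s
    using that by (auto simp: J_def)
  have 3: "halts w c3 s2 (25 * M ^ 1) (\<lambda>s'. (\<forall>r<N u. s' ''E'' [u, r] = r) \<and>
      (\<forall>v p. v \<noteq> u \<longrightarrow> s' ''E'' [v, p] = s2 ''E'' [v, p]) \<and> (\<forall>v p. s' ''E'' [v, p] \<le> w))"
    if s2: "prepared s2" "s2 ''u'' [] = u" "\<And>v p. s2 ''E'' [v, p] \<le> w" for s2
    unfolding c3_def
  proof (rule halts_For[where k = 5 and d = 0 and M = M and a = 0 and b = "N u" and
        I = "\<lambda>i s'. (\<forall>r<i. s' ''E'' [u, r] = r) \<and>
      (\<forall>v p. v \<noteq> u \<longrightarrow> s' ''E'' [v, p] = s2 ''E'' [v, p]) \<and> (\<forall>v p. s' ''E'' [v, p] \<le> w)"])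
    fix i s3 assume i: "i < N u" "s3 ''p'' [] = i"
      and I: "(\<forall>r<i. s3 ''E'' [u, r] = r) \<and>
      (\<forall>v p. v \<noteq> u \<longrightarrow> s3 ''E'' [v, p] = s2 ''E'' [v, p]) \<and> (\<forall>v p. s3 ''E'' [v, p] \<le> w)"
      and fr: "\<And>y. y \<notin> insert ''p'' (writes (Put ''E'' [var ''u'', var ''p''] (var ''p''))) \<Longrightarrow> s3 y = s2 y"
    have "s3 ''u'' [] = u" using s2 by (simp add: fr)
    then show "halts w (Put ''E'' [var ''u'', var ''p''] (var ''p'')) s3 (5 * M ^ 0)
       (\<lambda>s''. (\<forall>r<Suc i. set_var ''p'' (Suc i) s'' ''E'' [u, r] = r) \<and>
      (\<forall>v p. v \<noteq> u \<longrightarrow> set_var ''p'' (Suc i) s'' ''E'' [v, p] = s2 ''E'' [v, p]) \<and>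
      (\<forall>v p. set_var ''p'' (Suc i) s'' ''E'' [v, p] \<le> w))"
      using i I u(1) less_w' by (intro halts_loop_free) (auto simp: less_Suc_eq)
  qed (use s2 u prepared_reads[OF s2(1)] less_w' bounds in auto)
  have 4: "halts w c4 s3 (60 * M ^ 2) (\<lambda>s'. J s' \<and> (s' ''g'' [] = 0 \<longrightarrow>
        s3 ''g'' [] = 0 \<and> (\<forall>p\<in>{0..<N u}. \<not> (\<exists>q\<in>{0..<N u}. (p, q) \<in> parcs (H u)))))"
    if s3: "prepared s3" "s3 ''u'' [] = u" "J s3" for s3
    unfolding c4_def
  proof (rule halts_For_search[where k = 40 and d = 1 and M = M and b = "N u"])
    fix p s4 assume p: "p < N u" "s4 ''p'' [] = p" "J s4"
      and fr: "\<And>y. y \<notin> insert ''p'' (writes (For ''q'' (Num 0) (order_of (var ''u'')) body)) \<Longrightarrow> s4 y = s3 y"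
    have s4: "prepared s4" using s3(1) by (rule prepared_cong) (auto simp: fr)
    have u4: "s4 ''u'' [] = u" using s3 by (simp add: fr)
    show "halts w (For ''q'' (Num 0) (order_of (var ''u'')) body) s4 (40 * M ^ 1)
      (\<lambda>s''. J s'' \<and> (s'' ''g'' [] = 0 \<longrightarrow> s4 ''g'' [] = 0 \<and> \<not> (\<exists>q\<in>{0..<N u}. (p, q) \<in> parcs (H u))))"
    proof (rule halts_mono[OF halts_For_search[where k = 20 and d = 0 and M = M and b = "N u" and ?i0.0 = 0
            and f = "''g''" and J = J and P = "\<lambda>q. (p, q) \<in> parcs (H u)" and B = "40 * M ^ 1"]])
      fix q s5 assume q: "q < N u" "s5 ''q'' [] = q" "J s5"
        and fr5: "\<And>y. y \<notin> insert ''q'' (writes body) \<Longrightarrow> s5 y = s4 y"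
      have s5: "prepared s5" using s4(1) by (rule prepared_cong) (auto simp: fr5)
      have "s5 ''u'' [] = u" "s5 ''p'' [] = p" using p u4 by (auto simp: fr5)
      then show "halts w body s5 (20 * M ^ 0)
        (\<lambda>s''. J s'' \<and> (s'' ''g'' [] = 0 \<longrightarrow> s5 ''g'' [] = 0 \<and> (p, q) \<notin> parcs (H u)))"
        using q p u(1) less_w' prepared_reads[OF s5] by (intro halts_loop_free) (auto simp: body_def J_def)
    qed (use p u u4 prepared_reads[OF s4(1)] less_w' bounds in \<open>auto simp: J_set\<close>)
  qed (use s3 u prepared_reads[OF s3(1)] less_w' bounds in \<open>auto simp: J_set eval_nat_numeral\<close>)
  have 5: "halts w c5 s4 40 (\<lambda>s'. arranged (H u) (\<lambda>p. s' ''E'' [u, p]) \<and>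
      (\<forall>v p. v \<noteq> u \<longrightarrow> s' ''E'' [v, p] = s4 ''E'' [v, p]) \<and> (\<forall>v p. s' ''E'' [v, p] \<le> w))"
    if s4: "s4 ''u'' [] = u" "J s4" "s4 ''g'' [] = 0 \<longrightarrow> parcs (H u) = {}"
      "\<forall>r<N u. s4 ''E'' [u, r] = r" "\<forall>v p. s4 ''E'' [v, p] \<le> w" for s4
  proof (cases "s4 ''g'' [] = 0")
    case True
    have "bij_betw (\<lambda>p. s4 ''E'' [u, p]) {..<N u} {..<N u}"
      using s4(4) by (subst bij_betw_cong[of _ _ id]) auto
    then have "arranged (H u) (\<lambda>p. s4 ''E'' [u, p])"
      using s4(3) True by (simp add: arranged_def pverts_H[OF u(1)])
    then show ?thesis
      using True s4 less_w' by (intro halts_loop_free) (auto simp: c5_def arrange_part_def)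
  next
    case False
    define x y where "x = s4 ''x'' []" and "y = s4 ''y'' []"
    have xy: "(x, y) \<in> parcs (H u)" "x < N u" "y < N u" "x \<noteq> y"
      using False s4(2) arc_H_less u(1) by (auto simp: J_def x_def y_def)
    have N1: "1 < N u" using xy by linarith
    have xw: "x \<le> w" "y \<le> w" "1 \<le> w" using xy less_w' by linarith+
    let ?s = "exec arrange_part s4"
    have row: "?s ''E'' [u, r] = bring_to_front x y r" if "r < N u" for r
      using that s4(1,4) xy N1
      by (auto simp: arrange_part_def bring_to_front_def transpose_def x_def[symmetric] y_def[symmetric])
    have "arranged (H u) (\<lambda>p. ?s ''E'' [u, p])"
      by (rule arranged_of_front[OF pverts_H[OF u(1)] xy(2-4,1) row])
    moreover have "\<forall>v p. v \<noteq> u \<longrightarrow> ?s ''E'' [v, p] = s4 ''E'' [v, p]"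
      using s4(1) by (auto simp: arrange_part_def)
    moreover have "\<forall>v p. ?s ''E'' [v, p] \<le> w"
      using s4(5) xw by (auto simp: arrange_part_def x_def[symmetric] y_def[symmetric])
    moreover have "safe w arrange_part s4"
      using s4(1,5) xw u less_w' bounds
      by (auto simp: arrange_part_def x_def[symmetric] y_def[symmetric])
    moreover have "worst_cost c5 \<le> 40" by (simp add: c5_def arrange_part_def)
    moreover have "s4 ''g'' [] \<le> w" using s4(2) xw by (simp add: J_def)
    ultimately show ?thesis using False by (intro halts_loop_free) (auto simp: c5_def)
  qed
  show ?thesis
    unfolding number_part
  proof (rule halts_Seq[where R = "\<lambda>s1. s1 = exec c1 s" and ?B1.0 = 2])
    show "halts w c1 s 2 (\<lambda>s1. s1 = exec c1 s)" by (intro halts_loop_free) (auto simp: c1_def)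
    fix s1 assume s1: "s1 = exec c1 s"
    show "halts w (c2 ;; c3 ;; c4 ;; c5) s1 (147 * M ^ 2) ?Q"
    proof (rule halts_Seq[where R = "\<lambda>s2. s2 = exec c2 s1" and ?B1.0 = 3])
      show "halts w c2 s1 3 (\<lambda>s2. s2 = exec c2 s1)"
        using u s less_w' by (intro halts_loop_free) (auto simp: c2_def c1_def s1 prepared_reads)
      fix s2 assume s2: "s2 = exec c2 s1"
      have p2: "prepared s2" using s by (rule prepared_cong) (auto simp: s1 s2 c1_def c2_def)
      have u2: "s2 ''u'' [] = u" and E2: "s2 ''E'' = s ''E''" and g2: "s2 ''g'' [] = 0"
        and K2: "s2 ''K'' [u] = n" "\<And>v. v \<noteq> u \<Longrightarrow> s2 ''K'' [v] = s ''K'' [v]"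
        using u s by (auto simp: s1 s2 c1_def c2_def prepared_reads)
      show "halts w (c3 ;; c4 ;; c5) s2 (143 * M ^ 2) ?Q"
      proof (rule halts_Seq[OF 3[OF p2 u2]])
        show "s2 ''E'' [v, p] \<le> w" for v p using E by (simp add: E2)
      next
        fix s3 assume R3: "(\<forall>r<N u. s3 ''E'' [u, r] = r) \<and>
            (\<forall>v p. v \<noteq> u \<longrightarrow> s3 ''E'' [v, p] = s2 ''E'' [v, p]) \<and> (\<forall>v p. s3 ''E'' [v, p] \<le> w)"
          and "\<And>a. a \<notin> writes c3 \<Longrightarrow> s3 a = s2 a"
        then have fr3: "\<And>a. a \<notin> {''p'', ''E''} \<Longrightarrow> s3 a = s2 a" by (simp add: w3)
        have p3: "prepared s3" using p2 by (rule prepared_cong) (auto simp: fr3)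
        have u3: "s3 ''u'' [] = u" and g3: "s3 ''g'' [] = 0" using u2 g2 by (auto simp: fr3)
        have J3: "J s3" by (simp add: J_def g3)
        show "halts w (c4 ;; c5) s3 (110 * M ^ 2) ?Q"
        proof (rule halts_Seq[OF 4[OF p3 u3 J3]])
          fix s4 assume R4: "J s4 \<and> (s4 ''g'' [] = 0 \<longrightarrow>
              s3 ''g'' [] = 0 \<and> (\<forall>p\<in>{0..<N u}. \<not> (\<exists>q\<in>{0..<N u}. (p, q) \<in> parcs (H u))))"
            and "\<And>a. a \<notin> writes c4 \<Longrightarrow> s4 a = s3 a"
          then have fr4: "\<And>a. a \<notin> {''p'', ''q'', ''x'', ''y'', ''g''} \<Longrightarrow> s4 a = s3 a" by (simp add: w4)
          have u4: "s4 ''u'' [] = u" and E4: "s4 ''E'' = s3 ''E''" and K4: "s4 ''K'' = s2 ''K''"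
            using u3 by (auto simp: fr4 fr3)
          have no_arc: "s4 ''g'' [] = 0 \<longrightarrow> parcs (H u) = {}"
          proof
            assume "s4 ''g'' [] = 0"
            then have "(p, q) \<notin> parcs (H u)" if "p < N u" "q < N u" for p q using R4 that by auto
            then show "parcs (H u) = {}" using arc_H_less[OF _ u(1)] by auto
          qed
          show "halts w c5 s4 40 ?Q"
          proof (rule halts_mono[OF 5[OF u4 conjunct1[OF R4] no_arc]])
            show "\<forall>r<N u. s4 ''E'' [u, r] = r" "\<forall>v p. s4 ''E'' [v, p] \<le> w" using R3 by (auto simp: E4)
          next
            fix s5 assume R5: "arranged (H u) (\<lambda>p. s5 ''E'' [u, p]) \<and>
                (\<forall>v p. v \<noteq> u \<longrightarrow> s5 ''E'' [v, p] = s4 ''E'' [v, p]) \<and> (\<forall>v p. s5 ''E'' [v, p] \<le> w)"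
              and fr5: "\<And>a. a \<notin> writes c5 \<Longrightarrow> s5 a = s4 a"
            have "s5 ''K'' = s4 ''K''" by (rule fr5) (simp add: c5_def arrange_part_def)
            then show "?Q s5" using R5 R3 K2 by (auto simp: E4 E2 K4)
          qed auto
        next
          show "1 + 60 * M ^ 2 + 40 \<le> 110 * M ^ 2" using one_le_power[of M 2] bounds by linarith
        qed
      next
        have "M \<le> M ^ 2" by (simp add: power2_eq_square)
        then show "1 + 25 * M ^ 1 + 110 * M ^ 2 \<le> 143 * M ^ 2" using one_le_power[of M 2] bounds by simp
      qed
    next
      show "1 + 3 + 143 * M ^ 2 \<le> 147 * M ^ 2" using one_le_power[of M 2] bounds by linarith
    qed
  next
    show "1 + 2 + 147 * M ^ 2 \<le> 150 * M ^ 2" using one_le_power[of M 2] bounds by linarith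
  qed
qed

lemma halts_number_parts:
  assumes s: "prepared s" and E: "\<And>v p. s ''E'' [v, p] \<le> w"
  shows "halts w number_parts s (170 * M ^ 3) (\<lambda>s'. (\<forall>u<t. arranged (H u) (\<lambda>p. s' ''E'' [u, p]) \<and>
     s' ''K'' [u] = n) \<and> (\<forall>v p. s' ''E'' [v, p] \<le> w))"
  unfolding number_parts_def
proof (rule halts_For[where k = 150 and d = 2 and M = M and a = 0 and b = t and
      I = "\<lambda>i s'. (\<forall>u<i. arranged (H u) (\<lambda>p. s' ''E'' [u, p]) \<and>
     s' ''K'' [u] = n) \<and> (\<forall>v p. s' ''E'' [v, p] \<le> w)"])
  show "''u'' \<notin> writes number_part" by (simp add: number_part_def arrange_part_def)
  fix u s1 assume u: "u < t" "s1 ''u'' [] = u"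
    and I: "(\<forall>v<u. arranged (H v) (\<lambda>p. s1 ''E'' [v, p]) \<and> s1 ''K'' [v] = n) \<and> (\<forall>v p. s1 ''E'' [v, p] \<le> w)"
    and fr: "\<And>y. y \<notin> insert ''u'' (writes number_part) \<Longrightarrow> s1 y = s y"
  have s1: "prepared s1" using s by (rule prepared_cong) (auto simp: fr number_part_def arrange_part_def)
  show "halts w number_part s1 (150 * M ^ 2) (\<lambda>s''. (\<forall>v<Suc u. arranged (H v) (\<lambda>p. set_var ''u'' (Suc u) s'' ''E'' [v, p]) \<and>
     set_var ''u'' (Suc u) s'' ''K'' [v] = n) \<and> (\<forall>v p. set_var ''u'' (Suc u) s'' ''E'' [v, p] \<le> w))"
    using I u by (intro halts_mono[OF halts_number_part[OF s1]]) (auto simp: less_Suc_eq)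
qed (use E prepared_reads[OF s] less_w bounds in \<open>auto simp: eval_nat_numeral prepared_reads number_part_def arrange_part_def\<close>)

end

section \<open>Writing out coloured arcs\<close>

text \<open>
  The entries of the array \<open>A\<close> that represent the arcs \<open>R\<close> of subgraph \<open>l\<close> if \<open>e\<close> is the numbering.
\<close>

definition coded :: "(nat list \<Rightarrow> nat) \<Rightarrow> nat \<Rightarrow> (nat \<times> nat) rel \<Rightarrow> nat list set" where
  "coded e l R = (\<lambda>((u, p), (v, q)). [l, u, e [u, p], v, e [v, q]]) ` R"

lemma coded_Un: "coded e l (R \<union> R') = coded e l R \<union> coded e l R'"
  by (simp add: coded_def image_Un)

lemma coded_head: "i # is \<in> coded e l R \<Longrightarrow> i = l"
  by (auto simp: coded_def)

context nonempty_packing_instance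
begin

lemma halts_emit_layers:
  assumes s: "prepared s" and E: "\<And>v p. s ''E'' [v, p] \<le> w" and wr: "writes step \<subseteq> {''q'', ''z''}"
    and step: "\<And>l u v p s'. l < n \<Longrightarrow> u < t \<Longrightarrow> v < t \<Longrightarrow> (u, v) \<in> parcs D \<Longrightarrow> p < n \<Longrightarrow>
      s' ''l'' [] = l \<Longrightarrow> s' ''u'' [] = u \<Longrightarrow> s' ''v'' [] = v \<Longrightarrow> s' ''p'' [] = p \<Longrightarrow> prepared s' \<Longrightarrow>
      (\<And>a. a \<notin> {''l'', ''u'', ''v'', ''p'', ''q'', ''z'', ''A''} \<Longrightarrow> s' a = s a) \<Longrightarrow>
      halts w step s' 100 (\<lambda>s''. s'' ''q'' [] = \<sigma> l u v p)"
    and \<sigma>: "\<And>l u v p. l < n \<Longrightarrow> (u, v) \<in> parcs D \<Longrightarrow> p < n \<Longrightarrow> \<sigma> l u v p < n"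
  shows "halts w (emit_layers step) s (200 * M ^ 4) (\<lambda>s'. cells ''A'' s' =
    cells ''A'' s \<union> (\<Union>l\<in>{0..<n}. coded (s ''E'') l (layered n (parcs D) \<sigma> l)))"
proof -
  let ?e = "s ''E''"
  define C1 where "C1 = step ;; emit (var ''l'') (var ''u'') (var ''p'') (var ''v'') (var ''q'')"
  define C2 where "C2 = Cond (Get ''D'' [var ''u'', var ''v'']) (For ''p'' (Num 0) (var ''n'') C1) Skip"
  define C3 where "C3 = For ''v'' (Num 0) (var ''t'') C2"
  define C4 where "C4 = For ''u'' (Num 0) (var ''t'') C3"
  have defs: "emit_layers step = For ''l'' (Num 0) (var ''n'') C4"
    by (simp add: emit_layers_def C1_def C2_def C3_def C4_def)
  have w1: "writes C1 \<subseteq> {''q'', ''z'', ''A''}" using wr by (auto simp: C1_def emit_def)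
  then have w2: "writes C2 \<subseteq> {''p'', ''q'', ''z'', ''A''}" by (auto simp: C2_def)
  then have w3: "writes C3 \<subseteq> {''v'', ''p'', ''q'', ''z'', ''A''}" by (auto simp: C3_def)
  then have w4: "writes C4 \<subseteq> {''u'', ''v'', ''p'', ''q'', ''z'', ''A''}" by (auto simp: C4_def)
  have keep: "''n'' \<notin> writes C1" "''t'' \<notin> writes C2" "''t'' \<notin> writes C3" "''n'' \<notin> writes C4"
    using w1 w2 w3 w4 by auto
  define G where "G l u v p = (if (u, v) \<in> parcs D then {[l, u, ?e [u, p], v, ?e [v, \<sigma> l u v p]]} else {})" for l u v p
  have "halts w (For ''l'' (Num 0) (var ''n'') C4) s (200 * M ^ 4) (\<lambda>s'. cells ''A'' s' =
    cells ''A'' s \<union> (\<Union>l\<in>{0..<n}. \<Union>u\<in>{0..<t}. \<Union>v\<in>{0..<t}. \<Union>p\<in>{0..<n}. G l u v p))"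
  proof (rule halts_For_collect[where k = 180 and d = 3 and M = M and b = n])
    show "''l'' \<notin> writes C4" using w4 by auto
    fix l s1 assume l: "l < n" "s1 ''l'' [] = l"
      and "\<And>y. y \<notin> insert ''l'' (writes C4) \<Longrightarrow> s1 y = s y"
    then have fr1: "\<And>y. y \<notin> {''l'', ''u'', ''v'', ''p'', ''q'', ''z'', ''A''} \<Longrightarrow> s1 y = s y"
      using w4 by (auto dest: subsetD)
    have s1: "prepared s1" using s by (rule prepared_cong) (auto simp: fr1)
    show "halts w C4 s1 (180 * M ^ 3) (\<lambda>s'. cells ''A'' s' =
      cells ''A'' s1 \<union> (\<Union>u\<in>{0..<t}. \<Union>v\<in>{0..<t}. \<Union>p\<in>{0..<n}. G l u v p))"
      unfolding C4_def
    proof (rule halts_For_collect[where k = 160 and d = 2 and M = M and b = t])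
      show "''u'' \<notin> writes C3" using w3 by auto
      fix u s2 assume u: "u < t" "s2 ''u'' [] = u"
        and "\<And>y. y \<notin> insert ''u'' (writes C3) \<Longrightarrow> s2 y = s1 y"
      then have fr2: "\<And>y. y \<notin> {''u'', ''v'', ''p'', ''q'', ''z'', ''A''} \<Longrightarrow> s2 y = s1 y"
        using w3 by (auto dest: subsetD)
      have s2: "prepared s2" using s1 by (rule prepared_cong) (auto simp: fr2)
      show "halts w C3 s2 (160 * M ^ 2) (\<lambda>s'. cells ''A'' s' =
        cells ''A'' s2 \<union> (\<Union>v\<in>{0..<t}. \<Union>p\<in>{0..<n}. G l u v p))"
        unfolding C3_def
      proof (rule halts_For_collect[where k = 140 and d = 1 and M = M and b = t])
        show "''v'' \<notin> writes C2" using w2 by auto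
        fix v s3 assume v: "v < t" "s3 ''v'' [] = v"
          and "\<And>y. y \<notin> insert ''v'' (writes C2) \<Longrightarrow> s3 y = s2 y"
        then have fr3: "\<And>y. y \<notin> {''v'', ''p'', ''q'', ''z'', ''A''} \<Longrightarrow> s3 y = s2 y"
          using w2 by (auto dest: subsetD)
        have s3: "prepared s3" using s2 by (rule prepared_cong) (auto simp: fr3)
        have lu3: "s3 ''l'' [] = l" "s3 ''u'' [] = u" using l u by (auto simp: fr3 fr2)
        note reads = prepared_reads[OF s3]
        show "halts w C2 s3 (140 * M ^ 1) (\<lambda>s'. cells ''A'' s' = cells ''A'' s3 \<union> (\<Union>p\<in>{0..<n}. G l u v p))"
          unfolding C2_def
        proof (rule halts_Cond[where ?B1.0 = "135 * M ^ 1"])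
          assume "eval s3 (Get ''D'' [var ''u'', var ''v'']) \<noteq> 0"
          then have uv: "(u, v) \<in> parcs D" using reads lu3 v by (auto split: if_splits)
          show "halts w (For ''p'' (Num 0) (var ''n'') C1) s3 (135 * M ^ 1)
              (\<lambda>s'. cells ''A'' s' = cells ''A'' s3 \<union> (\<Union>p\<in>{0..<n}. G l u v p))"
          proof (rule halts_For_collect[where k = 115 and d = 0 and M = M and b = n])
            show "''p'' \<notin> writes C1" using w1 by auto
            fix p s4 assume p: "p < n" "s4 ''p'' [] = p"
              and "\<And>y. y \<notin> insert ''p'' (writes C1) \<Longrightarrow> s4 y = s3 y"
            then have fr4: "\<And>y. y \<notin> {''p'', ''q'', ''z'', ''A''} \<Longrightarrow> s4 y = s3 y"
              using w1 by (auto dest: subsetD)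
            have s4: "prepared s4" using s3 by (rule prepared_cong) (auto simp: fr4)
            have luv4: "s4 ''l'' [] = l" "s4 ''u'' [] = u" "s4 ''v'' [] = v" using lu3 v by (auto simp: fr4)
            have all: "s4 a = s a" if "a \<notin> {''l'', ''u'', ''v'', ''p'', ''q'', ''z'', ''A''}" for a
              using that by (simp add: fr1 fr2 fr3 fr4)
            note st = step[OF l(1) u(1) v(1) uv p(1) luv4 p(2) s4 all]
            show "halts w C1 s4 (115 * M ^ 0) (\<lambda>s''. cells ''A'' s'' = cells ''A'' s4 \<union> G l u v p)"
              unfolding C1_def
            proof (rule halts_Seq[OF st])
              fix s5 assume q: "s5 ''q'' [] = \<sigma> l u v p" and "\<And>a. a \<notin> writes step \<Longrightarrow> s5 a = s4 a"
              then have fr5: "\<And>a. a \<notin> {''q'', ''z''} \<Longrightarrow> s5 a = s4 a" using wr by (auto dest: subsetD)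
              have "s5 ''l'' [] = l" "s5 ''u'' [] = u" "s5 ''v'' [] = v" "s5 ''p'' [] = p"
                "s5 ''E'' = ?e" "s5 ''A'' = s4 ''A''"
                using luv4 p all by (auto simp: fr5)
              moreover have "\<sigma> l u v p \<le> w" "l \<le> w" "u \<le> w" "v \<le> w" "p \<le> w"
                using \<sigma>[OF l(1) uv p(1)] l u v p less_w by auto
              ultimately show "halts w (emit (var ''l'') (var ''u'') (var ''p'') (var ''v'') (var ''q'')) s5 11
                 (\<lambda>s''. cells ''A'' s'' = cells ''A'' s4 \<union> G l u v p)"
                unfolding emit_def using uv q E less_w(5)
                by (intro halts_loop_free) (auto simp: G_def cells_def)
            qed auto
          qed (use reads lu3 l u v less_w bounds keep in auto)
        next
          assume "eval s3 (Get ''D'' [var ''u'', var ''v'']) = 0"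
          then have "(u, v) \<notin> parcs D" using reads lu3 v by (auto split: if_splits)
          then show "halts w Skip s3 (135 * M ^ 1)
              (\<lambda>s'. cells ''A'' s' = cells ''A'' s3 \<union> (\<Union>p\<in>{0..<n}. G l u v p))"
            using bounds by (intro halts_Skip) (auto simp: G_def)
        qed (use reads lu3 u v less_w bounds in auto)
      qed (use prepared_reads[OF s2] less_w bounds keep in \<open>auto simp: eval_nat_numeral\<close>)
    qed (use prepared_reads[OF s1] less_w bounds keep in \<open>auto simp: eval_nat_numeral\<close>)
  qed (use prepared_reads[OF s] less_w bounds keep in \<open>auto simp: eval_nat_numeral\<close>)
  moreover have "(\<Union>u\<in>{0..<t}. \<Union>v\<in>{0..<t}. \<Union>p\<in>{0..<n}. G l u v p)
      = coded ?e l (layered n (parcs D) \<sigma> l)" for l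
  proof -
    have "coded ?e l (layered n (parcs D) \<sigma> l)
        = (\<Union>(u, v)\<in>parcs D. \<Union>p\<in>{0..<n}. {[l, u, ?e [u, p], v, ?e [v, \<sigma> l u v p]]})"
      by (force simp: coded_def layered_def)
    also have "\<dots> = (\<Union>u\<in>{0..<t}. \<Union>v\<in>{0..<t}. \<Union>p\<in>{0..<n}. G l u v p)"
      using arc_D_less by (fastforce simp: G_def split: if_splits)
    finally show ?thesis by simp
  qed
  ultimately show ?thesis unfolding defs by simp
qed

text \<open>
  The relation \<open>spread\<close>, stated without reference to a numbering of the parts.
\<close>

definition spread_on :: "(nat \<Rightarrow> nat) \<Rightarrow> nat \<Rightarrow> (nat \<times> nat) rel" where
  "spread_on k i =
     {((u, p), (v, i)) | u p v. (u, v) \<in> parcs D \<and> k u \<le> p \<and> p < N u} \<union>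
     {((u, i), (v, q)) | u v q. (u, v) \<in> parcs D \<and> k v \<le> q \<and> q < N v}"

lemma halts_emit_spread:
  assumes s: "prepared s" and E: "\<And>v p. s ''E'' [v, p] \<le> w" and K: "\<And>u. u < t \<Longrightarrow> s ''K'' [u] \<le> N u"
  shows "halts w emit_spread s (128 * M ^ 4) (\<lambda>s'. cells ''A'' s' =
    cells ''A'' s \<union> (\<Union>l\<in>{0..<n}. coded (s ''E'') l (spread_on (\<lambda>u. s ''K'' [u]) l)))"
proof -
  let ?e = "s ''E''"
  let ?k = "\<lambda>u. s ''K'' [u]"
  define P1 where "P1 = emit (var ''l'') (var ''u'') (var ''p'') (var ''v'') (var ''l'')"
  define P2 where "P2 = emit (var ''l'') (var ''u'') (var ''l'') (var ''v'') (var ''p'')"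
  define F1 where "F1 = For ''p'' (Get ''K'' [var ''u'']) (order_of (var ''u'')) P1"
  define F2 where "F2 = For ''p'' (Get ''K'' [var ''v'']) (order_of (var ''v'')) P2"
  define C2 where "C2 = Cond (Get ''D'' [var ''u'', var ''v'']) (F1 ;; F2) Skip"
  define C3 where "C3 = For ''v'' (Num 0) (var ''t'') C2"
  define C4 where "C4 = For ''u'' (Num 0) (var ''t'') C3"
  have defs: "emit_spread = For ''l'' (Num 0) (var ''n'') C4"
    by (simp add: emit_spread_def P1_def P2_def F1_def F2_def C2_def C3_def C4_def)
  have wP: "writes P1 = {''A''}" "writes P2 = {''A''}" by (auto simp: P1_def P2_def emit_def)
  then have wF: "writes F1 = {''p'', ''A''}" "writes F2 = {''p'', ''A''}" by (auto simp: F1_def F2_def)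
  then have w2: "writes C2 = {''p'', ''A''}" by (auto simp: C2_def)
  then have w3: "writes C3 = {''v'', ''p'', ''A''}" by (auto simp: C3_def)
  then have w4: "writes C4 = {''u'', ''v'', ''p'', ''A''}" by (auto simp: C4_def)
  define G1 where "G1 l u v = (\<Union>p\<in>{?k u..<N u}. {[l, u, ?e [u, p], v, ?e [v, l]]})" for l u v
  define G2 where "G2 l u v = (\<Union>p\<in>{?k v..<N v}. {[l, u, ?e [u, l], v, ?e [v, p]]})" for l u v
  define G where "G l u v = (if (u, v) \<in> parcs D then G1 l u v \<union> G2 l u v else {})" for l u v
  have inner: "halts w F1 s' (31 * M ^ 1) (\<lambda>s''. cells ''A'' s'' = cells ''A'' s' \<union> G1 l u v) \<and>
      halts w F2 s' (31 * M ^ 1) (\<lambda>s''. cells ''A'' s'' = cells ''A'' s' \<union> G2 l u v)"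
    if s': "prepared s'" "s' ''l'' [] = l" "s' ''u'' [] = u" "s' ''v'' [] = v" "l < n" "u < t" "v < t"
      "s' ''E'' = ?e" "s' ''K'' = s ''K''" for s' l u v
  proof
    note reads = prepared_reads[OF s'(1)]
    have lw: "N u \<le> w" "N v \<le> w" "N u \<le> M" "N v \<le> M" "l \<le> w" "u \<le> w" "v \<le> w" "1 \<le> w" "1 \<le> M"
      using that less_w bounds by auto
    have kw: "?k u \<le> N u" "?k v \<le> N v" "?k u \<le> w" "?k v \<le> w"
      using K[of u] K[of v] that lw by auto
    show "halts w F1 s' (31 * M ^ 1) (\<lambda>s''. cells ''A'' s'' = cells ''A'' s' \<union> G1 l u v)"
      unfolding F1_def G1_def
    proof (rule halts_For_collect[where k = 11 and d = 0 and M = M and b = "N u"])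
      fix p s4 assume p: "p < N u" "s4 ''p'' [] = p"
        and fr4: "\<And>y. y \<notin> insert ''p'' (writes P1) \<Longrightarrow> s4 y = s' y"
      have "s4 ''l'' [] = l" "s4 ''u'' [] = u" "s4 ''v'' [] = v" "s4 ''E'' = ?e" "p \<le> w"
        using s' p lw by (auto simp: fr4 wP)
      then show "halts w P1 s4 (11 * M ^ 0) (\<lambda>s''. cells ''A'' s'' = cells ''A'' s4 \<union> {[l, u, ?e [u, p], v, ?e [v, l]]})"
        unfolding P1_def emit_def using p E lw
        by (intro halts_loop_free) (auto simp: cells_def)
    qed (use reads s' lw kw in \<open>auto simp: wP\<close>)
    show "halts w F2 s' (31 * M ^ 1) (\<lambda>s''. cells ''A'' s'' = cells ''A'' s' \<union> G2 l u v)"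
      unfolding F2_def G2_def
    proof (rule halts_For_collect[where k = 11 and d = 0 and M = M and b = "N v"])
      fix p s4 assume p: "p < N v" "s4 ''p'' [] = p"
        and fr4: "\<And>y. y \<notin> insert ''p'' (writes P2) \<Longrightarrow> s4 y = s' y"
      have "s4 ''l'' [] = l" "s4 ''u'' [] = u" "s4 ''v'' [] = v" "s4 ''E'' = ?e" "p \<le> w"
        using s' p lw by (auto simp: fr4 wP)
      then show "halts w P2 s4 (11 * M ^ 0) (\<lambda>s''. cells ''A'' s'' = cells ''A'' s4 \<union> {[l, u, ?e [u, l], v, ?e [v, p]]})"
        unfolding P2_def emit_def using p E lw
        by (intro halts_loop_free) (auto simp: cells_def)
    qed (use reads s' lw kw in \<open>auto simp: wP\<close>)
  qed
  have "halts w (For ''l'' (Num 0) (var ''n'') C4) s (128 * M ^ 4) (\<lambda>s'. cells ''A'' s' =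
    cells ''A'' s \<union> (\<Union>l\<in>{0..<n}. \<Union>u\<in>{0..<t}. \<Union>v\<in>{0..<t}. G l u v))"
  proof (rule halts_For_collect[where k = 108 and d = 3 and M = M and b = n])
    fix l s1 assume l: "l < n" "s1 ''l'' [] = l"
      and fr1: "\<And>y. y \<notin> insert ''l'' (writes C4) \<Longrightarrow> s1 y = s y"
    have s1: "prepared s1" using s by (rule prepared_cong) (auto simp: fr1 w4)
    show "halts w C4 s1 (108 * M ^ 3) (\<lambda>s'. cells ''A'' s' =
      cells ''A'' s1 \<union> (\<Union>u\<in>{0..<t}. \<Union>v\<in>{0..<t}. G l u v))"
      unfolding C4_def
    proof (rule halts_For_collect[where k = 88 and d = 2 and M = M and b = t])
      fix u s2 assume u: "u < t" "s2 ''u'' [] = u"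
        and fr2: "\<And>y. y \<notin> insert ''u'' (writes C3) \<Longrightarrow> s2 y = s1 y"
      have s2: "prepared s2" using s1 by (rule prepared_cong) (auto simp: fr2 w3)
      show "halts w C3 s2 (88 * M ^ 2) (\<lambda>s'. cells ''A'' s' = cells ''A'' s2 \<union> (\<Union>v\<in>{0..<t}. G l u v))"
        unfolding C3_def
      proof (rule halts_For_collect[where k = 68 and d = 1 and M = M and b = t])
        fix v s3 assume v: "v < t" "s3 ''v'' [] = v"
          and fr3: "\<And>y. y \<notin> insert ''v'' (writes C2) \<Longrightarrow> s3 y = s2 y"
        have s3: "prepared s3" using s2 by (rule prepared_cong) (auto simp: fr3 w2)
        have lu3: "s3 ''l'' [] = l" "s3 ''u'' [] = u" "s3 ''E'' = ?e" "s3 ''K'' = s ''K''"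
          using l u by (auto simp: fr3 fr2 fr1 w2 w3 w4)
        note reads = prepared_reads[OF s3]
        show "halts w C2 s3 (68 * M ^ 1) (\<lambda>s'. cells ''A'' s' = cells ''A'' s3 \<union> G l u v)"
          unfolding C2_def
        proof (rule halts_Cond[where ?B1.0 = "63 * M ^ 1"])
          assume "eval s3 (Get ''D'' [var ''u'', var ''v'']) \<noteq> 0"
          then have uv: "(u, v) \<in> parcs D" using reads lu3 v by (auto split: if_splits)
          show "halts w (F1 ;; F2) s3 (63 * M ^ 1) (\<lambda>s'. cells ''A'' s' = cells ''A'' s3 \<union> G l u v)"
          proof (rule halts_Seq[OF conjunct1[OF inner[OF s3 lu3(1,2) v(2) l(1) u(1) v(1) lu3(3,4)]]])
            fix s4 assume c4: "cells ''A'' s4 = cells ''A'' s3 \<union> G1 l u v"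
              and fr4: "\<And>a. a \<notin> writes F1 \<Longrightarrow> s4 a = s3 a"
            have s4: "prepared s4" using s3 by (rule prepared_cong) (auto simp: fr4 wF)
            have "s4 ''l'' [] = l" "s4 ''u'' [] = u" "s4 ''v'' [] = v" "s4 ''E'' = ?e" "s4 ''K'' = s ''K''"
              using lu3 v by (auto simp: fr4 wF)
            from conjunct2[OF inner[OF s4 this(1-3) l(1) u(1) v(1) this(4,5)]]
            show "halts w F2 s4 (31 * M ^ 1) (\<lambda>s'. cells ''A'' s' = cells ''A'' s3 \<union> G l u v)"
              by (rule halts_mono) (auto simp: c4 G_def uv)
          qed (use bounds in auto)
        next
          assume "eval s3 (Get ''D'' [var ''u'', var ''v'']) = 0"
          then have "(u, v) \<notin> parcs D" using reads lu3 v by (auto split: if_splits)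
          then show "halts w Skip s3 (63 * M ^ 1) (\<lambda>s'. cells ''A'' s' = cells ''A'' s3 \<union> G l u v)"
            using bounds by (intro halts_Skip) (auto simp: G_def)
        qed (use reads lu3 u v less_w bounds in auto)
      qed (use prepared_reads[OF s2] less_w bounds in \<open>auto simp: eval_nat_numeral w2\<close>)
    qed (use prepared_reads[OF s1] less_w bounds in \<open>auto simp: eval_nat_numeral w3\<close>)
  qed (use prepared_reads[OF s] less_w bounds in \<open>auto simp: eval_nat_numeral w4\<close>)
  moreover have "(\<Union>u\<in>{0..<t}. \<Union>v\<in>{0..<t}. G l u v) = coded ?e l (spread_on ?k l)" for l
  proof -
    have "coded ?e l (spread_on ?k l) = (\<Union>(u, v)\<in>parcs D. G1 l u v \<union> G2 l u v)"
      unfolding spread_on_def coded_def image_Un G1_def G2_def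
      by (force simp: image_iff)
    also have "\<dots> = (\<Union>u\<in>{0..<t}. \<Union>v\<in>{0..<t}. G l u v)"
      using arc_D_less by (fastforce simp: G_def split: if_splits)
    finally show ?thesis by simp
  qed
  ultimately show ?thesis unfolding defs by simp
qed

end

section \<open>Colour steps and patterns\<close>

context nonempty_packing_instance
begin

lemma halts_step_on_walk:
  assumes s: "prepared s" "s ''l'' [] = l" "s ''u'' [] = u" "s ''v'' [] = v" "s ''p'' [] = p"
    and less: "l < n" "u < t" "v < t" "p < n"
    and W: "s ''w0'' [] = a" "s ''w1'' [] = b" "s ''w2'' [] = c" "s ''w3'' [] = d"
      "a < t" "b < t" "c < t" "d < t"
  shows "halts w step_on_walk s 100 (\<lambda>s'. s' ''q'' [] = walk_step n a b c d l u v p)"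
proof (rule halts_loop_free)
  have mod: "x mod n \<le> w" for x using mod_less_divisor[OF n_pos, of x] less_w(2) by linarith
  have sub: "x \<le> w \<Longrightarrow> x - y \<le> w" "x + z \<le> w \<Longrightarrow> x + (z - y) \<le> w" for x y z by linarith+
  have small: "p + (n + 1) \<le> w" "n + 1 \<le> w" "n \<le> w" "p + n \<le> w" "p + l \<le> w" "1 \<le> w"
    "l \<le> w" "u \<le> w" "v \<le> w" "p \<le> w" "a \<le> w" "b \<le> w" "c \<le> w" "d \<le> w"
    using less W bounds(2-) by linarith+
  note facts = s(2-5) prepared_reads(1)[OF s(1)] W(1-4) small mod sub
  consider "u = d \<and> v = a" | "\<not> (u = d \<and> v = a)" "u = b \<and> v = c"
    | "\<not> (u = d \<and> v = a)" "\<not> (u = b \<and> v = c)" by metis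
  note region = this
  show "safe w step_on_walk s"
    by (rule region; use facts in \<open>simp add: step_on_walk_def of_bool_conj[symmetric] del: of_bool_conj\<close>)
  show "exec step_on_walk s ''q'' [] = walk_step n a b c d l u v p"
    by (rule region; use facts in \<open>auto simp add: step_on_walk_def walk_step_def walk_shift_def
        of_bool_conj[symmetric] del: of_bool_conj\<close>)
qed (simp add: step_on_walk_def)

text \<open>
  The remainders and the comparison are replaced by variables \<open>r\<close>, \<open>k\<close>, \<open>h\<close> of small range, which keeps
  the arithmetic in the case distinctions linear.
\<close>

lemma shift_codes:
  assumes s: "s ''n'' [] = n" "s ''l'' [] = l" "s ''p'' [] = p" and w: "4 \<le> w" "2 * n + 2 \<le> w" "2 * l \<le> w" "l + 1 \<le> w" "p \<le> w"
  shows "safe w twist_code s \<and> exec twist_code s = set_var ''q'' (twist n l p) s"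
    and "safe w middle_shift_code s \<and> exec middle_shift_code s = set_var ''z'' (middle_shift n l) s"
    and "safe w last_shift_code s \<and> exec last_shift_code s = set_var ''z'' (last_shift n l) s"
proof -
  define r where "r = n mod 4"
  define k where "k = l mod 2"
  define h where "h = (if 2 * l < n then 1 else 0 :: nat)"
  have rk: "n mod 4 = r" "l mod 2 = k" "even l \<longleftrightarrow> k = 0" "n \<le> 2 * l \<longleftrightarrow> h = 0"
    "of_bool (2 * l < n) = h" "2 * l < n \<longleftrightarrow> h = 1"
    by (auto simp: r_def k_def h_def even_iff_mod_2_eq_zero)
  have bounds: "r \<le> 3" "k \<le> 1" "h \<le> 1" by (auto simp: r_def k_def h_def)
  have k: "k = 0 \<or> k = 1" and h: "h = 0 \<or> h = 1" using bounds by linarith+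
  have nw: "n \<le> w" "l \<le> w" "2 * n \<le> w" "r \<le> w" "2 * n - 2 - 2 * l \<le> w" "2 * n + 1 - 2 * l \<le> w"
     "2 * n + 2 - 2 * l \<le> w" "2 * n - 2 \<le> w" "l - 1 \<le> w"
    using w bounds by linarith+
  show "safe w twist_code s \<and> exec twist_code s = set_var ''q'' (twist n l p) s"
    using k s w(1,5) nw(1,2,4) by (auto simp: twist_code_def twist_def rk set_var_def)
  show "safe w middle_shift_code s \<and> exec middle_shift_code s = set_var ''z'' (middle_shift n l) s"
    using k h s w(1,3,4) nw(1,2,4,9) by (auto simp: middle_shift_code_def middle_shift_def rk set_var_def)
  show "safe w last_shift_code s \<and> exec last_shift_code s = set_var ''z'' (last_shift n l) s"
    using k h s w(1,2,3) nw
    by (elim disjE) (auto simp: last_shift_code_def last_shift_def rk set_var_def)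
qed

lemma halts_step_on_triangle:
  assumes s: "prepared s" "s ''l'' [] = l" "s ''u'' [] = u" "s ''v'' [] = v" "s ''p'' [] = p"
    and less: "l < n" "u < t" "v < t" "p < n"
    and W: "s ''a'' [] = a" "s ''b'' [] = b" "a < t" "b < t"
  shows "halts w step_on_triangle s 100 (\<lambda>s'. s' ''q'' [] = triangle_step n a b l u v p)"
proof (rule halts_loop_free)
  have n: "s ''n'' [] = n" using prepared_reads(1)[OF s(1)] .
  have small: "4 \<le> w" "2 * n + 2 \<le> w" "2 * l \<le> w" "l + 1 \<le> w" "p \<le> w"
    using less bounds(2-) by linarith+
  have vars: "u \<le> w" "a \<le> w" "b \<le> w" "l \<le> w" "n \<le> w" "p + l \<le> w" "1 \<le> w"
    using less W bounds(2-) by linarith+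
  have mod: "x mod n \<le> w" for x using mod_less_divisor[OF n_pos, of x] less_w(2) by linarith
  have "twist n l p \<le> p + 2" by (auto simp: twist_def)
  moreover have "middle_shift n l \<le> l + 1" "last_shift n l \<le> 2 * n + 2"
    by (auto simp: middle_shift_def last_shift_def)
  ultimately have sums: "twist n l p + middle_shift n l \<le> w" "p + last_shift n l \<le> w"
    using less bounds(2-) by linarith+
  then have parts: "twist n l p \<le> w" "middle_shift n l \<le> w" "last_shift n l \<le> w" by linarith+
  have codes: "safe w middle_shift_code (set_var ''q'' y s)" "safe w last_shift_code (set_var ''q'' y s)"
    "exec middle_shift_code (set_var ''q'' y s) = set_var ''z'' (middle_shift n l) (set_var ''q'' y s)"
    "exec last_shift_code (set_var ''q'' y s) = set_var ''z'' (last_shift n l) (set_var ''q'' y s)"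
    "safe w twist_code s" "exec twist_code s = set_var ''q'' (twist n l p) s" for y
    using shift_codes[of "set_var ''q'' y s" l p] shift_codes(1)[of s l p] n s small by simp_all
  consider "u = a" | "u \<noteq> a" "u = b" | "u \<noteq> a" "u \<noteq> b" by metis
  then have "safe w step_on_triangle s \<and> exec step_on_triangle s ''q'' [] = triangle_step n a b l u v p"
  proof cases
    case 1
    then show ?thesis
      using s n W vars small mod
      by (simp add: step_on_triangle_def triangle_step_def)
  next
    case 2
    show ?thesis
      unfolding step_on_triangle_def exec.simps(3,4) safe.simps(3,4)
      using s n W vars small mod 2 codes sums parts
      by (simp add: triangle_step_def)
  next
    case 3
    have z: "exec (''q'' ::= var ''p'') s = set_var ''q'' p s" using s by (simp add: set_var_def)
    show ?thesis
      unfolding step_on_triangle_def exec.simps(3,4) safe.simps(3,4) z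
      using s n W vars small mod 3 codes sums parts
      by (simp add: triangle_step_def)
  qed
  then show "safe w step_on_triangle s" "exec step_on_triangle s ''q'' [] = triangle_step n a b l u v p"
    by simp_all
qed (simp add: step_on_triangle_def twist_code_def middle_shift_code_def last_shift_code_def)

end

lemma patterns_small:
  "list_all (\<lambda>pat. list_all (\<lambda>k. k \<le> 4) [fst pat ! 0, fst pat ! 1, fst pat ! 2] \<and>
     list_all (\<lambda>(j, p, q). p \<le> 4 \<and> q \<le> 4) (inner_arcs pat) \<and>
     list_all (\<lambda>(j, p). p \<le> 4) (fst (snd pat) @ snd (snd pat))) patterns"
  by code_simp

lemma eval_foldr_both:
  "eval s (foldr both es (Num 1)) \<noteq> 0 \<longleftrightarrow> (\<forall>e\<in>set es. eval s e \<noteq> 0)"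
  by (induction es) auto

lemma fits_foldr_both:
  assumes "1 \<le> w" "\<And>e. e \<in> set es \<Longrightarrow> fits w s e \<and> eval s e \<le> 1"
  shows "fits w s (foldr both es (Num 1)) \<and> eval s (foldr both es (Num 1)) \<le> 1"
  using assms(2)
proof (induction es)
  case (Cons e es)
  then have IH: "fits w s (foldr both es (Num 1))" "eval s (foldr both es (Num 1)) \<le> 1"
    and e: "fits w s e" "eval s e \<le> 1" by auto
  have "eval s e * eval s (foldr both es (Num 1)) \<le> 1 * 1" using IH e by (intro mult_le_mono)
  then show ?case using IH e assms(1) by simp
qed (use assms(1) in simp)

context nonempty_packing_instance
begin

context
  fixes a b c :: nat and e :: "nat list \<Rightarrow> nat"
  assumes abc: "a < t" "b < t" "c < t" and e: "\<And>v p. e [v, p] \<le> w"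
begin

definition cornered :: "state \<Rightarrow> bool" where
  "cornered s \<longleftrightarrow> prepared s \<and> s ''E'' = e \<and> s ''a'' [] = a \<and> s ''b'' [] = b \<and> s ''c'' [] = c"

lemma eval_corner_var: "cornered s \<Longrightarrow> eval s (corner_var j) = corner a b c j"
  by (simp add: cornered_def corner_var_def corner_def)

lemma corner_less: "corner a b c j < t"
  using abc by (simp add: corner_def)

lemma fits_corner_var: "cornered s \<Longrightarrow> fits w s (corner_var j)"
  using eval_corner_var[of s j] corner_less[of j] less_w(3) by (simp add: corner_var_def)

lemma pattern_test_decides_fit:
  assumes s: "cornered s" and pat: "pat \<in> set patterns"
  shows "fits w s (pattern_test pat)"
    and "eval s (pattern_test pat) \<noteq> 0 \<longleftrightarrow> (\<forall>j<3. fst pat ! j \<le> N (corner a b c j)) \<and>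
      (\<forall>(j, p, q)\<in>set (inner_arcs pat).
         (e [corner a b c j, p], e [corner a b c j, q]) \<in> parcs (H (corner a b c j)))"
proof -
  note reads = prepared_reads[of s]
  have p: "prepared s" and E: "s ''E'' = e" using s by (auto simp: cornered_def)
  have small: "fst pat ! j \<le> 4" if "j \<in> {0, 1, 2}" for j
    using patterns_small pat that by (auto simp: list_all_iff)
  have small': "x \<le> 4 \<and> y \<le> 4" if "(j, x, y) \<in> set (inner_arcs pat)" for j x y
    using patterns_small pat that by (auto simp: list_all_iff)
  have w4: "4 \<le> w" using bounds by linarith
  let ?sizes = "map (\<lambda>j. negate (Bin Less (order_of (corner_var j)) (Num (fst pat ! j)))) [0, 1, 2]"
  let ?arcs = "map (\<lambda>(j, p, q). Get ''H'' [corner_var j, Get ''E'' [corner_var j, Num p],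
         Get ''E'' [corner_var j, Num q]]) (inner_arcs pat)"
  have size: "fits w s x \<and> eval s x \<le> 1" if "x \<in> set ?sizes" for x
  proof -
    from that obtain j where "j \<in> set [0, 1, 2]"
      and "x = negate (Bin Less (order_of (corner_var j)) (Num (fst pat ! j)))"
      unfolding set_map by (elim imageE)
    then show ?thesis
      using small[of j] w4 reads(3)[OF p corner_less, of j] eval_corner_var[OF s] fits_corner_var[OF s]
        less_w(1)[OF corner_less, of j]
      by simp
  qed
  have arc: "fits w s x \<and> eval s x \<le> 1" if "x \<in> set ?arcs" for x
  proof -
    from that obtain y where y: "y \<in> set (inner_arcs pat)"
      and xy: "x = (\<lambda>(j, p, q). Get ''H'' [corner_var j, Get ''E'' [corner_var j, Num p],
         Get ''E'' [corner_var j, Num q]]) y"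
      unfolding set_map by (elim imageE)
    obtain j k l where "y = (j, k, l)" by (cases y)
    with y xy have jkl: "(j, k, l) \<in> set (inner_arcs pat)"
      and x: "x = Get ''H'' [corner_var j, Get ''E'' [corner_var j, Num k], Get ''E'' [corner_var j, Num l]]"
      by simp_all
    show ?thesis
      using small'[OF jkl] w4 reads(5)[OF p corner_less] eval_corner_var[OF s] fits_corner_var[OF s] e
      by (simp add: x E)
  qed
  have "fits w s y \<and> eval s y \<le> 1" if "y \<in> set (?sizes @ ?arcs)" for y
    using that size[of y] arc[of y] unfolding set_append by blast
  from fits_foldr_both[OF less_w(5) this]
  show "fits w s (pattern_test pat)" unfolding pattern_test_def by blast
  have less3: "(\<forall>j<3. P j) \<longleftrightarrow> (\<forall>j\<in>set [0, 1, 2]. P j)" for P :: "nat \<Rightarrow> bool"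
  proof -
    have "j < 3 \<longleftrightarrow> j = 0 \<or> j = 1 \<or> j = 2" for j :: nat by auto
    then show ?thesis by auto
  qed
  have sizes: "(\<forall>x\<in>set ?sizes. eval s x \<noteq> 0) \<longleftrightarrow> (\<forall>j<3. fst pat ! j \<le> N (corner a b c j))"
    unfolding less3 set_map ball_simps(9)
    using reads(3)[OF p corner_less] eval_corner_var[OF s] by (simp add: not_less)
  have arcs: "(\<forall>x\<in>set ?arcs. eval s x \<noteq> 0) \<longleftrightarrow> (\<forall>(j, p, q)\<in>set (inner_arcs pat).
         (e [corner a b c j, p], e [corner a b c j, q]) \<in> parcs (H (corner a b c j)))"
    unfolding set_map ball_simps(9)
    using reads(5)[OF p corner_less] eval_corner_var[OF s] by (simp add: E case_prod_beta)
  show "eval s (pattern_test pat) \<noteq> 0 \<longleftrightarrow> (\<forall>j<3. fst pat ! j \<le> N (corner a b c j)) \<and>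
      (\<forall>(j, p, q)\<in>set (inner_arcs pat).
         (e [corner a b c j, p], e [corner a b c j, q]) \<in> parcs (H (corner a b c j)))"
    unfolding pattern_test_def eval_foldr_both set_append ball_Un sizes arcs ..
qed

lemma exec_emit_arcs:
  assumes "cornered s" "l \<le> 4" "\<And>j p j' q. ((j, p), (j', q)) \<in> set es \<Longrightarrow> p \<le> 4 \<and> q \<le> 4"
  shows "safe w (emit_arcs l es) s \<and> cornered (exec (emit_arcs l es) s) \<and>
    exec (emit_arcs l es) s ''K'' = s ''K'' \<and>
    cells ''A'' (exec (emit_arcs l es) s) = cells ''A'' s \<union>
      coded e l (map_prod (map_prod (corner a b c) id) (map_prod (corner a b c) id) ` set es)"
  using assms(1,3)
proof (induction es arbitrary: s)
  case Nil
  then show ?case by (simp add: emit_arcs_def coded_def)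
next
  case (Cons x es)
  obtain j p j' q where x: "x = ((j, p), (j', q))" by (metis surj_pair)
  let ?c = "emit (Num l) (corner_var j) (Num p) (corner_var j') (Num q)"
  let ?s = "exec ?c s"
  have pq: "p \<le> 4" "q \<le> 4" using Cons.prems(2)[of j p j' q] by (auto simp: x)
  have E: "s ''E'' = e" and pr: "prepared s" using Cons.prems(1) by (auto simp: cornered_def)
  have w4: "4 \<le> w" "1 \<le> w" using bounds by linarith+
  have safe: "safe w ?c s"
    using fits_corner_var[OF Cons.prems(1)] eval_corner_var[OF Cons.prems(1)] pq assms(2) w4 e
    by (auto simp: emit_def E)
  have cor: "cornered ?s"
  proof -
    have "prepared ?s" using pr by (rule prepared_cong) (auto simp: emit_def)
    then show ?thesis using Cons.prems(1) by (simp add: cornered_def emit_def)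
  qed
  have K: "?s ''K'' = s ''K''" by (simp add: emit_def)
  have cells: "cells ''A'' ?s = cells ''A'' s \<union> {[l, corner a b c j, e [corner a b c j, p], corner a b c j', e [corner a b c j', q]]}"
    using eval_corner_var[OF Cons.prems(1)] by (auto simp: cells_def emit_def E)
  have IH: "safe w (emit_arcs l es) ?s \<and> cornered (exec (emit_arcs l es) ?s) \<and>
    exec (emit_arcs l es) ?s ''K'' = ?s ''K'' \<and>
    cells ''A'' (exec (emit_arcs l es) ?s) = cells ''A'' ?s \<union>
      coded e l (map_prod (map_prod (corner a b c) id) (map_prod (corner a b c) id) ` set es)"
    using Cons.prems(2) by (intro Cons.IH[OF cor]) auto
  have unfold: "emit_arcs l (x # es) = ?c ;; emit_arcs l es" by (simp add: emit_arcs_def x)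
  have "coded e l (map_prod (map_prod (corner a b c) id) (map_prod (corner a b c) id) ` set (x # es)) =
      {[l, corner a b c j, e [corner a b c j, p], corner a b c j', e [corner a b c j', q]]} \<union>
      coded e l (map_prod (map_prod (corner a b c) id) (map_prod (corner a b c) id) ` set es)"
    by (simp add: coded_def x)
  then show ?case unfolding unfold exec.simps safe.simps using safe IH K cells by (simp only: Un_assoc simp_thms)
qed

lemma exec_emit_pattern:
  assumes s: "cornered s" and pat: "pat \<in> set patterns" and neq: "a \<noteq> b" "b \<noteq> c" "c \<noteq> a"
  defines "s' \<equiv> exec (emit_pattern pat) s"
  shows "safe w (emit_pattern pat) s"
    and "s' ''K'' [a] = fst pat ! 0" "s' ''K'' [b] = fst pat ! 1" "s' ''K'' [c] = fst pat ! 2"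
    and "cells ''A'' s' = cells ''A'' s \<union>
      coded e 0 (map_prod (map_prod (corner a b c) id) (map_prod (corner a b c) id) ` walk_arcs (fst (snd pat))) \<union>
      coded e 1 (map_prod (map_prod (corner a b c) id) (map_prod (corner a b c) id) ` walk_arcs (snd (snd pat)))"
    and "s' ''E'' = e"
proof -
  obtain ks v v' where p: "pat = (ks, v, v')" by (cases pat)
  have small: "ks ! 0 \<le> 4" "ks ! 1 \<le> 4" "ks ! 2 \<le> 4"
    and all: "list_all (\<lambda>(j, p). p \<le> 4) v" "list_all (\<lambda>(j, p). p \<le> 4) v'"
    using patterns_small[unfolded list_all_iff[of _ patterns]] pat by (auto simp: p)
  have sv: "x \<le> 4" if "(j, x) \<in> set v" for j x using all(1) that unfolding list_all_iff by fast
  have sv': "x \<le> 4" if "(j, x) \<in> set v'" for j x using all(2) that unfolding list_all_iff by fast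
  have sz: "x \<le> 4 \<and> y \<le> 4" if "((j, x), (j', y)) \<in> set (zip v (tl v))" for j x j' y
    using set_zip_leftD[OF that] set_zip_rightD[OF that] sv list.set_sel(2)[of v "(j', y)"]
    by (cases "v = []") auto
  have sz': "x \<le> 4 \<and> y \<le> 4" if "((j, x), (j', y)) \<in> set (zip v' (tl v'))" for j x j' y
    using set_zip_leftD[OF that] set_zip_rightD[OF that] sv' list.set_sel(2)[of v' "(j', y)"]
    by (cases "v' = []") auto
  define kc where "kc = Put ''K'' [corner_var 0] (Num (ks ! 0)) ;; Put ''K'' [corner_var 1] (Num (ks ! 1)) ;;
     Put ''K'' [corner_var 2] (Num (ks ! 2))"
  let ?s1 = "exec kc s"
  have s': "s' = exec (emit_arcs 1 (zip v' (tl v'))) (exec (emit_arcs 0 (zip v (tl v))) ?s1)"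
    by (simp add: s'_def emit_pattern_def p kc_def)
  have w4: "4 \<le> w" "1 \<le> w" using bounds by linarith+
  have vars: "s ''a'' [] = a" "s ''b'' [] = b" "s ''c'' [] = c" "prepared s" "s ''E'' = e"
    using s by (auto simp: cornered_def)
  have abw: "a \<le> w" "b \<le> w" "c \<le> w" using abc less_w(3) by linarith+
  have cv: "corner_var 0 = var ''a''" "corner_var 1 = var ''b''" "corner_var 2 = var ''c''"
    "corner_var (Suc 0) = var ''b''"
    by (simp_all add: corner_var_def corner_def)
  have safe1: "safe w kc s" using small w4 vars abw by (auto simp: kc_def cv)
  have K1: "?s1 ''K'' [a] = ks ! 0" "?s1 ''K'' [b] = ks ! 1" "?s1 ''K'' [c] = ks ! 2"
    using vars neq by (auto simp: kc_def cv)
  have s1: "cornered ?s1"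
  proof -
    have "prepared ?s1" using vars(4) by (rule prepared_cong) (auto simp: kc_def)
    then show ?thesis using vars by (simp add: cornered_def kc_def)
  qed
  have A1: "cells ''A'' ?s1 = cells ''A'' s" by (simp add: kc_def cells_def)
  have r1: "safe w (emit_arcs 0 (zip v (tl v))) ?s1 \<and> cornered (exec (emit_arcs 0 (zip v (tl v))) ?s1) \<and>
    exec (emit_arcs 0 (zip v (tl v))) ?s1 ''K'' = ?s1 ''K'' \<and>
    cells ''A'' (exec (emit_arcs 0 (zip v (tl v))) ?s1) = cells ''A'' ?s1 \<union>
      coded e 0 (map_prod (map_prod (corner a b c) id) (map_prod (corner a b c) id) ` set (zip v (tl v)))"
    using sz by (intro exec_emit_arcs[OF s1]) auto
  let ?s2 = "exec (emit_arcs 0 (zip v (tl v))) ?s1"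
  have r2: "safe w (emit_arcs 1 (zip v' (tl v'))) ?s2 \<and> cornered (exec (emit_arcs 1 (zip v' (tl v'))) ?s2) \<and>
    exec (emit_arcs 1 (zip v' (tl v'))) ?s2 ''K'' = ?s2 ''K'' \<and>
    cells ''A'' (exec (emit_arcs 1 (zip v' (tl v'))) ?s2) = cells ''A'' ?s2 \<union>
      coded e 1 (map_prod (map_prod (corner a b c) id) (map_prod (corner a b c) id) ` set (zip v' (tl v')))"
    using sz' r1 by (intro exec_emit_arcs) auto
  show "safe w (emit_pattern pat) s"
    using safe1 r1 r2 by (simp add: emit_pattern_def p kc_def)
  show "s' ''K'' [a] = fst pat ! 0" "s' ''K'' [b] = fst pat ! 1" "s' ''K'' [c] = fst pat ! 2"
    using r1 r2 K1 by (simp_all add: s' p)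
  show "cells ''A'' s' = cells ''A'' s \<union>
      coded e 0 (map_prod (map_prod (corner a b c) id) (map_prod (corner a b c) id) ` walk_arcs (fst (snd pat))) \<union>
      coded e 1 (map_prod (map_prod (corner a b c) id) (map_prod (corner a b c) id) ` walk_arcs (snd (snd pat)))"
    using r1 r2 A1 by (simp add: s' p walk_arcs_def)
  show "s' ''E'' = e" using r2 by (simp add: s' cornered_def)
qed

lemma exec_try_patterns:
  assumes s: "cornered s" and ps: "set ps \<subseteq> set patterns" and neq: "a \<noteq> b" "b \<noteq> c" "c \<noteq> a"
    and some: "\<exists>pat\<in>set ps. eval s (pattern_test pat) \<noteq> 0"
  shows "\<exists>pat\<in>set ps. eval s (pattern_test pat) \<noteq> 0 \<and> safe w (try_patterns ps) s \<and>
    exec (try_patterns ps) s = exec (emit_pattern pat) s"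
  using ps some
proof (induction ps)
  case (Cons pat ps)
  have pat: "pat \<in> set patterns" using Cons.prems by simp
  have unfold: "try_patterns (pat # ps) = Cond (pattern_test pat) (emit_pattern pat) (try_patterns ps)"
    by (simp add: try_patterns_def)
  show ?case
  proof (cases "eval s (pattern_test pat) = 0")
    case True
    then obtain pat' where "pat' \<in> set ps" "eval s (pattern_test pat') \<noteq> 0" "safe w (try_patterns ps) s"
      "exec (try_patterns ps) s = exec (emit_pattern pat') s"
      using Cons by auto
    then show ?thesis unfolding unfold using True pattern_test_decides_fit(1)[OF s pat] by auto
  next
    case False
    then show ?thesis
      unfolding unfold using pattern_test_decides_fit(1)[OF s pat] exec_emit_pattern(1)[OF s pat neq] by auto
  qed
qed simp

end

end

section \<open>The whole program\<close>

lemma directed_triangle_on_012: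
  assumes T: "directed_triangle D x y z" and V: "pverts D = {..<t}"
  defines "d \<equiv> (of_bool ((0, 1) \<in> parcs D) :: nat)"
  shows "directed_triangle D 0 (2 - d) (1 + d)" and "t = 3"
proof -
  have xyz: "pverts D = {x, y, z}" using T by (simp add: directed_triangle_def)
  then have "x \<in> {..<t}" using V by blast
  then have "0 \<in> pverts D" unfolding V by simp
  then have "0 = x \<or> 0 = y \<or> 0 = z" unfolding xyz by simp
  then have "\<exists>y z. directed_triangle D 0 y z"
  proof (elim disjE)
    assume "0 = x"
    with T show ?thesis by (intro exI[of _ y] exI[of _ z]) simp
  next
    assume "0 = y"
    with directed_triangle_rotate[OF T] show ?thesis by (intro exI[of _ z] exI[of _ x]) simp
  next
    assume "0 = z"
    with directed_triangle_rotate[OF directed_triangle_rotate[OF T]]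
    show ?thesis by (intro exI[of _ x] exI[of _ y]) simp
  qed
  then obtain y z where T: "directed_triangle D 0 y z" by blast
  then have neq: "0 \<noteq> y" "y \<noteq> z" "z \<noteq> 0"
    and A: "parcs D = {(0, y), (y, z), (z, 0)}" and V0: "pverts D = {0, y, z}"
    unfolding directed_triangle_def by blast+
  have V': "{..<t} = {0, y, z}" using V0 unfolding V .
  have "card {..<t} = 3" unfolding V' using neq by simp
  then show t: "t = 3" by simp
  have "y \<in> {..<t}" "z \<in> {..<t}" unfolding V' by simp_all
  then have "y < 3" "z < 3" unfolding t by simp_all
  then have "y = 1 \<and> z = 2 \<or> y = 2 \<and> z = 1" using neq by auto
  then show "directed_triangle D 0 (2 - d) (1 + d)"
  proof (elim disjE conjE)
    assume yz: "y = 1" "z = 2"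
    then have "d = 1" unfolding d_def A by simp
    then show ?thesis using T yz by (simp add: numeral_2_eq_2)
  next
    assume yz: "y = 2" "z = 1"
    then have "d = 0" unfolding d_def A by simp
    then show ?thesis using T yz by simp
  qed
qed

context nonempty_packing_instance
begin

text \<open>
  The time for trying the patterns is a constant of the program and enters the bound by its name.
\<close>

lemma halts_core_phase:
  assumes s: "prepared s" and E: "\<And>v p. s ''E'' [v, p] \<le> w"
    and arr: "\<And>u. u < t \<Longrightarrow> arranged (H u) (\<lambda>p. s ''E'' [u, p])"
    and K: "\<And>u. u < t \<Longrightarrow> s ''K'' [u] = n" and A: "cells ''A'' s = {}"
    and f: "(s ''f'' [] = 0 \<and> (\<nexists>a b c d. closed_4_walk (parcs D) a b c d)) \<or>
     (s ''f'' [] = 1 \<and> closed_4_walk (parcs D) (s ''w0'' []) (s ''w1'' []) (s ''w2'' []) (s ''w3'' []))"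
  shows "halts w core_phase s ((250 + worst_cost (try_patterns patterns)) * M ^ 4) (\<lambda>s'. s' ''E'' = s ''E'' \<and>
     (\<exists>R. numbered_composition.core_packing D H (\<lambda>u p. s ''E'' [u, p]) n (\<lambda>u. s' ''K'' [u]) R \<and>
        cells ''A'' s' = (\<Union>l\<in>{0..<n}. coded (s ''E'') l (R l))))"
    (is "halts w _ s _ ?Q")
proof -
  interpret C: numbered_composition D H "\<lambda>u p. s ''E'' [u, p]" n
    using numbered_compositionI[OF hyp, of "\<lambda>u p. s ''E'' [u, p]"] n_pos arr
    by (simp add: n_def pverts_D)
  have w1: "writes step_on_walk = {''q'', ''z''}" by (auto simp: step_on_walk_def)
  have w2: "writes step_on_triangle = {''q'', ''z''}"
    by (auto simp: step_on_triangle_def twist_code_def middle_shift_code_def last_shift_code_def)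
  have we: "''E'' \<notin> writes (emit_layers step)" "''K'' \<notin> writes (emit_layers step)"
    if "writes step = {''q'', ''z''}" for step
    using that by (auto simp: emit_layers_def emit_def)
  have pos: "1 \<le> M ^ 4" using bounds by simp
  have K': "u \<in> C.V \<Longrightarrow> s ''K'' [u] = n" for u using K by (simp add: pverts_D)
  show ?thesis
    unfolding core_phase_def
  proof (rule halts_Cond[where ?B1.0 = "(240 + worst_cost (try_patterns patterns)) * M ^ 4"])
    show "fits w s (var ''f'')" using f less_w by auto
    assume "eval s (var ''f'') \<noteq> 0"
    then have walk: "closed_4_walk (parcs D) (s ''w0'' []) (s ''w1'' []) (s ''w2'' []) (s ''w3'' [])"
      using f by auto
    then have less: "s ''w0'' [] < t" "s ''w1'' [] < t" "s ''w2'' [] < t" "s ''w3'' [] < t"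
      using arc_D_less by (auto simp: closed_4_walk_def)
    let ?\<sigma> = "walk_step n (s ''w0'' []) (s ''w1'' []) (s ''w2'' []) (s ''w3'' [])"
    have R: "C.core_packing (\<lambda>_. n) (layered n C.A ?\<sigma>)" by (rule C.walk_core_packing[OF walk])
    show "halts w (emit_layers step_on_walk) s ((240 + worst_cost (try_patterns patterns)) * M ^ 4) ?Q"
    proof (rule halts_mono[OF halts_emit_layers[OF s E, where step = step_on_walk and \<sigma> = ?\<sigma>]])
      show "writes step_on_walk \<subseteq> {''q'', ''z''}" by (simp add: w1)
      show "halts w step_on_walk s' 100 (\<lambda>s''. s'' ''q'' [] = ?\<sigma> l u v p)"
        if "l < n" "u < t" "v < t" "p < n" "s' ''l'' [] = l" "s' ''u'' [] = u" "s' ''v'' [] = v" "s' ''p'' [] = p"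
          "prepared s'" "\<And>a. a \<notin> {''l'', ''u'', ''v'', ''p'', ''q'', ''z'', ''A''} \<Longrightarrow> s' a = s a" for l u v p s'
        using that(10)[of "''w0''"] that(10)[of "''w1''"] that(10)[of "''w2''"] that(10)[of "''w3''"] less
        by (intro halts_step_on_walk[OF that(9,5-8) that(1-4)]) simp_all
      show "?\<sigma> l u v p < n" for l u v p using n_pos by (simp add: walk_step_def)
      fix s' assume A': "cells ''A'' s' = cells ''A'' s \<union> (\<Union>l\<in>{0..<n}. coded (s ''E'') l (layered n (parcs D) ?\<sigma> l))"
        and fr: "\<And>a. a \<notin> writes (emit_layers step_on_walk) \<Longrightarrow> s' a = s a"
      have "s' ''E'' = s ''E''" "s' ''K'' = s ''K''" using fr we[OF w1] by auto
      then show "?Q s'" using A' A C.core_packing_cong[OF R, of "\<lambda>u. s ''K'' [u]"] K' by auto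
    qed auto
  next
    assume "eval s (var ''f'') = 0"
    then have no: "\<nexists>a b c d. closed_4_walk (parcs D) a b c d" using f by auto
    obtain x y z where "directed_triangle D x y z" and Q0: "\<not> in_Q0 (composition D H)"
      using core_cases[OF hyp] no by metis
    note corners = directed_triangle_on_012[OF this(1) pverts_D]
    define d where "d = (of_bool ((0, 1) \<in> parcs D) :: nat)"
    define b c where "b = 2 - d" and "c = 1 + d"
    have T: "directed_triangle D 0 b c" using corners(1) by (simp add: b_def c_def d_def)
    have neq: "0 \<noteq> b" "b \<noteq> c" "c \<noteq> 0" and V: "pverts D = {0, b, c}"
      using T by (auto simp: directed_triangle_def)
    have less: "0 < t" "b < t" "c < t" using V pverts_D by auto
    show "halts w (find_corners ;; Cond (Bin Eq (var ''n'') (Num 2)) (try_patterns patterns)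
        (emit_layers step_on_triangle)) s ((240 + worst_cost (try_patterns patterns)) * M ^ 4) ?Q"
    proof (rule halts_Seq[where R = "\<lambda>s1. s1 = exec find_corners s" and ?B1.0 = 20
          and ?B2.0 = "(219 + worst_cost (try_patterns patterns)) * M ^ 4"])
      have "d \<le> 1" by (simp add: d_def)
      then show "halts w find_corners s 20 (\<lambda>s1. s1 = exec find_corners s)"
        using prepared_reads(4)[OF s] bounds(5)
        by (intro halts_loop_free) (auto simp: find_corners_def)
      fix s1 assume s1: "s1 = exec find_corners s"
      have abc: "s1 ''a'' [] = 0" "s1 ''b'' [] = b" "s1 ''c'' [] = c"
        using prepared_reads(4)[OF s] by (auto simp: s1 find_corners_def b_def c_def d_def)
      have p1: "prepared s1" using s by (rule prepared_cong) (auto simp: s1 find_corners_def)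
      have same: "s1 ''E'' = s ''E''" "s1 ''K'' = s ''K''" "cells ''A'' s1 = {}"
        using A by (auto simp: s1 find_corners_def cells_def)
      note n1 = prepared_reads(1)[OF p1]
      show "halts w (Cond (Bin Eq (var ''n'') (Num 2)) (try_patterns patterns)
        (emit_layers step_on_triangle)) s1 ((219 + worst_cost (try_patterns patterns)) * M ^ 4) ?Q"
      proof (rule halts_Cond[where ?B1.0 = "(210 + worst_cost (try_patterns patterns)) * M ^ 4"])
        show "fits w s1 (Bin Eq (var ''n'') (Num 2))" using n1 less_w(2) bounds(5) by auto
        assume "eval s1 (Bin Eq (var ''n'') (Num 2)) \<noteq> 0"
        then have n2: "n = 2" using n1 by (auto split: if_splits)
        have e: "\<And>v p. (s ''E'') [v, p] \<le> w" using E .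
        have cor: "cornered 0 b c (s ''E'') s1"
          using abc p1 same unfolding cornered_def[where e = "s ''E''", OF less e] by simp
        have fits: "C.pattern_fits (corner 0 b c) pat \<longleftrightarrow> eval s1 (pattern_test pat) \<noteq> 0"
          if "pat \<in> set patterns" for pat
          unfolding C.pattern_fits_def pattern_test_decides_fit(2)[where e = "s ''E''", OF less e cor that] N_def ..
        have "\<exists>pat\<in>set patterns. C.pattern_fits (corner 0 b c) pat"
          using C.fitting_pattern_exists[OF T n2 _ Q0] arr by (simp add: pverts_D)
        then have some: "\<exists>pat\<in>set patterns. eval s1 (pattern_test pat) \<noteq> 0" using fits by blast
        obtain pat where pat: "pat \<in> set patterns" "eval s1 (pattern_test pat) \<noteq> 0"
          and safe: "safe w (try_patterns patterns) s1"
          and ex: "exec (try_patterns patterns) s1 = exec (emit_pattern pat) s1"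
          using exec_try_patterns[where e = "s ''E''", OF less e cor order_refl neq some] by blast
        have fit: "C.pattern_fits (corner 0 b c) pat" using fits[OF pat(1)] pat(2) by simp
        note em = exec_emit_pattern[where e = "s ''E''", OF less e cor pat(1) neq]
        let ?s = "exec (emit_pattern pat) s1"
        show "halts w (try_patterns patterns) s1 ((210 + worst_cost (try_patterns patterns)) * M ^ 4) ?Q"
        proof (rule halts_loop_free[OF safe])
          show "worst_cost (try_patterns patterns) \<le> (210 + worst_cost (try_patterns patterns)) * M ^ 4"
            using mult_le_mono[OF _ pos, of "worst_cost (try_patterns patterns)" "210 + worst_cost (try_patterns patterns)"] by simp
          have "C.core_packing (\<lambda>u. ?s ''K'' [u]) (C.pattern_colour (corner 0 b c) pat)"
          proof (rule C.core_packing_cong[OF C.pattern_core_packing[OF T n2 pat(1) fit]])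
            fix u assume "u \<in> C.V"
            then have "u = 0 \<or> u = b \<or> u = c" using V by auto
            then show "?s ''K'' [u] = C.pattern_size (corner 0 b c) pat u"
              using em(2-4) neq by (auto simp: C.pattern_size_def corner_def split: prod.splits)
          qed
          moreover have "cells ''A'' ?s = (\<Union>l\<in>{0..<n}. coded (s ''E'') l (C.pattern_colour (corner 0 b c) pat l))"
          proof -
            have "{0..<n} = {0, 1}" using n2 by auto
            then show ?thesis using em(5) same by (simp add: C.pattern_colour_def case_prod_beta)
          qed
          moreover have "?s ''E'' = s ''E''" using em(6) same by simp
          ultimately show "?Q (exec (try_patterns patterns) s1)" unfolding ex by blast
        qed
      next
        assume "eval s1 (Bin Eq (var ''n'') (Num 2)) = 0"
        then have n2: "n \<noteq> 2" using n1 by (auto split: if_splits)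
        let ?\<sigma> = "triangle_step n 0 b"
        have R: "C.core_packing (\<lambda>_. n) (layered n C.A ?\<sigma>)" by (rule C.triangle_core_packing[OF T n2])
        show "halts w (emit_layers step_on_triangle) s1 ((210 + worst_cost (try_patterns patterns)) * M ^ 4) ?Q"
        proof (rule halts_mono[OF halts_emit_layers[OF p1, where step = step_on_triangle and \<sigma> = ?\<sigma>]])
          show "s1 ''E'' [v, p] \<le> w" for v p using E same by simp
          show "writes step_on_triangle \<subseteq> {''q'', ''z''}" by (simp add: w2)
          show "halts w step_on_triangle s' 100 (\<lambda>s''. s'' ''q'' [] = ?\<sigma> l u v p)"
            if "l < n" "u < t" "v < t" "p < n" "s' ''l'' [] = l" "s' ''u'' [] = u" "s' ''v'' [] = v" "s' ''p'' [] = p"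
              "prepared s'" "\<And>a. a \<notin> {''l'', ''u'', ''v'', ''p'', ''q'', ''z'', ''A''} \<Longrightarrow> s' a = s1 a" for l u v p s'
            using that(10)[of "''a''"] that(10)[of "''b''"] abc less
            by (intro halts_step_on_triangle[OF that(9,5-8) that(1-4)]) simp_all
          show "?\<sigma> l u v p < n" for l u v p using n_pos by (simp add: triangle_step_def)
          fix s' assume A': "cells ''A'' s' = cells ''A'' s1 \<union> (\<Union>l\<in>{0..<n}. coded (s1 ''E'') l (layered n (parcs D) ?\<sigma> l))"
            and fr: "\<And>a. a \<notin> writes (emit_layers step_on_triangle) \<Longrightarrow> s' a = s1 a"
          have "s' ''E'' = s1 ''E''" "s' ''K'' = s1 ''K''" using fr we[OF w2] by auto
          then show "?Q s'" using A' same C.core_packing_cong[OF R, of "\<lambda>u. s ''K'' [u]"] K' by auto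
        qed auto
      next
        show "1 + cost (Bin Eq (var ''n'') (Num 2)) + (210 + worst_cost (try_patterns patterns)) * M ^ 4
            \<le> (219 + worst_cost (try_patterns patterns)) * M ^ 4"
          using pos by (simp add: distrib_right)
      qed
    next
      show "1 + 20 + (219 + worst_cost (try_patterns patterns)) * M ^ 4 \<le> (240 + worst_cost (try_patterns patterns)) * M ^ 4"
        using pos by (simp add: distrib_right)
    qed
  next
    show "1 + cost (var ''f'') + (240 + worst_cost (try_patterns patterns)) * M ^ 4
        \<le> (250 + worst_cost (try_patterns patterns)) * M ^ 4"
      using pos by (simp add: distrib_right)
  qed
qed

lemma halts_main:
  assumes s: "prepared s" and init: "s ''E'' = (\<lambda>_. 0)" "s ''A'' = (\<lambda>_. 0)" "s ''V'' = (\<lambda>_. 0)"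
  shows "halts w (all_vertices ;; number_parts ;; find_walk ;; core_phase ;; emit_spread) s
    ((800 + worst_cost (try_patterns patterns)) * M ^ 4) (\<lambda>s'.
      cells ''V'' s' = {[l, u, p] | l u p. l < n \<and> u < t \<and> p < N u} \<and>
      (\<exists>e k R. numbered_composition D H (\<lambda>u p. e [u, p]) n \<and>
        numbered_composition.core_packing D H (\<lambda>u p. e [u, p]) n k R \<and>
        cells ''A'' s' = (\<Union>l\<in>{0..<n}. coded e l (R l \<union> spread_on k l))))"
    (is "halts w _ s _ ?Q")
proof -
  let ?P = "worst_cost (try_patterns patterns)"
  have pow: "1 \<le> M ^ 4" "M ^ 3 \<le> M ^ 4" using bounds by (auto intro: power_increasing)
  have X: "(c + ?P) * M ^ 4 = c * M ^ 4 + ?P * M ^ 4" for c by (rule distrib_right)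
  have wr: "writes all_vertices = {''l'', ''u'', ''p'', ''V''}"
    "writes number_parts = {''u'', ''g'', ''K'', ''p'', ''q'', ''x'', ''y'', ''E''}"
    "writes find_walk = {''f'', ''a'', ''b'', ''c'', ''d'', ''w0'', ''w1'', ''w2'', ''w3''}"
    "writes emit_spread = {''l'', ''u'', ''v'', ''p'', ''A''}"
    by (auto simp: all_vertices_def number_parts_def number_part_def arrange_part_def find_walk_def
        emit_spread_def emit_def)
  have wp: "writes (try_patterns ps) \<subseteq> {''K'', ''A''}" for ps
  proof (induction ps)
    case (Cons pat ps)
    have "writes (emit_arcs l es) \<subseteq> {''A''}" for l es
      by (induction es) (auto simp: emit_arcs_def emit_def)
    then have "writes (emit_pattern pat) \<subseteq> {''K'', ''A''}"
      by (fastforce simp: emit_pattern_def split: prod.splits)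
    then show ?case using Cons by (simp add: try_patterns_def)
  qed (simp add: try_patterns_def)
  have wc: "writes core_phase \<subseteq> {''K'', ''A'', ''a'', ''b'', ''c'', ''l'', ''u'', ''v'', ''p'', ''q'', ''z''}"
    using wp[of patterns]
    by (auto simp: core_phase_def emit_layers_def emit_def find_corners_def step_on_walk_def
        step_on_triangle_def twist_code_def middle_shift_code_def last_shift_code_def)
  show ?thesis
  proof (rule halts_Seq[OF halts_all_vertices[OF s], where ?B2.0 = "(700 + ?P) * M ^ 4"])
    fix s1 assume V1: "cells ''V'' s1 = cells ''V'' s \<union> (\<Union>l\<in>{0..<n}. \<Union>u\<in>{0..<t}. \<Union>p\<in>{0..<N u}. {[l, u, p]})"
      and "\<And>a. a \<notin> writes all_vertices \<Longrightarrow> s1 a = s a"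
    then have fr1: "\<And>a. a \<notin> {''l'', ''u'', ''p'', ''V''} \<Longrightarrow> s1 a = s a" by (simp add: wr)
    have s1: "prepared s1" using s by (rule prepared_cong) (auto simp: fr1)
    have V1: "cells ''V'' s1 = {[l, u, p] | l u p. l < n \<and> u < t \<and> p < N u}"
      unfolding V1 by (auto simp: init cells_def)
    have E1: "s1 ''E'' [v, p] \<le> w" for v p by (simp add: fr1 init)
    show "halts w (number_parts ;; find_walk ;; core_phase ;; emit_spread) s1 ((700 + ?P) * M ^ 4) ?Q"
    proof (rule halts_Seq[OF halts_number_parts[OF s1 E1], where ?B2.0 = "(520 + ?P) * M ^ 4"])
      fix s2 assume R2: "(\<forall>u<t. arranged (H u) (\<lambda>p. s2 ''E'' [u, p]) \<and> s2 ''K'' [u] = n) \<and>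
          (\<forall>v p. s2 ''E'' [v, p] \<le> w)"
        and "\<And>a. a \<notin> writes number_parts \<Longrightarrow> s2 a = s1 a"
      then have fr2: "\<And>a. a \<notin> {''u'', ''g'', ''K'', ''p'', ''q'', ''x'', ''y'', ''E''} \<Longrightarrow> s2 a = s1 a"
        by (simp add: wr)
      have s2: "prepared s2" using s1 by (rule prepared_cong) (auto simp: fr2)
      show "halts w (find_walk ;; core_phase ;; emit_spread) s2 ((520 + ?P) * M ^ 4) ?Q"
      proof (rule halts_Seq[OF halts_find_walk[OF s2], where ?B2.0 = "(390 + ?P) * M ^ 4"])
        fix s3 assume R3: "(s3 ''f'' [] = 0 \<and> (\<nexists>a b c d. closed_4_walk (parcs D) a b c d)) \<or>
            (s3 ''f'' [] = 1 \<and> closed_4_walk (parcs D) (s3 ''w0'' []) (s3 ''w1'' []) (s3 ''w2'' []) (s3 ''w3'' []))"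
          and "\<And>a. a \<notin> writes find_walk \<Longrightarrow> s3 a = s2 a"
        then have fr3: "\<And>a. a \<notin> {''f'', ''a'', ''b'', ''c'', ''d'', ''w0'', ''w1'', ''w2'', ''w3''} \<Longrightarrow> s3 a = s2 a"
          by (simp add: wr)
        have s3: "prepared s3" using s2 by (rule prepared_cong) (auto simp: fr3)
        have E3: "s3 ''E'' [v, p] \<le> w" for v p using R2 by (simp add: fr3)
        have arr3: "arranged (H u) (\<lambda>p. s3 ''E'' [u, p])" if "u < t" for u using R2 that by (simp add: fr3)
        have K3: "s3 ''K'' [u] = n" if "u < t" for u using R2 that by (simp add: fr3)
        have A3: "cells ''A'' s3 = {}" by (simp add: cells_def fr3 fr2 fr1 init)
        let ?e = "s3 ''E''"
        have num: "numbered_composition D H (\<lambda>u p. ?e [u, p]) n"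
          using numbered_compositionI[OF hyp, of "\<lambda>u p. ?e [u, p]"] n_pos arr3
          by (simp add: n_def pverts_D)
        interpret C: numbered_composition D H "\<lambda>u p. ?e [u, p]" n by (rule num)
        show "halts w (core_phase ;; emit_spread) s3 ((390 + ?P) * M ^ 4) ?Q"
        proof (rule halts_Seq[OF halts_core_phase[OF s3 E3 arr3 K3 A3 R3], where ?B2.0 = "128 * M ^ 4"])
          fix s4 assume R4: "s4 ''E'' = ?e \<and> (\<exists>R. C.core_packing (\<lambda>u. s4 ''K'' [u]) R \<and>
              cells ''A'' s4 = (\<Union>l\<in>{0..<n}. coded ?e l (R l)))"
            and fr: "\<And>a. a \<notin> writes core_phase \<Longrightarrow> s4 a = s3 a"
          have fr4: "\<And>a. a \<notin> {''K'', ''A'', ''a'', ''b'', ''c'', ''l'', ''u'', ''v'', ''p'', ''q'', ''z''} \<Longrightarrow>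
              s4 a = s3 a"
            by (rule fr, rule contra_subsetD[OF wc])
          have s4: "prepared s4" using s3 by (rule prepared_cong) (auto simp: fr4)
          obtain R where R: "C.core_packing (\<lambda>u. s4 ''K'' [u]) R"
            and A4: "cells ''A'' s4 = (\<Union>l\<in>{0..<n}. coded ?e l (R l))" and E4: "s4 ''E'' = ?e"
            using R4 by blast
          have K4: "s4 ''K'' [u] \<le> N u" if "u < t" for u
            using C.core_packing_bounds(2)[OF R] that by (simp add: pverts_D N_def)
          show "halts w emit_spread s4 (128 * M ^ 4) ?Q"
          proof (rule halts_mono[OF halts_emit_spread[OF s4]])
            show "s4 ''E'' [v, p] \<le> w" for v p using E3 by (simp add: E4)
            show "s4 ''K'' [u] \<le> N u" if "u < t" for u using K4 that .
            fix s5 assume A5: "cells ''A'' s5 = cells ''A'' s4 \<union>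
                (\<Union>l\<in>{0..<n}. coded (s4 ''E'') l (spread_on (\<lambda>u. s4 ''K'' [u]) l))"
              and "\<And>a. a \<notin> writes emit_spread \<Longrightarrow> s5 a = s4 a"
            then have "s5 ''V'' = s4 ''V''" by (simp add: wr)
            then have "cells ''V'' s5 = {[l, u, p] | l u p. l < n \<and> u < t \<and> p < N u}"
              using V1 by (simp add: cells_def fr4 fr3 fr2)
            moreover have "cells ''A'' s5 = (\<Union>l\<in>{0..<n}. coded ?e l (R l \<union> spread_on (\<lambda>u. s4 ''K'' [u]) l))"
              unfolding A5 A4 E4 coded_Un by (simp add: UN_Un_distrib)
            ultimately show "?Q s5" using num R by blast
          qed simp
        next
          show "1 + (250 + ?P) * M ^ 4 + 128 * M ^ 4 \<le> (390 + ?P) * M ^ 4"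
            using pow unfolding X by linarith
        qed
      next
        show "1 + 120 * M ^ 4 + (390 + ?P) * M ^ 4 \<le> (520 + ?P) * M ^ 4" using pow unfolding X by linarith
      qed
    next
      show "1 + 170 * M ^ 3 + (520 + ?P) * M ^ 4 \<le> (700 + ?P) * M ^ 4" using pow unfolding X by linarith
    qed
  next
    show "1 + 65 * M ^ 3 + (700 + ?P) * M ^ 4 \<le> (800 + ?P) * M ^ 4" using pow unfolding X by linarith
  qed
qed

text \<open>
  The output is read back as the extension of the core packing, to which \<open>core_packing_extends\<close> applies.
\<close>

lemma output_is_packing:
  assumes V: "cells ''V'' s = {[l, u, p] | l u p. l < n \<and> u < t \<and> p < N u}"
    and num: "numbered_composition D H (\<lambda>u p. e [u, p]) n"
    and R: "numbered_composition.core_packing D H (\<lambda>u p. e [u, p]) n k R"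
    and A: "cells ''A'' s = (\<Union>l\<in>{0..<n}. coded e l (R l \<union> spread_on k l))"
    and count: "s ''count'' [] = n"
  shows "arc_disjoint_strong_subgraphs (composition D H) S (output_subgraphs s)"
    and "card (output_subgraphs s) = n"
proof -
  interpret C: numbered_composition D H "\<lambda>u p. e [u, p]" n by (rule num)
  have spread: "C.spread k l = spread_on k l" for l
    by (simp add: C.spread_def spread_on_def N_def)
  have "output_subgraph s l = C.packed k R l" if l: "l < n" for l
  proof -
    have "s ''V'' [l, u, p] \<noteq> 0 \<longleftrightarrow> u < t \<and> p < N u" for u p
    proof -
      have "s ''V'' [l, u, p] \<noteq> 0 \<longleftrightarrow> [l, u, p] \<in> cells ''V'' s" by (simp add: cells_def)
      then show ?thesis unfolding V using l by auto
    qed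
    then have "pverts (output_subgraph s l) = pverts (composition D H)"
      by (auto simp: output_subgraph_def composition_def pverts_D pverts_H)
    moreover have "parcs (output_subgraph s l) = map_prod C.vertex C.vertex ` (R l \<union> C.spread k l)"
    proof (intro set_eqI)
      fix x :: "(nat \<times> nat) \<times> nat \<times> nat"
      obtain i p j q where x: "x = ((i, p), (j, q))" by (metis surj_pair)
      have "x \<in> parcs (output_subgraph s l) \<longleftrightarrow> [l, i, p, j, q] \<in> cells ''A'' s"
        by (simp add: x output_subgraph_def cells_def)
      also have "\<dots> \<longleftrightarrow> [l, i, p, j, q] \<in> coded e l (R l \<union> spread_on k l)"
        unfolding A using l by (auto dest: coded_head)
      also have "\<dots> \<longleftrightarrow> x \<in> map_prod C.vertex C.vertex ` (R l \<union> C.spread k l)"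
      proof -
        have "[l, i, p, j, q] \<in> coded e l Z \<longleftrightarrow> ((i, p), (j, q)) \<in> map_prod C.vertex C.vertex ` Z" for Z
          unfolding coded_def C.vertex_def by (force simp: image_iff case_prod_beta)
        then show ?thesis by (simp only: spread x)
      qed
      finally show "x \<in> parcs (output_subgraph s l) \<longleftrightarrow> x \<in> map_prod C.vertex C.vertex ` (R l \<union> C.spread k l)" .
    qed
    ultimately show ?thesis by (simp add: C.packed_def)
  qed
  then have out: "output_subgraphs s = C.packed k R ` {..<n}"
    unfolding output_subgraphs_def count by (intro image_cong) auto
  have "S \<subseteq> pverts (composition D H)" using hyp by (simp add: packing_hypotheses_def)
  from C.core_packing_extends[OF R this]
  show "arc_disjoint_strong_subgraphs (composition D H) S (output_subgraphs s)"
    and "card (output_subgraphs s) = n" unfolding out by auto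
qed

end

lemma (in packing_instance) halts_program:
  "halts w program (input_state D H S) ((1000 + worst_cost (try_patterns patterns)) * M ^ 4) (\<lambda>s.
     arc_disjoint_strong_subgraphs (composition D H) S (output_subgraphs s) \<and>
     n \<le> card (output_subgraphs s))"
  (is "halts w _ ?s _ ?Q")
proof -
  let ?P = "worst_cost (try_patterns patterns)"
  let ?main = "all_vertices ;; number_parts ;; find_walk ;; core_phase ;; emit_spread"
  have program: "program = minimum ;; ''count'' ::= var ''n'' ;; Cond (var ''n'') ?main Skip"
    by (simp add: program_def)
  have pow: "1 \<le> M ^ 4" "M \<le> M ^ 4" using M_ge2 self_le_power[of M 4] by auto
  have X: "(c + ?P) * M ^ 4 = c * M ^ 4 + ?P * M ^ 4" for c by (rule distrib_right)
  have nw: "n \<le> w" using n_le_M w_ge by linarith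
  have kept: "input_kept ?s" by (simp add: input_kept_def)
  have w_min: "writes minimum = {''n'', ''u''}" by (auto simp: minimum_def)
  have w_main: "''count'' \<notin> writes ?main"
  proof -
    have "''count'' \<notin> writes (try_patterns ps)" for ps
    proof (induction ps)
      case (Cons pat ps)
      have "''count'' \<notin> writes (emit_arcs l es)" for l es
        by (induction es) (auto simp: emit_arcs_def emit_def)
      then show ?case using Cons by (auto simp: try_patterns_def emit_pattern_def split: prod.splits)
    qed (simp add: try_patterns_def)
    then show ?thesis
      by (auto simp: core_phase_def emit_layers_def emit_def find_corners_def step_on_walk_def
        step_on_triangle_def twist_code_def middle_shift_code_def last_shift_code_def
        all_vertices_def number_parts_def number_part_def arrange_part_def find_walk_def emit_spread_def)
  qed
  show ?thesis
    unfolding program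
  proof (rule halts_Seq[OF halts_minimum[OF kept], where ?B2.0 = "(850 + ?P) * M ^ 4"])
    fix s1 assume n1: "s1 ''n'' [] = n" and "\<And>a. a \<notin> writes minimum \<Longrightarrow> s1 a = ?s a"
    then have fr1: "\<And>a. a \<notin> {''n'', ''u''} \<Longrightarrow> s1 a = ?s a" by (simp add: w_min)
    show "halts w (''count'' ::= var ''n'' ;; Cond (var ''n'') ?main Skip) s1 ((850 + ?P) * M ^ 4) ?Q"
    proof (rule halts_Seq[where R = "\<lambda>s2. s2 = set_var ''count'' n s1" and ?B1.0 = 2
          and ?B2.0 = "(830 + ?P) * M ^ 4"])
      show "halts w (''count'' ::= var ''n'') s1 2 (\<lambda>s2. s2 = set_var ''count'' n s1)"
        using n1 nw by (intro halts_assign) auto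
      fix s2 assume s2: "s2 = set_var ''count'' n s1"
      show "halts w (Cond (var ''n'') ?main Skip) s2 ((830 + ?P) * M ^ 4) ?Q"
      proof (rule halts_Cond[where ?B1.0 = "(800 + ?P) * M ^ 4"])
        show "fits w s2 (var ''n'')" using n1 nw by (simp add: s2)
        assume "eval s2 (var ''n'') \<noteq> 0"
        then have "0 < n" using n1 by (simp add: s2)
        then interpret nonempty_packing_instance D H S by unfold_locales
        have p2: "prepared s2"
          using kept n1 by (auto simp: prepared_def input_kept_def s2 fr1)
        show "halts w ?main s2 ((800 + ?P) * M ^ 4) ?Q"
        proof (rule halts_mono[OF halts_main[OF p2]])
          show "s2 ''E'' = (\<lambda>_. 0)" "s2 ''A'' = (\<lambda>_. 0)" "s2 ''V'' = (\<lambda>_. 0)"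
            by (auto simp: s2 fr1 input_state_def)
          fix s3 assume R3: "cells ''V'' s3 = {[l, u, p] | l u p. l < n \<and> u < t \<and> p < N u} \<and>
            (\<exists>e k R. numbered_composition D H (\<lambda>u p. e [u, p]) n \<and>
              numbered_composition.core_packing D H (\<lambda>u p. e [u, p]) n k R \<and>
              cells ''A'' s3 = (\<Union>l\<in>{0..<n}. coded e l (R l \<union> spread_on k l)))"
            and fr3: "\<And>a. a \<notin> writes ?main \<Longrightarrow> s3 a = s2 a"
          have "s3 ''count'' [] = n" using fr3[OF w_main] by (simp add: s2)
          then show "?Q s3" using R3 output_is_packing[of s3] by auto
        qed simp
      next
        assume "eval s2 (var ''n'') = 0"
        then have "n = 0" "s2 ''count'' [] = 0" using n1 by (auto simp: s2)
        then have "?Q s2" by (simp add: output_subgraphs_def arc_disjoint_strong_subgraphs_def)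
        then show "halts w Skip s2 ((800 + ?P) * M ^ 4) ?Q" using pow(1) by (intro halts_Skip) auto
      next
        show "1 + cost (var ''n'') + (800 + ?P) * M ^ 4 \<le> (830 + ?P) * M ^ 4"
          using pow unfolding X by simp
      qed
    next
      show "1 + 2 + (830 + ?P) * M ^ 4 \<le> (850 + ?P) * M ^ 4" using pow unfolding X by linarith
    qed
  next
    show "1 + 100 * M + (850 + ?P) * M ^ 4 \<le> (1000 + ?P) * M ^ 4" using pow unfolding X by linarith
  qed
qed

theorem packing_algorithm_program: "packing_algorithm program"
  unfolding packing_algorithm_def
proof (intro exI allI impI)
  fix D :: "nat pair_pre_digraph" and H :: "nat \<Rightarrow> nat pair_pre_digraph" and S :: "(nat \<times> nat) set"
  assume "packing_hypotheses D H S \<and> standard_labels D H"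
  then interpret packing_instance D H S by unfold_locales auto
  show "let Q = composition D H; n = card (pverts Q); t = card (pverts D) in
         \<exists>T s. runs (100 * (n + t) ^ 1) program (input_state D H S) T s \<and>
           T \<le> (1000 + worst_cost (try_patterns patterns)) * n ^ 4 \<and>
           arc_disjoint_strong_subgraphs Q S (output_subgraphs s) \<and>
           min_part D H \<le> card (output_subgraphs s)"
    using halts_program by (simp add: halts_def w_def M_def t_def n_def Let_def)
qed

theorem theorem4p7:
  shows "(\<forall>(D :: 'a pair_pre_digraph) (H :: 'a \<Rightarrow> 'b pair_pre_digraph) S.
            packing_hypotheses D H S \<longrightarrow>
            (\<exists>\<F>. arc_disjoint_strong_subgraphs (composition D H) S \<F> \<and>
                 min_part D H \<le> card \<F>))
       \<and> (\<exists>P. packing_algorithm P)"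
  using packing_exists packing_algorithm_program by blast

end
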